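(* Assume that either $\phi\in L^2(\mathbb R)\cap L^{2+\varepsilon}(\mathbb R)$ for some $\varepsilon>0$ and $\psi\in L^2(\mathbb R)\cap L^\infty(\mathbb R)$, or $\phi,\psi\in L^2(\mathbb R)\cap L^4(\mathbb R)$. Let $E_0$ be the set of all $\alpha\in\mathbb C$ for which there is a set $E\subseteq\mathbb R$ of positive Lebesgue measure such that $$1+2\pi i\alpha\big(P_+(\overline\phi\psi)-\psi\,P_+(\overline\phi)\big)=0\quad\text{on }E .$$ If $\alpha\in E_0$, then $\dim(\mathcal S_\alpha^\perp)=+\infty$, where $\overline{\mathcal S}_\alpha$ is the detectable subspace of the Friedrichs model with data $\phi,\alpha\psi$.
   Context: Riesz projections: $P_\pm f(k)=\pm\frac1{2\pi i}\lim_{\varepsilon\to0^+}\int_{\mathbb R}\frac{f(x)}{x-(k\pm i\varepsilon)}dx$; on $L^2(\mathbb R)$ these are the projections onto the Hardy spaces $H_2^\pm(\mathbb R)$ of boundary values from the upper/lower half-plane. Friedrichs model with data $\phi,\psi\in L^2(\mathbb R)$: $\langle f,g\rangle=\int_{\mathbb R}f\overline g\,dx$. Let $\mathcal D=\{f\in L^2(\mathbb R):\exists c_f\in\mathbb C,\ xf(x)-c_f\mathbf 1\in L^2(\mathbb R)\}$; $c_f$ is uniquely determined. Let $(\widetilde A^*f)(x)=xf(x)-c_f+\langle f,\phi\rangle\psi(x)$ on $\mathcal D$, $\Gamma_1u=\lim_{R\to\infty}\int_{-R}^Ru\,dx$, $\Gamma_2u=c_u$. For $B\in\mathbb C$, $A_B$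 is the restriction of $\widetilde A^*$ to $\{u\in\mathcal D:\Gamma_1u=B\Gamma_2u\}$, and for $\lambda\in\rho(A_B)$ the solution operator $S_{\lambda,B}:\mathbb C\to\ker(\widetilde A^*-\lambda)$ is defined by $(\widetilde A^*-\lambda)S_{\lambda,B}f=0$, $(\Gamma_1-B\Gamma_2)S_{\lambda,B}f=f$. The detectable subspace $\overline{\mathcal S}$ is the closed linear span in $L^2(\mathbb R)$ of all $\mathrm{Ran}(S_{\lambda,B})$, $B\in\mathbb C$, $\lambda\in\rho(A_B)$; equivalently $\mathcal S^\perp=\bigcap_{B}\bigcap_{\lambda\in\rho(A_B)}\ker(S_{\lambda,B}^* )$. $\overline{\mathcal S}_\alpha$ denotes this space when $\psi$ is replaced by $\alpha\psi$. *)

theory Defs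
  imports "HOL-Analysis.Analysis" "HOL-Library.Function_Algebras"
begin

section \<open>Lebesgue spaces on the real line\<close>

text \<open>
  Elements of \<open>L\<^sup>p(\<real>)\<close> are represented by Lebesgue measurable functions; two representatives are
  identified when they agree almost everywhere, and this identification is made explicit
  (by \<open>AE\<close> or by the \<open>L\<^sup>2\<close> seminorm) wherever it matters.
\<close>

definition Lp :: "real \<Rightarrow> (real \<Rightarrow> complex) set" where
  "Lp p = {f \<in> borel_measurable lebesgue. integrable lebesgue (\<lambda>x. norm (f x) powr p)}"

definition Linfty :: "(real \<Rightarrow> complex) set" where
  "Linfty = {f \<in> borel_measurable lebesgue. \<exists>C. AE x in lebesgue. norm (f x) \<le> C}"

definition L2_inner :: "(real \<Rightarrow> complex) \<Rightarrow> (real \<Rightarrow> complex) \<Rightarrow> complex" where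
  "L2_inner f g = (LINT x|lebesgue. f x * cnj (g x))"

definition L2_norm :: "(real \<Rightarrow> complex) \<Rightarrow> real" where
  "L2_norm f = sqrt (LINT x|lebesgue. (norm (f x))\<^sup>2)"

definition cscale :: "complex \<Rightarrow> (real \<Rightarrow> complex) \<Rightarrow> real \<Rightarrow> complex" where
  "cscale c f = (\<lambda>x. c * f x)"

interpretation cfun: vector_space cscale
  by unfold_locales (auto simp: cscale_def fun_eq_iff algebra_simps)

definition L2_closed_span :: "(real \<Rightarrow> complex) set \<Rightarrow> (real \<Rightarrow> complex) set" where
  "L2_closed_span V = {f \<in> Lp 2. \<forall>\<epsilon>>0. \<exists>g \<in> cfun.span V. L2_norm (f - g) < \<epsilon>}"

definition L2_orth_compl :: "(real \<Rightarrow> complex) set \<Rightarrow> (real \<Rightarrow> complex) set" where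
  "L2_orth_compl V = {f \<in> Lp 2. \<forall>g \<in> V. L2_inner f g = 0}"

text \<open>Dimension is that of the space of almost-everywhere classes of members of \<open>V\<close>.\<close>

definition infinite_dim_ae :: "(real \<Rightarrow> complex) set \<Rightarrow> bool" where
  "infinite_dim_ae V \<longleftrightarrow>
     \<not> (\<exists>F. finite F \<and> F \<subseteq> V \<and> (\<forall>f \<in> V. \<exists>g \<in> cfun.span F. AE x in lebesgue. f x = g x))"


section \<open>The Riesz projection onto the Hardy space of the upper half-plane\<close>

text \<open>
  For \<open>f \<in> L\<^sup>2(\<real>)\<close> the limit exists for almost every \<open>k\<close>; elsewhere the value is arbitrary.
\<close>

definition riesz_plus :: "(real \<Rightarrow> complex) \<Rightarrow> real \<Rightarrow> complex" where
  "riesz_plus f k =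
     1 / (2 * of_real pi * \<i>) *
     Lim (at_right 0) (\<lambda>\<epsilon>::real. LINT x|lebesgue. f x / (of_real x - (of_real k + \<i> * of_real \<epsilon>)))"


section \<open>The Friedrichs model\<close>

definition friedrichs_dom :: "(real \<Rightarrow> complex) set" where
  "friedrichs_dom = {f \<in> Lp 2. \<exists>c. (\<lambda>x. of_real x * f x - c) \<in> Lp 2}"

definition bdry_const :: "(real \<Rightarrow> complex) \<Rightarrow> complex" where
  "bdry_const f = (THE c. (\<lambda>x. of_real x * f x - c) \<in> Lp 2)"

definition friedrichs_max ::
    "(real \<Rightarrow> complex) \<Rightarrow> (real \<Rightarrow> complex) \<Rightarrow> (real \<Rightarrow> complex) \<Rightarrow> real \<Rightarrow> complex" where
  "friedrichs_max \<phi> \<psi> f = (\<lambda>x. of_real x * f x - bdry_const f + L2_inner f \<phi> * \<psi> x)"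

definition Gamma1 :: "(real \<Rightarrow> complex) \<Rightarrow> complex" where
  "Gamma1 u = Lim at_top (\<lambda>R::real. LINT x:{-R..R}|lebesgue. u x)"

definition Gamma2 :: "(real \<Rightarrow> complex) \<Rightarrow> complex" where
  "Gamma2 u = bdry_const u"

text \<open>The operator \<open>A\<^sub>B\<close> is \<open>friedrichs_max \<phi> \<psi>\<close> restricted to the following domain.\<close>

definition A_dom :: "complex \<Rightarrow> (real \<Rightarrow> complex) set" where
  "A_dom B = {u \<in> friedrichs_dom. Gamma1 u = B * Gamma2 u}"

text \<open>
  The resolvent set of an operator \<open>T\<close> in \<open>L\<^sup>2(\<real>)\<close> with domain \<open>D\<close>: the points \<open>\<mu>\<close> for which
  \<open>T - \<mu>\<close> is injective and onto \<open>L\<^sup>2(\<real>)\<close> with bounded inverse.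
\<close>

definition resolvent_set ::
    "(real \<Rightarrow> complex) set \<Rightarrow> ((real \<Rightarrow> complex) \<Rightarrow> real \<Rightarrow> complex) \<Rightarrow> complex set" where
  "resolvent_set D T = {\<mu>.
     (\<forall>u \<in> D. (AE x in lebesgue. T u x - \<mu> * u x = 0) \<longrightarrow> (AE x in lebesgue. u x = 0)) \<and>
     (\<forall>g \<in> Lp 2. \<exists>u \<in> D. AE x in lebesgue. T u x - \<mu> * u x = g x) \<and>
     (\<exists>C. \<forall>u \<in> D. L2_norm u \<le> C * L2_norm (\<lambda>x. T u x - \<mu> * u x))}"

definition rho_A :: "(real \<Rightarrow> complex) \<Rightarrow> (real \<Rightarrow> complex) \<Rightarrow> complex \<Rightarrow> complex set" where
  "rho_A \<phi> \<psi> B = resolvent_set (A_dom B) (friedrichs_max \<phi> \<psi>)"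

text \<open>
  For \<open>\<mu> \<in> rho_A \<phi> \<psi> B\<close> the solution below is unique up to null sets; \<open>SOME\<close> only picks a
  representative of its class.
\<close>

definition solution_op ::
    "(real \<Rightarrow> complex) \<Rightarrow> (real \<Rightarrow> complex) \<Rightarrow> complex \<Rightarrow> complex \<Rightarrow> complex \<Rightarrow> real \<Rightarrow> complex" where
  "solution_op \<phi> \<psi> \<mu> B z = (SOME u. u \<in> friedrichs_dom \<and>
     (AE x in lebesgue. friedrichs_max \<phi> \<psi> u x - \<mu> * u x = 0) \<and>
     Gamma1 u - B * Gamma2 u = z)"

definition detectable_space ::
    "(real \<Rightarrow> complex) \<Rightarrow> (real \<Rightarrow> complex) \<Rightarrow> (real \<Rightarrow> complex) set" where
  "detectable_space \<phi> \<psi> =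
     L2_closed_span (\<Union>B. \<Union>\<mu> \<in> rho_A \<phi> \<psi> B. range (solution_op \<phi> \<psi> \<mu> B))"

definition exceptional_set :: "(real \<Rightarrow> complex) \<Rightarrow> (real \<Rightarrow> complex) \<Rightarrow> complex set" where
  "exceptional_set \<phi> \<psi> = {\<alpha>. \<exists>E \<in> sets lebesgue. emeasure lebesgue E > 0 \<and>
     (AE k in lebesgue. k \<in> E \<longrightarrow>
        1 + 2 * of_real pi * \<i> * \<alpha> *
          (riesz_plus (\<lambda>x. cnj (\<phi> x) * \<psi> x) k - \<psi> k * riesz_plus (\<lambda>x. cnj (\<phi> x)) k) = 0)}"

end

theory Submission
  imports Defs "HOL-Complex_Analysis.Complex_Analysis"
begin

text \<open>
  Replace \<open>\<psi>\<close> by \<open>\<alpha> \<psi>\<close> and write \<open>C f (z) = \<integral> f(x) / (x - z) dx\<close>, \<open>N = C (cnj \<phi>)\<close>, \<open>D = 1 + C (cnj \<phi> \<psi>)\<close>. Elements of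
  the kernel of the operator at a nonreal \<open>\<mu>\<close> have the form \<open>(c - d \<psi>) / (x - \<mu>)\<close> with \<open>d D(\<mu>) = c N(\<mu>)\<close>, so they are
  annihilated by every \<open>h\<close> for which \<open>C h = N g\<close> and \<open>C (\<psi> h) = D g\<close> off the real line, with a common factor \<open>g\<close>.
  By the Plemelj relation \<open>D - \<psi> N\<close> has the same boundary values from both sides, and they vanish on the
  exceptional set \<open>E\<close>. Let \<open>G\<close> be a bounded analytic function off the real line whose two boundary values
  agree off \<open>E\<close>. Then the jumps \<open>h\<close> of \<open>N G\<^sup>n\<close> and \<open>k\<close> of \<open>D G\<^sup>n\<close> satisfy \<open>k = \<psi> h\<close> almost everywhere, and
  both functions are the Cauchy transforms of their jumps. Letting \<open>n\<close> vary gives infinitely many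
  linearly independent \<open>h\<close>, because \<open>G\<close> takes infinitely many values. Almost everywhere existence of the boundary
  values is a maximal-function argument: the \<open>L\<^sup>2\<close> bound for \<open>C\<close> on horizontal lines, the Poisson formula and
  the Vitali covering lemma reduce it to indicators of intervals, whose Cauchy transforms are logarithms.
\<close>

section \<open>Square-integrable functions\<close>

text \<open>The exceptional condition mentions upper boundary values only: it says that
  \<open>D = \<psi> N\<close> holds from above on \<open>E\<close>, and the absence of a jump of
  \<open>D - \<psi> N\<close> carries it to the lower side. Two obstacles shape the choice of
  \<open>G\<close>. A function is recovered from its jump here only if it is square integrable on
  horizontal lines, uniformly in the height. Since \<open>D\<close> contains the summand 1,
  \<open>G\<close> itself must have this property; hence the numerator \<open>w\<close> in
  \<open>w / (w - c)\<close>, and powers of \<open>G\<close> that start at 1. Moreover,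
  \<open>\<psi>\<close> need not be bounded, so \<open>\<psi> h\<close> is not visibly in L^2; it is
  shown to be so by identifying it with the jump of \<open>D G^n\<close>. The transforms are
  evaluated off the real line, so real points must be kept out of every resolvent set: each of them
  is an approximate eigenvalue of every \<open>A_B\<close>. The L^2 bound for \<open>C\<close> uses
  no Fourier transform but the identity for \<open>T^* T\<close> and a doubling of the height. The
  maximal inequality starts from a line of positive height, because a boundary function is available
  only after it has been proved.\<close>

definition sqnorm :: "(real \<Rightarrow> complex) \<Rightarrow> real" where
  "sqnorm f = (LINT x|lebesgue. (norm (f x))\<^sup>2)"

lemma Lp2_iff: "f \<in> Lp 2 \<longleftrightarrow> f \<in> borel_measurable lebesgue \<and> integrable lebesgue (\<lambda>x. (norm (f x))\<^sup>2)"
  by (simp add: Lp_def)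

lemma Lp2_measurable [measurable_dest]: "f \<in> Lp 2 \<Longrightarrow> f \<in> borel_measurable lebesgue"
  and Lp2_integrable: "f \<in> Lp 2 \<Longrightarrow> integrable lebesgue (\<lambda>x. (norm (f x))\<^sup>2)"
  by (simp_all add: Lp2_iff)

lemma sqnorm_nonneg [simp]: "0 \<le> sqnorm f"
  by (simp add: sqnorm_def)

lemma L2_norm_eq_sqrt_sqnorm: "L2_norm f = sqrt (sqnorm f)"
  by (simp add: L2_norm_def sqnorm_def)

lemma measurable_lebesgue_ident [measurable]: "(\<lambda>x::real. x) \<in> borel_measurable lebesgue"
  by (rule measurable_completion) simp

lemma borel_measurable_cnj [measurable (raw)]:
  "f \<in> borel_measurable M \<Longrightarrow> (\<lambda>x. cnj (f x)) \<in> borel_measurable M"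
  by (rule borel_measurable_continuous_on[of cnj]) (auto intro: continuous_intros)

lemma Lp2_bound:
  assumes "f \<in> borel_measurable lebesgue" "g \<in> Lp 2" "AE x in lebesgue. norm (f x) \<le> c * norm (g x)"
  shows "f \<in> Lp 2"
proof -
  have [measurable]: "f \<in> borel_measurable lebesgue" by fact
  have "integrable lebesgue (\<lambda>x. (norm (f x))\<^sup>2)"
  proof (rule Bochner_Integration.integrable_bound)
    show "integrable lebesgue (\<lambda>x. c\<^sup>2 * (norm (g x))\<^sup>2)"
      using Lp2_integrable[OF assms(2)] by simp
    show "AE x in lebesgue. norm ((norm (f x))\<^sup>2) \<le> norm (c\<^sup>2 * (norm (g x))\<^sup>2)"
      using assms(3)
    proof eventually_elim
      case (elim x)
      have "(norm (f x))\<^sup>2 \<le> (c * norm (g x))\<^sup>2"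
        using elim by (intro power_mono) auto
      then show ?case by (simp add: power_mult_distrib)
    qed
  qed measurable
  then show ?thesis using assms by (simp add: Lp2_iff)
qed

lemma norm_square_le_double:
  assumes "norm h \<le> norm f + norm g"
  shows "(norm h)\<^sup>2 \<le> 2 * (norm f)\<^sup>2 + 2 * (norm g)\<^sup>2"
proof -
  have "(norm h)\<^sup>2 \<le> (norm f + norm g)\<^sup>2"
    using assms by (intro power_mono) auto
  also have "\<dots> \<le> 2 * (norm f)\<^sup>2 + 2 * (norm g)\<^sup>2"
    using sum_squares_bound[of "norm f" "norm g"] by (simp add: power2_sum)
  finally show ?thesis .
qed

text \<open>Phrased by pointwise domination so that it covers sums and differences alike; the factor
  2 is the price of bounding squares instead of norms.\<close>

lemma Lp2_norm_sum_bound: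
  assumes "h \<in> borel_measurable lebesgue" "f \<in> Lp 2" "g \<in> Lp 2"
    and "AE x in lebesgue. norm (h x) \<le> norm (f x) + norm (g x)"
  shows "h \<in> Lp 2" and "sqnorm h \<le> 2 * sqnorm f + 2 * sqnorm g"
proof -
  have [measurable]: "h \<in> borel_measurable lebesgue" by fact
  have int: "integrable lebesgue (\<lambda>x. 2 * (norm (f x))\<^sup>2 + 2 * (norm (g x))\<^sup>2)"
    using assms by (auto simp: Lp2_iff)
  have le: "AE x in lebesgue. (norm (h x))\<^sup>2 \<le> 2 * (norm (f x))\<^sup>2 + 2 * (norm (g x))\<^sup>2"
    using assms(4) by eventually_elim (rule norm_square_le_double)
  have int_h: "integrable lebesgue (\<lambda>x. (norm (h x))\<^sup>2)"
    by (rule Bochner_Integration.integrable_bound[OF int]) (use le in auto)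
  then show "h \<in> Lp 2" using assms by (simp add: Lp2_iff)
  have "sqnorm h \<le> (LINT x|lebesgue. 2 * (norm (f x))\<^sup>2 + 2 * (norm (g x))\<^sup>2)"
    unfolding sqnorm_def by (rule integral_mono_AE[OF int_h int le])
  also have "\<dots> = 2 * sqnorm f + 2 * sqnorm g"
    using assms(2,3) by (simp add: sqnorm_def Lp2_iff)
  finally show "sqnorm h \<le> 2 * sqnorm f + 2 * sqnorm g" .
qed

lemma Lp2_add: "f \<in> Lp 2 \<Longrightarrow> g \<in> Lp 2 \<Longrightarrow> (\<lambda>x. f x + g x) \<in> Lp 2"
  by (rule Lp2_norm_sum_bound(1)[of _ f g]) (auto intro!: borel_measurable_add borel_measurable_diff simp: Lp2_measurable norm_triangle_ineq)

lemma Lp2_cmult: "f \<in> Lp 2 \<Longrightarrow> (\<lambda>x. c * f x) \<in> Lp 2"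
  by (rule Lp2_bound[of _ f "norm c"]) (auto intro!: borel_measurable_times simp: Lp2_measurable norm_mult)

lemma Lp2_diff: "f \<in> Lp 2 \<Longrightarrow> g \<in> Lp 2 \<Longrightarrow> (\<lambda>x. f x - g x) \<in> Lp 2"
  by (rule Lp2_norm_sum_bound(1)[of _ f g]) (auto intro!: borel_measurable_add borel_measurable_diff simp: Lp2_measurable norm_triangle_ineq4)

lemma Lp2_cnj: "f \<in> Lp 2 \<Longrightarrow> (\<lambda>x. cnj (f x)) \<in> Lp 2"
  unfolding Lp2_iff by (intro conjI borel_measurable_cnj) simp_all

lemma Lp2_zero: "(\<lambda>x. 0) \<in> Lp 2"
  by (simp add: Lp2_iff)

lemma Lp2_sum: "(\<And>i. i \<in> I \<Longrightarrow> f i \<in> Lp 2) \<Longrightarrow> (\<lambda>x. \<Sum>i\<in>I. f i x) \<in> Lp 2"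
  by (induction I rule: infinite_finite_induct) (auto simp: Lp2_zero Lp2_add)

lemma Lp2_indicator_mult:
  assumes "f \<in> Lp 2" "A \<in> sets lebesgue"
  shows "(\<lambda>x. indicator A x * f x) \<in> Lp 2"
proof (rule Lp2_bound[OF _ assms(1), of _ 1])
  show "(\<lambda>x. indicator A x * f x) \<in> borel_measurable lebesgue"
    using assms by (auto intro!: borel_measurable_times simp: Lp2_measurable)
qed (auto simp: norm_mult indicator_def)

lemma sqnorm_cmult: "sqnorm (\<lambda>x. c * f x) = (norm c)\<^sup>2 * sqnorm f"
  by (simp add: sqnorm_def norm_mult power_mult_distrib)

lemma sqnorm_cnj: "sqnorm (\<lambda>x. cnj (f x)) = sqnorm f"
  by (simp add: sqnorm_def)

lemma sqnorm_mono:
  assumes "f \<in> borel_measurable lebesgue" "g \<in> Lp 2" "AE x in lebesgue. norm (f x) \<le> norm (g x)"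
  shows "sqnorm f \<le> sqnorm g"
  unfolding sqnorm_def
proof (rule integral_mono_AE)
  show "integrable lebesgue (\<lambda>x. (norm (f x))\<^sup>2)"
    using Lp2_integrable[OF Lp2_bound[of f g 1]] assms by simp
  show "AE x in lebesgue. (norm (f x))\<^sup>2 \<le> (norm (g x))\<^sup>2"
    using assms(3) by eventually_elim (auto intro: power_mono)
qed (use assms in \<open>auto simp: Lp2_iff\<close>)

lemma Lp2_cong_AE:
  assumes "f \<in> borel_measurable lebesgue" "g \<in> Lp 2" "AE x in lebesgue. f x = g x"
  shows "f \<in> Lp 2"
  by (rule Lp2_bound[OF assms(1,2), of 1]) (use assms(3) in auto)

section \<open>Products of square-integrable functions\<close>

lemma Lp2_mult_integrable:
  assumes "f \<in> Lp 2" "g \<in> Lp 2"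
  shows "integrable lebesgue (\<lambda>x. f x * g x)"
proof (rule Bochner_Integration.integrable_bound)
  show "integrable lebesgue (\<lambda>x. (norm (f x))\<^sup>2 + (norm (g x))\<^sup>2)"
    using assms by (auto simp: Lp2_iff)
  show "(\<lambda>x. f x * g x) \<in> borel_measurable lebesgue"
    using assms by (auto simp: Lp2_iff)
  have "norm (f x) * norm (g x) \<le> (norm (f x))\<^sup>2 + (norm (g x))\<^sup>2" for x
    using sum_squares_bound[of "norm (f x)" "norm (g x)"]
      mult_nonneg_nonneg[OF norm_ge_zero[of "f x"] norm_ge_zero[of "g x"]] by linarith
  then show "AE x in lebesgue. norm (f x * g x) \<le> norm ((norm (f x))\<^sup>2 + (norm (g x))\<^sup>2)"
    by (simp add: norm_mult)
qed

lemma Lp2_norm_mult_integrable: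
  assumes "f \<in> Lp 2" "g \<in> Lp 2"
  shows "integrable lebesgue (\<lambda>x. norm (f x) * norm (g x))"
  using integrable_norm[OF Lp2_mult_integrable[OF assms]] by (simp add: norm_mult)

text \<open>Nonnegativity of the integral of \<open>(s |f| - t |g|)^2\<close> as a quadratic form.
  Both parameters are kept free so that the case \<open>sqnorm g = 0\<close> follows from the same
  inequality.\<close>

lemma Cauchy_Schwarz_Lp2_norm:
  assumes f: "f \<in> Lp 2" and g: "g \<in> Lp 2"
  shows "(LINT x|lebesgue. norm (f x) * norm (g x)) \<le> sqrt (sqnorm f) * sqrt (sqnorm g)"
proof -
  define c where "c = (LINT x|lebesgue. norm (f x) * norm (g x))"
  have c0: "0 \<le> c" unfolding c_def by (rule integral_nonneg_AE) auto
  have quad: "0 \<le> s\<^sup>2 * sqnorm f - 2 * s * t * c + t\<^sup>2 * sqnorm g" for s t :: real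
  proof -
    have "0 \<le> (LINT x|lebesgue. (s * norm (f x) - t * norm (g x))\<^sup>2)" by simp
    also have "\<dots> = (LINT x|lebesgue. s\<^sup>2 * (norm (f x))\<^sup>2 - 2 * s * t * (norm (f x) * norm (g x)) + t\<^sup>2 * (norm (g x))\<^sup>2)"
      by (intro Bochner_Integration.integral_cong) (auto simp: power2_eq_square algebra_simps)
    also have "\<dots> = s\<^sup>2 * sqnorm f - 2 * s * t * c + t\<^sup>2 * sqnorm g"
      using Lp2_integrable[OF f] Lp2_integrable[OF g] Lp2_norm_mult_integrable[OF f g]
      by (simp add: sqnorm_def c_def)
    finally show ?thesis .
  qed
  have "c\<^sup>2 \<le> sqnorm f * sqnorm g"
  proof (cases "sqnorm g = 0")
    case True
    \<comment> \<open>Here the form is affine in \<open>t\<close>; this choice makes it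
      \<open>- c^2 (sqnorm f + 2)\<close> and so forces \<open>c = 0\<close>.\<close>
    have "0 \<le> c\<^sup>2 * sqnorm f - 2 * c * (sqnorm f + 1) * c"
      using quad[of c "sqnorm f + 1"] True by simp
    then have "c\<^sup>2 * (sqnorm f + 2) \<le> 0" by (simp add: algebra_simps power2_eq_square)
    then have "c\<^sup>2 \<le> 0" using sqnorm_nonneg[of f] by (auto simp: mult_le_0_iff)
    then show ?thesis using True by simp
  next
    case False
    have "0 \<le> sqnorm g * (sqnorm f * sqnorm g - c\<^sup>2)"
      using quad[of "sqnorm g" c] by (simp add: algebra_simps power2_eq_square)
    moreover have "0 < sqnorm g" using False sqnorm_nonneg[of g] by linarith
    ultimately show ?thesis by (simp add: zero_le_mult_iff)
  qed
  then show ?thesis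
    unfolding c_def[symmetric] using c0 by (metis real_le_rsqrt real_sqrt_mult)
qed

lemma Cauchy_Schwarz_Lp2:
  assumes "f \<in> Lp 2" "g \<in> Lp 2"
  shows "norm (LINT x|lebesgue. f x * g x) \<le> sqrt (sqnorm f) * sqrt (sqnorm g)"
proof -
  have "norm (LINT x|lebesgue. f x * g x) \<le> (LINT x|lebesgue. norm (f x * g x))"
    by (rule integral_norm_bound)
  also have "\<dots> \<le> sqrt (sqnorm f) * sqrt (sqnorm g)"
    using Cauchy_Schwarz_Lp2_norm[OF assms] by (simp add: norm_mult)
  finally show ?thesis .
qed

section \<open>The Cauchy transform\<close>

text \<open>One half-line by the primitive \<open>arctan\<close>, the other by reflection.\<close>

lemma integrable_inverse_one_plus_square: "integrable lborel (\<lambda>x::real. 1 / (1 + x\<^sup>2))"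
proof -
  define f :: "real \<Rightarrow> real" where "f x = (1 / (1 + x\<^sup>2)) * indicator {0..} x" for x
  have [measurable]: "f \<in> borel_measurable borel" unfolding f_def by measurable
  have "(\<integral>\<^sup>+x. ennreal (1 / (1 + x\<^sup>2)) * indicator {0..} x \<partial>lborel) = ennreal (pi / 2 - arctan 0)"
    by (intro nn_integral_FTC_atLeast DERIV_arctan[THEN DERIV_cong] tendsto_arctan_at_top)
       (auto simp: inverse_eq_divide)
  then have "(\<integral>\<^sup>+x. ennreal (f x) \<partial>lborel) < \<infinity>"
    by (simp only: f_def nn_integral_set_ennreal) simp
  then have f: "integrable lborel f"
    by (subst integrable_iff_bounded) (simp add: f_def)
  then have "integrable lborel (\<lambda>x. f (0 + (-1) * x))"
    by (rule lborel_integrable_real_affine) simp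
  then have "integrable lborel (\<lambda>x. f x + f (- x))"
    using f by simp
  then show ?thesis
    by (rule Bochner_Integration.integrable_bound) (auto simp: f_def indicator_def)
qed

text \<open>This number is \<open>pi\<close>; the estimates carry it symbolically.\<close>

definition inv_sq_integral :: real where
  "inv_sq_integral = (LINT x|lborel. 1 / (1 + x\<^sup>2))"

lemma inv_sq_integral_nonneg: "0 \<le> inv_sq_integral"
  unfolding inv_sq_integral_def by (rule integral_nonneg_AE) auto

text \<open>Substitution \<open>x = Re z + b y\<close> with \<open>b = \<bar>Im z\<bar>\<close>. The
  resulting L^2 norm of order \<open>1 / sqrt \<bar>Im z\<bar>\<close> is the source of all later
  bounds \<open>K / sqrt (Im z)\<close>.\<close>

lemma has_bochner_integral_kernel:
  assumes "Im z \<noteq> 0"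
  shows "has_bochner_integral lebesgue (\<lambda>x. (norm (1 / (complex_of_real x - z)))\<^sup>2) (inv_sq_integral / \<bar>Im z\<bar>)"
proof -
  define b where "b = \<bar>Im z\<bar>"
  have b: "b > 0" using assms by (simp add: b_def)
  have eq: "(norm (1 / (complex_of_real x - z)))\<^sup>2 = (1 / b\<^sup>2) * (1 / (1 + (- Re z / b + (1 / b) * x)\<^sup>2))" for x
  proof -
    have "(norm (complex_of_real x - z))\<^sup>2 = b\<^sup>2 + (x - Re z)\<^sup>2"
      by (simp add: cmod_power2 b_def)
    also have "\<dots> = b\<^sup>2 * (1 + (- Re z / b + (1 / b) * x)\<^sup>2)"
      using b by (simp add: field_simps power2_eq_square)
    finally show ?thesis
      by (simp add: norm_divide power_divide)
  qed
  have "has_bochner_integral lborel (\<lambda>x. 1 / (1 + (- Re z / b + (1 / b) * x)\<^sup>2)) (inv_sq_integral /\<^sub>R \<bar>1 / b\<bar>)"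
    using b lborel_has_bochner_integral_real_affine_iff[of "1 / b" "\<lambda>x. 1 / (1 + x\<^sup>2)" inv_sq_integral "- Re z / b"]
      integrable_inverse_one_plus_square
    by (simp add: has_bochner_integral_iff inv_sq_integral_def)
  from has_bochner_integral_mult_right[OF this, of "1 / b\<^sup>2"]
  have "has_bochner_integral lborel (\<lambda>x. (norm (1 / (complex_of_real x - z)))\<^sup>2) (inv_sq_integral / b)"
    using b unfolding eq by (simp add: field_simps power2_eq_square)
  then show ?thesis
    by (auto simp: has_bochner_integral_iff integrable_completion integral_completion b_def)
qed

lemma kernel_measurable [measurable]: "(\<lambda>x. 1 / (complex_of_real x - z)) \<in> borel_measurable lebesgue"
  by measurable

lemma kernel_Lp2: "Im z \<noteq> 0 \<Longrightarrow> (\<lambda>x. 1 / (complex_of_real x - z)) \<in> Lp 2"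
  and sqnorm_kernel: "Im z \<noteq> 0 \<Longrightarrow> sqnorm (\<lambda>x. 1 / (complex_of_real x - z)) = inv_sq_integral / \<bar>Im z\<bar>"
  using has_bochner_integral_kernel[of z]
  by (auto simp: Lp2_iff sqnorm_def has_bochner_integral_iff)

lemma norm_ge_abs_Im_kernel: "\<bar>Im z\<bar> \<le> norm (complex_of_real x - z)"
  using abs_Im_le_cmod[of "complex_of_real x - z"] by simp

text \<open>No factor \<open>1 / (2 * pi * \<i>)\<close>: upper boundary values are then
  \<open>2 * pi * \<i> * riesz_plus f\<close>, and the jump across the line is
  \<open>2 * pi * \<i> * f\<close>.\<close>

definition cauchy_transform :: "(real \<Rightarrow> complex) \<Rightarrow> complex \<Rightarrow> complex" where
  "cauchy_transform f z = (LINT x|lebesgue. f x / (complex_of_real x - z))"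

section \<open>Linearity, reflection and holomorphy of the Cauchy transform\<close>

lemma cauchy_transform_integrable:
  assumes "f \<in> Lp 2" "Im z \<noteq> 0"
  shows "integrable lebesgue (\<lambda>x. f x / (complex_of_real x - z))"
  using Lp2_mult_integrable[OF assms(1) kernel_Lp2[OF assms(2)]] by simp

lemma norm_cauchy_transform_le:
  assumes "f \<in> Lp 2" "Im z \<noteq> 0"
  shows "norm (cauchy_transform f z) \<le> sqrt (sqnorm f) * sqrt (inv_sq_integral / \<bar>Im z\<bar>)"
  using Cauchy_Schwarz_Lp2[OF assms(1) kernel_Lp2[OF assms(2)]] sqnorm_kernel[OF assms(2)]
  by (simp add: cauchy_transform_def)

lemma cauchy_transform_add:
  assumes "f \<in> Lp 2" "g \<in> Lp 2" "Im z \<noteq> 0"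
  shows "cauchy_transform (\<lambda>x. f x + g x) z = cauchy_transform f z + cauchy_transform g z"
  using cauchy_transform_integrable[of f z] cauchy_transform_integrable[of g z] assms
  by (simp add: cauchy_transform_def add_divide_distrib)

lemma cauchy_transform_diff:
  assumes "f \<in> Lp 2" "g \<in> Lp 2" "Im z \<noteq> 0"
  shows "cauchy_transform (\<lambda>x. f x - g x) z = cauchy_transform f z - cauchy_transform g z"
  using cauchy_transform_integrable[of f z] cauchy_transform_integrable[of g z] assms
  by (simp add: cauchy_transform_def diff_divide_distrib)

lemma cauchy_transform_cmult: "cauchy_transform (\<lambda>x. c * f x) z = c * cauchy_transform f z"
  by (simp add: cauchy_transform_def flip: times_divide_eq_right)

text \<open>Schwarz reflection; it reduces the lower half-plane to the upper one.\<close>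

lemma cauchy_transform_cnj: "cauchy_transform (\<lambda>x. cnj (f x)) z = cnj (cauchy_transform f (cnj z))"
proof -
  have "(LINT x|lebesgue. cnj (f x) / (complex_of_real x - z)) = (LINT x|lebesgue. cnj (f x / (complex_of_real x - cnj z)))"
    by (intro Bochner_Integration.integral_cong) auto
  also have "\<dots> = cnj (LINT x|lebesgue. f x / (complex_of_real x - cnj z))"
    by (rule Bochner_Integration.integral_cnj)
  finally show ?thesis unfolding cauchy_transform_def .
qed

lemma cauchy_transform_sum:
  assumes "\<And>i. i \<in> I \<Longrightarrow> f i \<in> Lp 2" "Im z \<noteq> 0"
  shows "cauchy_transform (\<lambda>x. \<Sum>i\<in>I. f i x) z = (\<Sum>i\<in>I. cauchy_transform (f i) z)"
  using assms(1)
proof (induction I rule: infinite_finite_induct)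
  case (insert i I)
  then show ?case
    using cauchy_transform_add[of "f i" "\<lambda>x. \<Sum>i\<in>I. f i x" z] Lp2_sum[of I f] assms(2) by simp
qed (simp_all add: cauchy_transform_def)

lemma cauchy_transform_cong_AE:
  assumes "f \<in> borel_measurable lebesgue" "g \<in> borel_measurable lebesgue" "AE x in lebesgue. f x = g x"
  shows "cauchy_transform f z = cauchy_transform g z"
proof -
  have [measurable]: "f \<in> borel_measurable lebesgue" "g \<in> borel_measurable lebesgue" by fact+
  show ?thesis
    unfolding cauchy_transform_def
    by (rule integral_cong_AE) (use assms(3) in auto)
qed

text \<open>The difference quotient is estimated directly: its error has the kernel
  \<open>(y - z) / ((x - y) (x - z)^2)\<close>. One factor \<open>1 / (x - z)\<close> is kept to
  make the product with \<open>f\<close> integrable; the other two are at most \<open>2 / b\<close>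
  and \<open>1 / b\<close> when \<open>y\<close> is within \<open>b / 2\<close> of
  \<open>z\<close>.\<close>

lemma has_field_derivative_cauchy_transform:
  assumes f: "f \<in> Lp 2" and z: "Im z \<noteq> 0"
  shows "(cauchy_transform f has_field_derivative (LINT x|lebesgue. f x / (complex_of_real x - z)\<^sup>2)) (at z)"
proof -
  define b where "b = \<bar>Im z\<bar>"
  have b: "b > 0" using z by (simp add: b_def)
  define D where "D = (LINT x|lebesgue. f x / (complex_of_real x - z)\<^sup>2)"
  define M where "M = (LINT x|lebesgue. norm (f x) * norm (1 / (complex_of_real x - z)))"
  have nz: "complex_of_real x - y \<noteq> 0" if "Im y \<noteq> 0" for x y
    using that by (auto simp: complex_eq_iff)
  have fm [measurable]: "f \<in> borel_measurable lebesgue" using f by (rule Lp2_measurable)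
  have intM: "integrable lebesgue (\<lambda>x. norm (f x) * norm (1 / (complex_of_real x - z)))"
    by (rule Lp2_norm_mult_integrable[OF f kernel_Lp2[OF z]])
  have intD: "integrable lebesgue (\<lambda>x. f x / (complex_of_real x - z)\<^sup>2)"
  proof (rule Bochner_Integration.integrable_bound)
    show "integrable lebesgue (\<lambda>x. (1 / b) * (norm (f x) * norm (1 / (complex_of_real x - z))))"
      using intM by simp
    have "norm (f x / (complex_of_real x - z)\<^sup>2) \<le> (1 / b) * (norm (f x) * norm (1 / (complex_of_real x - z)))" for x
    proof -
      have "1 / norm (complex_of_real x - z) \<le> 1 / b"
        using b norm_ge_abs_Im_kernel[of z x] by (simp add: b_def frac_le)
      then show ?thesis
        using mult_right_mono[of "1 / norm (complex_of_real x - z)" "1 / b" "norm (f x) / norm (complex_of_real x - z)"]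
        by (simp add: norm_divide norm_power norm_mult power2_eq_square)
    qed
    then show "AE x in lebesgue. norm (f x / (complex_of_real x - z)\<^sup>2) \<le> norm ((1 / b) * (norm (f x) * norm (1 / (complex_of_real x - z))))"
      using b by (auto simp: norm_mult)
  qed measurable
  have bound: "norm ((cauchy_transform f y - cauchy_transform f z) / (y - z) - D) \<le> norm (y - z) * ((2 / b\<^sup>2) * M)"
    if y: "y \<noteq> z" "norm (y - z) < b / 2" for y
  proof -
    have "\<bar>Im y - Im z\<bar> < b / 2" using abs_Im_le_cmod[of "y - z"] y by simp
    then have Imy: "\<bar>Im y\<bar> \<ge> b / 2" unfolding b_def by linarith
    then have Imy0: "Im y \<noteq> 0" using b by auto
    define Q where "Q x = (f x / (complex_of_real x - y) - f x / (complex_of_real x - z)) / (y - z)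
        - f x / (complex_of_real x - z)\<^sup>2" for x
    have hb: "has_bochner_integral lebesgue Q ((cauchy_transform f y - cauchy_transform f z) / (y - z) - D)"
      unfolding cauchy_transform_def D_def Q_def
      by (intro has_bochner_integral_diff has_bochner_integral_divide_zero has_bochner_integral_integrable
          cauchy_transform_integrable[OF f Imy0] cauchy_transform_integrable[OF f z] intD)
    have intQ: "integrable lebesgue Q"
      by (rule integrable.intros[OF hb])
    have ptw: "norm (Q x) \<le> (norm (y - z) * (2 / b\<^sup>2)) * (norm (f x) * norm (1 / (complex_of_real x - z)))" for x
    proof -
      define p where "p = complex_of_real x - y"
      define q where "q = complex_of_real x - z"
      have pq: "p \<noteq> 0" "q \<noteq> 0" "y - z = q - p" "q - p \<noteq> 0"
        using nz Imy0 z y by (auto simp: p_def q_def)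
      have "Q x = f x * ((q - p) / (p * q\<^sup>2))"
        unfolding Q_def pq(3) p_def[symmetric] q_def[symmetric] using pq(1,2,4)
        by (simp add: field_simps power2_eq_square)
      then have "norm (Q x) = (norm (q - p) * (1 / norm p) * (1 / norm q)) * (norm (f x) * norm (1 / q))"
        by (simp add: norm_mult norm_divide norm_power power2_eq_square ac_simps)
      also have "\<dots> \<le> (norm (q - p) * (2 / b) * (1 / b)) * (norm (f x) * norm (1 / q))"
      proof -
        have "b / 2 \<le> norm p" "b \<le> norm q"
          using Imy norm_ge_abs_Im_kernel[of y x] norm_ge_abs_Im_kernel[of z x]
          by (simp_all add: p_def q_def b_def)
        then have "1 / norm p \<le> 2 / b" "1 / norm q \<le> 1 / b"
          using b pq by (simp_all add: field_simps)
        then show ?thesis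
          using b by (intro mult_right_mono mult_mono mult_nonneg_nonneg) auto
      qed
      finally show ?thesis
        by (simp add: power2_eq_square pq(3) q_def)
    qed
    have "norm ((cauchy_transform f y - cauchy_transform f z) / (y - z) - D) = norm (LINT x|lebesgue. Q x)"
      using has_bochner_integral_integral_eq[OF hb] by simp
    also have "\<dots> \<le> (LINT x|lebesgue. norm (Q x))"
      by (rule integral_norm_bound)
    also have "\<dots> \<le> (LINT x|lebesgue. (norm (y - z) * (2 / b\<^sup>2)) * (norm (f x) * norm (1 / (complex_of_real x - z))))"
      by (rule Bochner_Integration.integral_mono[OF integrable_norm[OF intQ] integrable_mult_right[OF intM] ptw])
    also have "\<dots> = norm (y - z) * ((2 / b\<^sup>2) * M)"
      using intM by (simp add: M_def)
    finally show ?thesis .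
  qed
  have "((\<lambda>y. (cauchy_transform f y - cauchy_transform f z) / (y - z) - D) \<longlongrightarrow> 0) (at z)"
  proof (rule Lim_null_comparison)
    have "\<forall>\<^sub>F y in at z. y \<noteq> z \<and> norm (y - z) < b / 2"
      using b unfolding eventually_at dist_norm by (intro exI[of _ "b / 2"]) auto
    then show "\<forall>\<^sub>F y in at z. norm ((cauchy_transform f y - cauchy_transform f z) / (y - z) - D) \<le> norm (y - z) * ((2 / b\<^sup>2) * M)"
      by eventually_elim (use bound in auto)
    show "((\<lambda>y. norm (y - z) * ((2 / b\<^sup>2) * M)) \<longlongrightarrow> 0) (at z)"
      using b by (auto intro!: tendsto_eq_intros)
  qed
  then have "((\<lambda>y. (cauchy_transform f y - cauchy_transform f z) / (y - z)) \<longlongrightarrow> D) (at z)"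
    by (simp add: Lim_null[symmetric])
  then show ?thesis
    unfolding has_field_derivative_iff D_def by simp
qed

lemma holomorphic_cauchy_transform:
  assumes "f \<in> Lp 2" "\<And>z. z \<in> S \<Longrightarrow> Im z \<noteq> 0"
  shows "cauchy_transform f holomorphic_on S"
  unfolding holomorphic_on_def field_differentiable_def
  using has_field_derivative_cauchy_transform[OF assms(1)] assms(2)
  by (meson has_field_derivative_at_within)

section \<open>The Cauchy formula in a half-plane\<close>

text \<open>The cut-offs \<open>N\<close> are arbitrary because the lemma serves both the
  rectangles, with \<open>N m = m^8\<close>, and the limit over all real \<open>R\<close> in
  \<open>Gamma1\<close>.\<close>

lemma tendsto_integral_symmetric_interval:
  fixes u :: "real \<Rightarrow> complex"
  assumes u: "integrable lebesgue u" and N: "filterlim N at_top sequentially"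
  shows "(\<lambda>m. LINT x:{- N m..N m}|lebesgue. u x) \<longlonglongrightarrow> (LINT x|lebesgue. u x)"
  unfolding set_lebesgue_integral_def
proof (rule integral_dominated_convergence[where w = "\<lambda>x. norm (u x)"])
  show "AE x in lebesgue. (\<lambda>m. indicat_real {- N m..N m} x *\<^sub>R u x) \<longlonglongrightarrow> u x"
  proof (rule AE_I2)
    fix x :: real
    have "\<forall>\<^sub>F m in sequentially. \<bar>x\<bar> \<le> N m"
      using N by (simp add: filterlim_at_top)
    then have "\<forall>\<^sub>F m in sequentially. indicat_real {- N m..N m} x *\<^sub>R u x = u x"
      by eventually_elim (auto simp: indicator_def)
    then show "(\<lambda>m. indicat_real {- N m..N m} x *\<^sub>R u x) \<longlonglongrightarrow> u x"
      by (rule tendsto_eventually)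
  qed
qed (use u in \<open>auto simp: indicator_def intro!: borel_measurable_scaleR\<close>)

abbreviation cauchy_rect :: "nat \<Rightarrow> real \<Rightarrow> complex" where
  "cauchy_rect m \<equiv> rectpath (Complex (- (real m ^ 8)) 0) (Complex (real m ^ 8) (real m ^ 6))"

text \<open>The rectangle has width \<open>2 m\<^sup>8\<close> and height \<open>m\<^sup>6\<close>, so that with \<open>norm (F z) \<le> K / sqrt (Im z)\<close>
  the vertical sides and the upper side both contribute \<open>O(1 / m)\<close>.\<close>

lemma line_integral_eq_rectangle_limit:
  assumes hol: "F holomorphic_on {z. 0 < Im z}"
    and bnd: "\<And>z. 0 < Im z \<Longrightarrow> norm (F z) \<le> K / sqrt (Im z)"
    and eps: "0 < \<epsilon>" and L2: "(\<lambda>x. F (Complex x \<epsilon>)) \<in> Lp 2" and lam: "Im \<mu> \<noteq> 0"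
    and rect: "\<forall>\<^sub>F m in sequentially. ((\<lambda>w. F (w + \<i> * \<epsilon>) / (w - \<mu>)) has_contour_integral I)
        (cauchy_rect m)"
  shows "cauchy_transform (\<lambda>x. F (Complex x \<epsilon>)) \<mu> = I"
proof -
  define g where "g w = F (w + \<i> * \<epsilon>) / (w - \<mu>)" for w
  define u where "u x = F (Complex x \<epsilon>) / (complex_of_real x - \<mu>)" for x
  have gu: "g (complex_of_real x) = u x" for x
  proof -
    have "complex_of_real x + \<i> * \<epsilon> = Complex x \<epsilon>" by (simp add: complex_eq_iff)
    then show ?thesis by (simp add: g_def u_def)
  qed
  have K0: "0 \<le> K" using order_trans[OF norm_ge_zero bnd[of \<i>]] by simp
  have intu: "integrable lebesgue u"
    unfolding u_def by (rule cauchy_transform_integrable[OF L2 lam])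
  have lim: "(\<lambda>m. LINT x:{- (real m ^ 8)..real m ^ 8}|lebesgue. u x) \<longlonglongrightarrow> cauchy_transform (\<lambda>x. F (Complex x \<epsilon>)) \<mu>"
    unfolding cauchy_transform_def u_def[symmetric]
    by (rule tendsto_integral_symmetric_interval[OF intu]) (rule filterlim_pow_at_top, simp, rule filterlim_real_sequentially)
  have holF: "(\<lambda>w. F (w + \<i> * \<epsilon>)) holomorphic_on {w. - \<epsilon> < Im w}"
  proof -
    have "(F \<circ> (\<lambda>w. w + \<i> * \<epsilon>)) holomorphic_on {w. - \<epsilon> < Im w}"
      by (rule holomorphic_on_compose_gen[OF _ hol]) (auto intro!: holomorphic_intros)
    then show ?thesis by (simp add: o_def)
  qed
  have bound: "\<forall>\<^sub>F m in sequentially. norm ((LINT x:{- (real m ^ 8)..real m ^ 8}|lebesgue. u x) - I)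
      \<le> (4 * K + 4 * (K / sqrt \<epsilon>)) / real m"
  proof -
    \<comment> \<open>For \<open>m > m0\<close> both \<open>m^8\<close> and \<open>m^6\<close>
      exceed \<open>2 * norm \<mu>\<close>, so the vertical sides and the top stay at distance at
      least \<open>N / 2\<close> and \<open>h / 2\<close> from the pole.\<close>
    obtain m0 :: nat where m0: "2 * norm \<mu> + 1 < real m0" using reals_Archimedean2 by blast
    from rect show ?thesis
      using eventually_gt_at_top[of "max m0 1"]
    proof eventually_elim
      case (elim m)
      define n where "n = real m"
      have n: "1 \<le> n" "2 * norm \<mu> + 1 < n" using elim(2) m0 by (auto simp: n_def)
      define N where "N = n ^ 8"
      define h where "h = n ^ 6"
      have np: "n \<le> n ^ k" if "k \<ge> 1" for k
        using power_increasing[of 1 k n] that n by simp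
      have Nl: "2 * norm \<mu> < N" "1 \<le> N" and hl: "2 * norm \<mu> < h" "1 \<le> h"
        using np[of 8] np[of 6] n by (auto simp: N_def h_def)
      let ?a1 = "Complex (- N) 0" and ?a2 = "Complex N 0" and ?a3 = "Complex N h" and ?a4 = "Complex (- N) h"
      have rp: "(g has_contour_integral I) (linepath ?a1 ?a2 +++ linepath ?a2 ?a3 +++ linepath ?a3 ?a4 +++ linepath ?a4 ?a1)"
        using elim(1) unfolding g_def rectpath_def N_def h_def n_def by (simp add: Let_def)
      have fnorm: "norm (F (w + \<i> * \<epsilon>)) \<le> K / sqrt \<epsilon>" "0 < y \<Longrightarrow> y \<le> Im w \<Longrightarrow> norm (F (w + \<i> * \<epsilon>)) \<le> K / sqrt y"
        if "0 \<le> Im w" for w y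
      proof -
        have *: "norm (F (w + \<i> * \<epsilon>)) \<le> K / sqrt (Im w + \<epsilon>)"
          using bnd[of "w + \<i> * \<epsilon>"] that eps by simp
        have "K / sqrt (Im w + \<epsilon>) \<le> K / sqrt \<epsilon>"
          using K0 that eps by (intro divide_left_mono) auto
        with * show "norm (F (w + \<i> * \<epsilon>)) \<le> K / sqrt \<epsilon>" by simp
        assume y: "0 < y" "y \<le> Im w"
        have "K / sqrt (Im w + \<epsilon>) \<le> K / sqrt y"
          using K0 that eps y by (intro divide_left_mono) auto
        with * show "norm (F (w + \<i> * \<epsilon>)) \<le> K / sqrt y" by simp
      qed
      have seg_top: "Im w = h" if "w \<in> closed_segment ?a3 ?a4" for w
        using that by (auto simp: in_segment algebra_simps complex_eq_iff)
      have seg_r: "Re w = N \<and> 0 \<le> Im w" if "w \<in> closed_segment ?a2 ?a3" for w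
        using that hl by (auto simp: in_segment algebra_simps complex_eq_iff)
      have seg_l: "Re w = - N \<and> 0 \<le> Im w" if "w \<in> closed_segment ?a4 ?a1" for w
      proof -
        from that obtain t where t: "0 \<le> t" "t \<le> 1" "w = (1 - t) *\<^sub>R ?a4 + t *\<^sub>R ?a1"
          by (auto simp: in_segment)
        have "Re w = - N" using arg_cong[OF t(3), of Re] by (simp add: algebra_simps)
        moreover have "Im w = (1 - t) * h" using arg_cong[OF t(3), of Im] by simp
        ultimately show ?thesis using t hl by simp
      qed
      have seg_b: "Im w = 0" if "w \<in> closed_segment ?a1 ?a2" for w
        using that by (auto simp: in_segment)
      have wl: "N / 2 \<le> norm (w - \<mu>)" if "\<bar>Re w\<bar> = N" for w
        using abs_Re_le_cmod[of "w - \<mu>"] abs_Re_le_cmod[of \<mu>] that Nl by simp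
      have wt: "h / 2 \<le> norm (w - \<mu>)" if "Im w = h" for w
        using abs_Im_le_cmod[of "w - \<mu>"] abs_Im_le_cmod[of \<mu>] that hl by simp
      have cont: "continuous_on S g" if "S \<subseteq> {w. 0 \<le> Im w}" "\<mu> \<notin> S" for S
      proof -
        have "S \<subseteq> {w. - \<epsilon> < Im w}" using that eps by auto
        then have "continuous_on S (\<lambda>w. F (w + \<i> * \<epsilon>))"
          using holF holomorphic_on_imp_continuous_on continuous_on_subset by blast
        then show ?thesis unfolding g_def using that(2)
          by (intro continuous_intros) auto
      qed
      have ci: "g contour_integrable_on linepath ?a1 ?a2" "g contour_integrable_on linepath ?a2 ?a3"
        "g contour_integrable_on linepath ?a3 ?a4" "g contour_integrable_on linepath ?a4 ?a1"
      proof -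
        show "g contour_integrable_on linepath ?a1 ?a2"
          by (intro contour_integrable_continuous_linepath cont) (use seg_b lam in fastforce)+
        show "g contour_integrable_on linepath ?a2 ?a3"
          using wl[of \<mu>] Nl seg_r
          by (intro contour_integrable_continuous_linepath cont) fastforce+
        show "g contour_integrable_on linepath ?a3 ?a4"
          using wt[of \<mu>] hl seg_top
          by (intro contour_integrable_continuous_linepath cont) fastforce+
        show "g contour_integrable_on linepath ?a4 ?a1"
          using wl[of \<mu>] Nl seg_l
          by (intro contour_integrable_continuous_linepath cont) fastforce+
      qed
      have "I = contour_integral (linepath ?a1 ?a2 +++ linepath ?a2 ?a3 +++ linepath ?a3 ?a4 +++ linepath ?a4 ?a1) g"
        using rp by (rule contour_integral_unique[symmetric])
      also have "\<dots> = contour_integral (linepath ?a1 ?a2) g + (contour_integral (linepath ?a2 ?a3) g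
          + (contour_integral (linepath ?a3 ?a4) g + contour_integral (linepath ?a4 ?a1) g))"
        using ci by (simp add: contour_integrable_joinI)
      finally have sum: "contour_integral (linepath ?a1 ?a2) g - I = - (contour_integral (linepath ?a2 ?a3) g
          + (contour_integral (linepath ?a3 ?a4) g + contour_integral (linepath ?a4 ?a1) g))"
        by simp
      have bot: "contour_integral (linepath ?a1 ?a2) g = (LINT x:{- N..N}|lebesgue. u x)"
      proof -
        have "contour_integral (linepath ?a1 ?a2) g = integral {- N..N} (\<lambda>x. g (of_real x))"
          using Nl by (subst contour_integral_linepath_Reals_eq) (auto simp: complex_is_Real_iff)
        also have "\<dots> = (LINT x:{- N..N}|lebesgue. u x)"
          unfolding gu using intu
          by (intro set_lebesgue_integral_eq_integral(2)[symmetric])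
             (auto intro!: integrable_mult_indicator simp: set_integrable_def)
        finally show ?thesis .
      qed
      have gside: "norm (g w) \<le> K / sqrt \<epsilon> * (2 / N)" if "\<bar>Re w\<bar> = N" "0 \<le> Im w" for w
      proof -
        have "1 / norm (w - \<mu>) \<le> 1 / (N / 2)"
          using wl[OF that(1)] Nl by (intro divide_left_mono) (auto intro!: mult_pos_pos)
        then have "norm (F (w + \<i> * \<epsilon>)) * (1 / norm (w - \<mu>)) \<le> (K / sqrt \<epsilon>) * (2 / N)"
          using fnorm(1)[OF that(2)] K0 eps by (intro mult_mono) auto
        then show ?thesis by (simp add: g_def norm_divide)
      qed
      have gtop: "norm (g w) \<le> K / sqrt h * (2 / h)" if "Im w = h" for w
      proof -
        have "1 / norm (w - \<mu>) \<le> 1 / (h / 2)"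
          using wt[OF that(1)] hl by (intro divide_left_mono) (auto intro!: mult_pos_pos)
        then have "norm (F (w + \<i> * \<epsilon>)) * (1 / norm (w - \<mu>)) \<le> (K / sqrt h) * (2 / h)"
          using fnorm(2)[of w h] that K0 hl by (intro mult_mono) auto
        then show ?thesis by (simp add: g_def norm_divide)
      qed
      have nonneg: "0 \<le> K / sqrt \<epsilon> * (2 / N)" "0 \<le> K / sqrt h * (2 / h)"
        using K0 eps Nl hl by auto
      have len: "norm (?a3 - ?a2) = h" "norm (?a4 - ?a3) = 2 * N" "norm (?a1 - ?a4) = h"
        using Nl hl by (auto simp: cmod_def power2_eq_square real_sqrt_mult)
      have b2: "norm (contour_integral (linepath ?a2 ?a3) g) \<le> K / sqrt \<epsilon> * (2 / N) * h"
        using contour_integral_bound_linepath[OF ci(2) nonneg(1)] gside seg_r len Nl by fastforce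
      have b3: "norm (contour_integral (linepath ?a3 ?a4) g) \<le> K / sqrt h * (2 / h) * (2 * N)"
        using contour_integral_bound_linepath[OF ci(3) nonneg(2)] gtop seg_top len by fastforce
      have b4: "norm (contour_integral (linepath ?a4 ?a1) g) \<le> K / sqrt \<epsilon> * (2 / N) * h"
        using contour_integral_bound_linepath[OF ci(4) nonneg(1)] gside seg_l len Nl by fastforce
      \<comment> \<open>With width exponent \<open>p\<close> and height exponent \<open>q\<close>
        the sides contribute \<open>n^(q - p)\<close> and the top \<open>n^(p - 3 q / 2)\<close>, so
        any \<open>q < p < 3 q / 2\<close> gives decay. The choice \<open>q = 6\<close>,
        \<open>p = 8\<close> does, and keeps \<open>sqrt h\<close> a power of
        \<open>n\<close>.\<close>
      have sqh: "sqrt h = n ^ 3"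
        unfolding h_def using n by (intro real_sqrt_unique) (auto simp flip: power_mult)
      have e3: "K / sqrt h * (2 / h) * (2 * N) = 4 * K / n"
      proof -
        have "n * n ^ 8 = n ^ 9" by (simp flip: power_Suc)
        with sqh show ?thesis
          unfolding h_def N_def using n by (simp add: field_simps flip: power_add)
      qed
      have e2: "K / sqrt \<epsilon> * (2 / N) * h \<le> 2 * (K / sqrt \<epsilon>) / n"
      proof -
        have "h / N = 1 / n\<^sup>2" unfolding h_def N_def using n by (simp add: field_simps flip: power_add)
        also have "\<dots> \<le> 1 / n" using n np[of 2] by (intro divide_left_mono) auto
        finally have "2 * (K / sqrt \<epsilon>) * (h / N) \<le> 2 * (K / sqrt \<epsilon>) * (1 / n)"
          using K0 eps by (intro mult_left_mono) auto
        then show ?thesis by (simp add: ac_simps)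
      qed
      have "norm (contour_integral (linepath ?a1 ?a2) g - I) \<le>
          norm (contour_integral (linepath ?a2 ?a3) g) + (norm (contour_integral (linepath ?a3 ?a4) g)
           + norm (contour_integral (linepath ?a4 ?a1) g))"
        unfolding sum norm_minus_cancel by (intro order_trans[OF norm_triangle_ineq] add_left_mono norm_triangle_ineq)
      also have "\<dots> \<le> 2 * (K / sqrt \<epsilon>) / n + (4 * K / n + 2 * (K / sqrt \<epsilon>) / n)"
        using b2 b3 b4 e2 e3 by linarith
      also have "\<dots> = (4 * K + 4 * (K / sqrt \<epsilon>)) / n"
        by (simp add: add_divide_distrib)
      finally have "norm ((LINT x:{- N..N}|lebesgue. u x) - I) \<le> (4 * K + 4 * (K / sqrt \<epsilon>)) / n"
        unfolding bot .
      then show ?case unfolding N_def n_def .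
    qed
  qed
  have "(\<lambda>m. (LINT x:{- (real m ^ 8)..real m ^ 8}|lebesgue. u x) - I) \<longlonglongrightarrow> 0"
    by (rule Lim_null_comparison[OF bound]) (rule lim_const_over_n)
  then have "(\<lambda>m. LINT x:{- (real m ^ 8)..real m ^ 8}|lebesgue. u x) \<longlonglongrightarrow> I"
    by (simp add: Lim_null[symmetric])
  with lim show ?thesis by (rule LIMSEQ_unique)
qed

text \<open>Shifting \<open>F\<close> by \<open>\<epsilon>\<close> moves the line of integration to
  the real axis, inside the domain of holomorphy. The vanishing for \<open>\<mu>\<close> below is as
  important as the value above: it yields the Poisson formula and later separates the two
  half-planes.\<close>

lemma half_plane_Cauchy_formula:
  assumes hol: "F holomorphic_on {z. 0 < Im z}"
    and bnd: "\<And>z. 0 < Im z \<Longrightarrow> norm (F z) \<le> K / sqrt (Im z)"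
    and eps: "0 < \<epsilon>" and L2: "(\<lambda>x. F (Complex x \<epsilon>)) \<in> Lp 2"
  shows "0 < Im \<mu> \<Longrightarrow> cauchy_transform (\<lambda>x. F (Complex x \<epsilon>)) \<mu> = 2 * pi * \<i> * F (\<mu> + \<i> * \<epsilon>)"
    and "Im \<mu> < 0 \<Longrightarrow> cauchy_transform (\<lambda>x. F (Complex x \<epsilon>)) \<mu> = 0"
proof -
  have holF: "(\<lambda>w. F (w + \<i> * \<epsilon>)) holomorphic_on {w. - \<epsilon> < Im w}"
  proof -
    have "(F \<circ> (\<lambda>w. w + \<i> * \<epsilon>)) holomorphic_on {w. - \<epsilon> < Im w}"
      by (rule holomorphic_on_compose_gen[OF _ hol]) (auto intro!: holomorphic_intros)
    then show ?thesis by (simp add: o_def)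
  qed
  obtain m0 :: nat where m0: "norm \<mu> + 1 < real m0" using reals_Archimedean2 by blast
  have large: "norm \<mu> < real m ^ k" "1 \<le> real m ^ k" if "m0 < m" "k \<ge> 1" for m k
  proof -
    have "real m \<le> real m ^ k"
      using power_increasing[of 1 k "real m"] that by simp
    then show "norm \<mu> < real m ^ k" "1 \<le> real m ^ k"
      using m0 that norm_ge_zero[of \<mu>] by linarith+
  qed
  have sub: "path_image (cauchy_rect m) \<subseteq> {w. 0 \<le> Im w}" for m
    by (subst path_image_rectpath) (auto simp: closed_segment_def in_segment path_image_rectpath)
  show "cauchy_transform (\<lambda>x. F (Complex x \<epsilon>)) \<mu> = 2 * pi * \<i> * F (\<mu> + \<i> * \<epsilon>)" if lam: "0 < Im \<mu>"
  proof (rule line_integral_eq_rectangle_limit[OF hol bnd eps L2])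
    show "\<forall>\<^sub>F m in sequentially. ((\<lambda>w. F (w + \<i> * \<epsilon>) / (w - \<mu>)) has_contour_integral 2 * pi * \<i> * F (\<mu> + \<i> * \<epsilon>))
        (cauchy_rect m)"
      using eventually_gt_at_top[of m0]
    proof eventually_elim
      case (elim m)
      have l: "norm \<mu> < real m ^ 8" "norm \<mu> < real m ^ 6" using large elim by auto
      have box: "\<mu> \<in> box (Complex (- (real m ^ 8)) 0) (Complex (real m ^ 8) (real m ^ 6))"
        using l lam abs_Re_le_cmod[of \<mu>] abs_Im_le_cmod[of \<mu>] by (auto simp: in_box_complex_iff)
      have "((\<lambda>w. F (w + \<i> * \<epsilon>) / (w - \<mu>)) has_contour_integral
          2 * pi * \<i> * winding_number (cauchy_rect m) \<mu> * F (\<mu> + \<i> * \<epsilon>))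
        (cauchy_rect m)"
      proof (rule Cauchy_integral_formula_convex_simple[OF _ holF])
        show "convex {w. - \<epsilon> < Im w}" by (rule convex_halfspace_Im_gt)
        show "\<mu> \<in> interior {w. - \<epsilon> < Im w}"
          using lam eps by (subst interior_open) (auto simp: open_halfspace_Im_gt)
        have "\<mu> \<notin> path_image (cauchy_rect m)"
          using box by (subst path_image_rectpath_cbox_minus_box) (auto simp: in_box_complex_iff)
        then show "path_image (cauchy_rect m) \<subseteq> {w. - \<epsilon> < Im w} - {\<mu>}"
          using sub[of m] eps by fastforce
      qed auto
      then show ?case using winding_number_rectpath[OF box] by simp
    qed
  qed (use lam in auto)
  show "cauchy_transform (\<lambda>x. F (Complex x \<epsilon>)) \<mu> = 0" if lam: "Im \<mu> < 0"
  proof (rule line_integral_eq_rectangle_limit[OF hol bnd eps L2])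
    have "((\<lambda>w. F (w + \<i> * \<epsilon>) / (w - \<mu>)) has_contour_integral 0)
        (cauchy_rect m)" for m
    proof (rule Cauchy_theorem_convex_simple)
      \<comment> \<open>This half-plane is convex, contains the closed upper half-plane and leaves
        the pole outside.\<close>
      show "(\<lambda>w. F (w + \<i> * \<epsilon>) / (w - \<mu>)) holomorphic_on {w. max (- \<epsilon>) (Im \<mu>) < Im w}"
        by (intro holomorphic_intros holomorphic_on_subset[OF holF]) auto
      show "convex {w. max (- \<epsilon>) (Im \<mu>) < Im w}" by (rule convex_halfspace_Im_gt)
      show "path_image (cauchy_rect m) \<subseteq> {w. max (- \<epsilon>) (Im \<mu>) < Im w}"
        using sub[of m] eps lam by fastforce
    qed auto
    then show "\<forall>\<^sub>F m in sequentially. ((\<lambda>w. F (w + \<i> * \<epsilon>) / (w - \<mu>)) has_contour_integral 0)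
        (cauchy_rect m)"
      by simp
  qed (use lam in auto)
qed


section \<open>The Cauchy transform on horizontal lines\<close>

text \<open>The limit inherits the bound although no convergence in norm is available; this is the
  situation when the height of a line tends to 0.\<close>

lemma Lp2_Fatou:
  assumes L2: "\<And>n. u n \<in> Lp 2" and lim: "AE x in lebesgue. (\<lambda>n. u n x) \<longlonglongrightarrow> v x"
    and v: "v \<in> borel_measurable lebesgue" and bnd: "\<And>n. sqnorm (u n) \<le> B"
  shows "v \<in> Lp 2" and "sqnorm v \<le> B"
proof -
  have [measurable]: "u n \<in> borel_measurable lebesgue" for n using L2 by (rule Lp2_measurable)
  have [measurable]: "v \<in> borel_measurable lebesgue" by fact
  have eq: "(\<integral>\<^sup>+x. ennreal ((norm (u n x))\<^sup>2) \<partial>lebesgue) = ennreal (sqnorm (u n))" for n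
    unfolding sqnorm_def by (rule nn_integral_eq_integral[OF Lp2_integrable[OF L2]]) simp
  have "(\<integral>\<^sup>+x. ennreal ((norm (v x))\<^sup>2) \<partial>lebesgue) = (\<integral>\<^sup>+x. liminf (\<lambda>n. ennreal ((norm (u n x))\<^sup>2)) \<partial>lebesgue)"
  proof (rule nn_integral_cong_AE)
    show "AE x in lebesgue. ennreal ((norm (v x))\<^sup>2) = liminf (\<lambda>n. ennreal ((norm (u n x))\<^sup>2))"
      using lim
    proof eventually_elim
      case (elim x)
      have "(\<lambda>n. ennreal ((norm (u n x))\<^sup>2)) \<longlonglongrightarrow> ennreal ((norm (v x))\<^sup>2)"
        by (intro tendsto_ennrealI tendsto_intros elim)
      from lim_imp_Liminf[OF _ this] show ?case by simp
    qed
  qed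
  also have "\<dots> \<le> liminf (\<lambda>n. \<integral>\<^sup>+x. ennreal ((norm (u n x))\<^sup>2) \<partial>lebesgue)"
    by (rule nn_integral_liminf) measurable
  also have "\<dots> \<le> liminf (\<lambda>n. ennreal B)"
    by (rule Liminf_mono) (use bnd in \<open>auto simp: eq intro!: always_eventually ennreal_leI\<close>)
  also have "\<dots> = ennreal B"
    by (rule lim_imp_Liminf) auto
  finally have le: "(\<integral>\<^sup>+x. ennreal ((norm (v x))\<^sup>2) \<partial>lebesgue) \<le> ennreal B" .
  have B0: "0 \<le> B" using bnd[of 0] sqnorm_nonneg[of "u 0"] by linarith
  have "integrable lebesgue (\<lambda>x. (norm (v x))\<^sup>2)"
    using le by (intro integrableI_nonneg) (auto simp: top_unique less_top intro: le_less_trans)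
  then show "v \<in> Lp 2" using v by (simp add: Lp2_iff)
  have "ennreal (sqnorm v) \<le> ennreal B"
    using le nn_integral_eq_integral[OF Lp2_integrable[OF \<open>v \<in> Lp 2\<close>]] by (simp add: sqnorm_def)
  then show "sqnorm v \<le> B" using B0 by simp
qed

text \<open>Fubini is applied to the product of two completed measures, and that needs
  sigma-finiteness of the completion.\<close>

lemma sigma_finite_lebesgue: "sigma_finite_measure (lebesgue :: real measure)"
proof (standard, intro exI[of _ "range (\<lambda>n::nat. {- real n..real n})"] conjI)
  show "\<Union> (range (\<lambda>n::nat. {- real n..real n})) = space lebesgue"
  proof -
    have "\<exists>n::nat. - real n \<le> x \<and> x \<le> real n" for x :: real
    proof -
      obtain n :: nat where "\<bar>x\<bar> \<le> real n" using real_arch_simple by blast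
      then show ?thesis by (intro exI[of _ n]) auto
    qed
    then show ?thesis by auto
  qed
qed auto

interpretation lebesgue: sigma_finite_measure "lebesgue :: real measure"
  by (rule sigma_finite_lebesgue)

interpretation lebesgue_pair: pair_sigma_finite "lebesgue :: real measure" "lebesgue :: real measure" ..

section \<open>The uniform L^2 bound on horizontal lines\<close>

lemma continuous_cauchy_transform_line:
  assumes "f \<in> Lp 2" "\<epsilon> \<noteq> 0"
  shows "continuous_on UNIV (\<lambda>x. cauchy_transform f (Complex x \<epsilon>))"
proof -
  have "continuous_on {z. Im z \<noteq> 0} (cauchy_transform f)"
    by (intro holomorphic_on_imp_continuous_on holomorphic_cauchy_transform assms) auto
  then show ?thesis
    by (rule continuous_on_compose2) (use assms in \<open>auto intro!: continuous_intros simp: Complex_eq\<close>)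
qed

lemma borel_measurable_lebesgue_continuous:
  fixes u :: "real \<Rightarrow> 'a :: real_normed_vector"
  shows "continuous_on UNIV u \<Longrightarrow> u \<in> borel_measurable lebesgue"
  by (intro measurable_completion) (simp add: borel_measurable_continuous_onI)

lemma cauchy_transform_line_measurable:
  assumes "f \<in> Lp 2" "\<epsilon> \<noteq> 0"
  shows "(\<lambda>x. cauchy_transform f (Complex x \<epsilon>)) \<in> borel_measurable lebesgue"
  by (intro borel_measurable_lebesgue_continuous continuous_cauchy_transform_line assms)

lemma Lp2_bounded_support_integrable:
  assumes f: "f \<in> Lp 2" and supp: "\<forall>x. R < \<bar>x\<bar> \<longrightarrow> f x = 0"
  shows "integrable lebesgue f"
proof -
  have supp': "- R \<le> x \<and> x \<le> R" if "f x \<noteq> 0" for x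
    using supp[rule_format, of x] that by (cases "R < \<bar>x\<bar>") auto
  have "(\<lambda>x. indicator {-R..R} x) \<in> Lp 2"
    unfolding Lp2_iff
  proof
    have "integrable lebesgue (\<lambda>x. indicator {-R..R} x :: real)"
      by (rule integrable_real_indicator) (auto simp: emeasure_lborel_Icc_eq)
    then show "integrable lebesgue (\<lambda>x. (norm (indicator {-R..R} x :: complex))\<^sup>2)"
      by (rule Bochner_Integration.integrable_cong[THEN iffD1, rotated -1]) (auto simp: indicator_def)
  qed auto
  from Lp2_mult_integrable[OF this f] show ?thesis
    by (rule Bochner_Integration.integrable_cong[THEN iffD1, rotated -1]) (auto simp: indicator_def dest: supp')
qed

text \<open>A crude bound that may depend on the support and on \<open>\<epsilon>\<close>. Its
  purpose is to make the supremum over all heights above \<open>\<epsilon>\<close> finite, so that a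
  doubling argument can improve it to one in terms of \<open>sqnorm f\<close>.\<close>

lemma cauchy_transform_line_bounded_support:
  assumes f: "f \<in> Lp 2" and supp: "\<forall>x. R < \<bar>x\<bar> \<longrightarrow> f x = 0" and eps: "0 < \<epsilon>"
  shows "\<exists>B. \<forall>\<eta>\<ge>\<epsilon>. (\<lambda>x. cauchy_transform f (Complex x \<eta>)) \<in> Lp 2 \<and>
    sqnorm (\<lambda>x. cauchy_transform f (Complex x \<eta>)) \<le> B"
proof -
  define A where "A = (LINT x|lebesgue. norm (f x))"
  have A0: "0 \<le> A" unfolding A_def by (rule integral_nonneg_AE) auto
  have intf: "integrable lebesgue f" by (rule Lp2_bounded_support_integrable[OF f supp])
  \<comment> \<open>The entry 2 pays for \<open>t^2 \<le> 2 (x - t)^2 + 2 x^2\<close>; the other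
    absorbs \<open>2 R^2 + 1\<close> into \<open>c \<eta>^2\<close>.\<close>
  define c where "c = max 2 ((2 * R\<^sup>2 + 1) / \<epsilon>\<^sup>2)"
  have c: "2 \<le> c" "(2 * R\<^sup>2 + 1) / \<epsilon>\<^sup>2 \<le> c" by (auto simp: c_def)
  have dist: "1 + t\<^sup>2 \<le> c * (norm (complex_of_real x - Complex t \<eta>))\<^sup>2" if "\<bar>x\<bar> \<le> R" "\<epsilon> \<le> \<eta>" for x t \<eta>
  proof -
    have "t\<^sup>2 = (x - (x - t))\<^sup>2" by simp
    also have "\<dots> \<le> 2 * (x - t)\<^sup>2 + 2 * x\<^sup>2"
      using zero_le_power2[of "(x - t) + x"] by (simp add: power2_eq_square algebra_simps)
    also have "x\<^sup>2 \<le> R\<^sup>2" using that(1) by (simp add: abs_le_square_iff[symmetric])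
    finally have "1 + t\<^sup>2 \<le> 2 * (x - t)\<^sup>2 + (2 * R\<^sup>2 + 1)" by simp
    also have "2 * R\<^sup>2 + 1 \<le> c * \<epsilon>\<^sup>2" using c(2) eps by (simp add: divide_le_eq)
    also have "c * \<epsilon>\<^sup>2 \<le> c * \<eta>\<^sup>2" using c(1) that eps by (intro mult_left_mono power_mono) auto
    also have "2 * (x - t)\<^sup>2 \<le> c * (x - t)\<^sup>2" using c(1) by (intro mult_right_mono) auto
    also have "c * (x - t)\<^sup>2 + c * \<eta>\<^sup>2 = c * (norm (complex_of_real x - Complex t \<eta>))\<^sup>2"
      by (simp add: cmod_power2 algebra_simps)
    finally show ?thesis by simp
  qed
  have bound: "norm (cauchy_transform f (Complex t \<eta>)) \<le> sqrt (c / (1 + t\<^sup>2)) * A" if eta: "\<epsilon> \<le> \<eta>" for t \<eta>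
  proof -
    have "norm (cauchy_transform f (Complex t \<eta>)) \<le> (LINT x|lebesgue. norm (f x / (complex_of_real x - Complex t \<eta>)))"
      unfolding cauchy_transform_def by (rule integral_norm_bound)
    also have "\<dots> \<le> (LINT x|lebesgue. sqrt (c / (1 + t\<^sup>2)) * norm (f x))"
    proof (rule Bochner_Integration.integral_mono)
      show "integrable lebesgue (\<lambda>x. norm (f x / (complex_of_real x - Complex t \<eta>)))"
        using cauchy_transform_integrable[OF f, of "Complex t \<eta>"] eta eps by (intro integrable_norm) auto
      show "integrable lebesgue (\<lambda>x. sqrt (c / (1 + t\<^sup>2)) * norm (f x))"
        using intf by auto
      fix x
      show "norm (f x / (complex_of_real x - Complex t \<eta>)) \<le> sqrt (c / (1 + t\<^sup>2)) * norm (f x)"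
      proof (cases "\<bar>x\<bar> \<le> R")
        case True
        define r where "r = norm (complex_of_real x - Complex t \<eta>)"
        have r: "0 < r" using eta eps by (auto simp: r_def complex_eq_iff)
        have tp: "0 < 1 + t\<^sup>2" by (rule add_pos_nonneg) auto
        have "(1 / r)\<^sup>2 \<le> c / (1 + t\<^sup>2)"
          using dist[OF True eta, of t] r tp unfolding r_def[symmetric] by (simp add: field_simps)
        then have "1 / r \<le> sqrt (c / (1 + t\<^sup>2))" by (rule real_le_rsqrt)
        then have "(1 / r) * norm (f x) \<le> sqrt (c / (1 + t\<^sup>2)) * norm (f x)" by (rule mult_right_mono) simp
        then show ?thesis by (simp add: norm_divide r_def)
      qed (simp add: supp)
    qed
    also have "\<dots> = sqrt (c / (1 + t\<^sup>2)) * A" by (simp add: A_def)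
    finally show ?thesis .
  qed
  define w where "w t = complex_of_real (sqrt (c / (1 + t\<^sup>2)) * A)" for t :: real
  have nw: "norm (w t) = sqrt (c / (1 + t\<^sup>2)) * A" for t
    using A0 c(1) by (simp add: w_def norm_mult)
  have w: "w \<in> Lp 2"
    unfolding Lp2_iff
  proof
    have tp: "1 + t\<^sup>2 \<noteq> 0" for t :: real by (smt (verit) zero_le_power2)
    then have "continuous_on UNIV w"
      unfolding w_def by (intro continuous_intros) auto
    then show "w \<in> borel_measurable lebesgue" by (rule borel_measurable_lebesgue_continuous)
    have "(norm (w t))\<^sup>2 = c * A\<^sup>2 * (1 / (1 + t\<^sup>2))" for t
      unfolding nw power_mult_distrib using c(1) by simp
    moreover have "integrable lebesgue (\<lambda>t. c * A\<^sup>2 * (1 / (1 + t\<^sup>2)))"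
      using integrable_inverse_one_plus_square by (intro integrable_mult_right) (simp add: integrable_completion)
    ultimately show "integrable lebesgue (\<lambda>t. (norm (w t))\<^sup>2)" by (simp only:)
  qed
  show ?thesis
  proof (intro exI allI impI conjI)
    fix \<eta> assume eta: "\<epsilon> \<le> \<eta>"
    have m: "(\<lambda>x. cauchy_transform f (Complex x \<eta>)) \<in> borel_measurable lebesgue"
      using eta eps by (intro cauchy_transform_line_measurable f) auto
    have b: "AE x in lebesgue. norm (cauchy_transform f (Complex x \<eta>)) \<le> norm (w x)"
      using bound[OF eta] by (simp add: nw)
    show "(\<lambda>x. cauchy_transform f (Complex x \<eta>)) \<in> Lp 2"
      by (rule Lp2_bound[OF m w, of 1]) (use b in simp)
    show "sqnorm (\<lambda>x. cauchy_transform f (Complex x \<eta>)) \<le> sqnorm w"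
      by (rule sqnorm_mono[OF m w b])
  qed
qed

lemma cauchy_transform_bound_half_plane:
  assumes "f \<in> Lp 2" "0 < Im z"
  shows "norm (cauchy_transform f z) \<le> (sqrt (sqnorm f) * sqrt inv_sq_integral) / sqrt (Im z)"
  using norm_cauchy_transform_le[of f z] assms by (simp add: real_sqrt_divide)

lemma holomorphic_cauchy_transform_upper: "f \<in> Lp 2 \<Longrightarrow> cauchy_transform f holomorphic_on {z. 0 < Im z}"
  by (rule holomorphic_cauchy_transform) auto

text \<open>The Cauchy transform \<open>T\<^sub>\<eta>\<close> onto the line at height \<open>\<eta>\<close> satisfies \<open>T\<^sub>\<eta>\<^sup>* T\<^sub>\<eta> = - 2 \<pi> \<i> T\<^bsub>2\<eta>\<^esub>\<close>.\<close>

lemma sqnorm_cauchy_transform_line_doubling: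
  assumes f: "f \<in> Lp 2" and supp: "\<forall>x. R < \<bar>x\<bar> \<longrightarrow> f x = 0" and eta: "0 < \<eta>"
  shows "sqnorm (\<lambda>x. cauchy_transform f (Complex x \<eta>)) \<le>
    2 * pi * sqrt (sqnorm f) * sqrt (sqnorm (\<lambda>x. cauchy_transform f (Complex x (2 * \<eta>))))"
proof -
  define F where "F t = cauchy_transform f (Complex t \<eta>)" for t
  have F: "F \<in> Lp 2" and F2: "(\<lambda>x. cauchy_transform f (Complex x (2 * \<eta>))) \<in> Lp 2"
    using cauchy_transform_line_bounded_support[OF f supp eta] eta unfolding F_def by auto
  have [measurable]: "f \<in> borel_measurable lebesgue" "F \<in> borel_measurable lebesgue"
    using f F by (auto simp: Lp2_measurable)
  \<comment> \<open>Bounded support enters here: \<open>f\<close> in L^1 makes the double integral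
    below absolutely convergent.\<close>
  have intf: "integrable lebesgue f" by (rule Lp2_bounded_support_integrable[OF f supp])
  \<comment> \<open>Integrated over \<open>y\<close> this gives \<open>F t * cnj (F t)\<close>, by
    reflection. Integrated over \<open>t\<close> it gives the Cauchy transform of \<open>F\<close>,
    which the Cauchy formula evaluates at height \<open>2 * \<eta>\<close>.\<close>
  define k where "k y t = F t * (cnj (f y) * (1 / (complex_of_real y - Complex t (- \<eta>))))" for y t
  have swap: "1 / (complex_of_real y - Complex t (- \<eta>)) = - (1 / (complex_of_real t - Complex y \<eta>))" for y t
  proof -
    have "complex_of_real y - Complex t (- \<eta>) = - (complex_of_real t - Complex y \<eta>)"
      by (simp add: complex_eq_iff)
    then show ?thesis by (simp only: minus_divide_right)
  qed
  have k_alt: "k y t = - cnj (f y) * (F t / (complex_of_real t - Complex y \<eta>))" for y t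
    by (simp add: k_def swap)
  have kmeas: "case_prod k \<in> borel_measurable (lebesgue \<Otimes>\<^sub>M lebesgue)"
    unfolding k_def Complex_eq by measurable
  have int1: "integrable lebesgue (k y)" for y
    unfolding k_alt using cauchy_transform_integrable[OF F, of "Complex y \<eta>"] eta
    by (intro integrable_mult_right) auto
  have intk: "integrable (lebesgue \<Otimes>\<^sub>M lebesgue) (case_prod k)"
  proof (rule lebesgue_pair.Fubini_integrable[OF kmeas])
    show "AE x in lebesgue. integrable lebesgue (\<lambda>y. case (x, y) of (x, xa) \<Rightarrow> k x xa)"
      using int1 by simp
    show "integrable lebesgue (\<lambda>x. LINT y|lebesgue. norm (case (x, y) of (x, xa) \<Rightarrow> k x xa))"
    proof (rule Bochner_Integration.integrable_bound)
      define M where "M = sqrt (sqnorm F) * sqrt (inv_sq_integral / \<eta>)"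
      show "integrable lebesgue (\<lambda>x. M * norm (f x))" using intf by auto
      show "(\<lambda>x. LINT y|lebesgue. norm (case (x, y) of (x, xa) \<Rightarrow> k x xa)) \<in> borel_measurable lebesgue"
        using kmeas by measurable
      have "(LINT t|lebesgue. norm (k y t)) \<le> M * norm (f y)" for y
      proof -
        have ky: "(\<lambda>t. 1 / (complex_of_real t - Complex y \<eta>)) \<in> Lp 2"
          "sqnorm (\<lambda>t. 1 / (complex_of_real t - Complex y \<eta>)) = inv_sq_integral / \<eta>"
          using kernel_Lp2[of "Complex y \<eta>"] sqnorm_kernel[of "Complex y \<eta>"] eta by auto
        have "(LINT t|lebesgue. norm (k y t)) = (LINT t|lebesgue. norm (f y) * (norm (F t) * norm (1 / (complex_of_real t - Complex y \<eta>))))"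
          by (intro Bochner_Integration.integral_cong) (simp_all add: k_alt norm_mult norm_divide)
        also have "\<dots> = norm (f y) * (LINT t|lebesgue. norm (F t) * norm (1 / (complex_of_real t - Complex y \<eta>)))"
          by (rule Bochner_Integration.integral_mult_right_zero)
        also have "\<dots> \<le> norm (f y) * M"
          using Cauchy_Schwarz_Lp2_norm[OF F ky(1)] unfolding ky(2) M_def by (rule mult_left_mono) simp
        finally show ?thesis by (simp only: mult.commute)
      qed
      moreover have "0 \<le> (LINT t|lebesgue. norm (k y t))" for y by (rule integral_nonneg_AE) simp
      ultimately show "AE x in lebesgue. norm (LINT y|lebesgue. norm (case (x, y) of (x, xa) \<Rightarrow> k x xa)) \<le> norm (M * norm (f x))"
        by (auto intro!: AE_I2 order_trans[OF _ abs_ge_self])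
    qed
  qed
  have inner1: "(LINT y|lebesgue. k y t) = F t * cnj (F t)" for t
  proof -
    have "(LINT y|lebesgue. k y t) = F t * (LINT y|lebesgue. cnj (f y) * (1 / (complex_of_real y - Complex t (- \<eta>))))"
      unfolding k_def by (rule Bochner_Integration.integral_mult_right_zero)
    also have "(LINT y|lebesgue. cnj (f y) * (1 / (complex_of_real y - Complex t (- \<eta>)))) = cauchy_transform (\<lambda>y. cnj (f y)) (Complex t (- \<eta>))"
      by (simp add: cauchy_transform_def)
    also have "\<dots> = cnj (F t)"
    proof -
      have "cnj (Complex t (- \<eta>)) = Complex t \<eta>" by (simp add: complex_eq_iff)
      then show ?thesis by (simp only: cauchy_transform_cnj F_def)
    qed
    finally show ?thesis .
  qed
  have inner2: "(LINT t|lebesgue. k y t) = - (2 * pi * \<i>) * (cauchy_transform f (Complex y (2 * \<eta>)) * cnj (f y))" for y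
  proof -
    have "(LINT t|lebesgue. k y t) = - cnj (f y) * cauchy_transform F (Complex y \<eta>)"
      unfolding k_alt cauchy_transform_def by (rule Bochner_Integration.integral_mult_right_zero)
    also have "cauchy_transform F (Complex y \<eta>) = 2 * pi * \<i> * cauchy_transform f (Complex y \<eta> + \<i> * \<eta>)"
      unfolding F_def using eta
      by (intro half_plane_Cauchy_formula(1)[OF holomorphic_cauchy_transform_upper[OF f] cauchy_transform_bound_half_plane[OF f] eta F[unfolded F_def]]) auto
    also have "Complex y \<eta> + \<i> * \<eta> = Complex y (2 * \<eta>)" by (simp add: complex_eq_iff)
    finally show ?thesis by simp
  qed
  have "complex_of_real (sqnorm F) = (LINT t|lebesgue. complex_of_real ((norm (F t))\<^sup>2))"
    unfolding sqnorm_def by (rule integral_complex_of_real[symmetric])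
  also have "\<dots> = (LINT t|lebesgue. F t * cnj (F t))"
    by (simp only: complex_norm_square)
  also have "\<dots> = (LINT t|lebesgue. LINT y|lebesgue. k y t)" unfolding inner1 ..
  also have "\<dots> = (LINT y|lebesgue. LINT t|lebesgue. k y t)"
    by (rule lebesgue_pair.Fubini_integral[OF intk])
  also have "\<dots> = - (2 * pi * \<i>) * (LINT y|lebesgue. cauchy_transform f (Complex y (2 * \<eta>)) * cnj (f y))"
    unfolding inner2 by (rule Bochner_Integration.integral_mult_right_zero)
  finally have "norm (complex_of_real (sqnorm F)) = 2 * pi * norm (LINT y|lebesgue. cauchy_transform f (Complex y (2 * \<eta>)) * cnj (f y))"
    by (simp add: norm_mult)
  also have "\<dots> \<le> 2 * pi * (sqrt (sqnorm (\<lambda>x. cauchy_transform f (Complex x (2 * \<eta>)))) * sqrt (sqnorm f))"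
    using Cauchy_Schwarz_Lp2[OF F2 Lp2_cnj[OF f]] by (intro mult_left_mono) (auto simp: sqnorm_cnj)
  finally show ?thesis
    unfolding F_def by (simp add: ac_simps)
qed

text \<open>The doubling inequality reads \<open>a(\<eta>)^2 \<le> c a(2 \<eta>)\<close> with
  \<open>c = 2 pi sqrt (sqnorm f)\<close>. For the finite supremum \<open>S\<close> of
  \<open>a\<close> over the heights above \<open>\<epsilon>\<close> it gives
  \<open>S^2 \<le> c S\<close>, hence \<open>S \<le> c\<close>: all dependence on the support
  disappears.\<close>

lemma sqnorm_cauchy_transform_line_bounded_support:
  assumes f: "f \<in> Lp 2" and supp: "\<forall>x. R < \<bar>x\<bar> \<longrightarrow> f x = 0" and eps: "0 < \<epsilon>"
  shows "sqnorm (\<lambda>x. cauchy_transform f (Complex x \<epsilon>)) \<le> (2 * pi)\<^sup>2 * sqnorm f"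
proof -
  define a where "a \<eta> = sqrt (sqnorm (\<lambda>x. cauchy_transform f (Complex x \<eta>)))" for \<eta>
  define S where "S = (SUP \<eta>\<in>{\<epsilon>..}. a \<eta>)"
  define c where "c = 2 * pi * sqrt (sqnorm f)"
  have c0: "0 \<le> c" by (simp add: c_def)
  have a0: "0 \<le> a \<eta>" for \<eta> by (simp add: a_def)
  from cauchy_transform_line_bounded_support[OF f supp eps] obtain B where
    B: "\<And>\<eta>. \<epsilon> \<le> \<eta> \<Longrightarrow> sqnorm (\<lambda>x. cauchy_transform f (Complex x \<eta>)) \<le> B" by blast
  have bdd: "bdd_above (a ` {\<epsilon>..})"
    by (intro bdd_aboveI[of _ "sqrt B"]) (auto simp: a_def B)
  have aS: "a \<eta> \<le> S" if "\<epsilon> \<le> \<eta>" for \<eta>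
    unfolding S_def using that by (intro cSUP_upper bdd) auto
  have S0: "0 \<le> S" using aS[of \<epsilon>] a0[of \<epsilon>] by simp
  have "a \<eta> \<le> sqrt (c * S)" if "\<epsilon> \<le> \<eta>" for \<eta>
  proof (rule real_le_rsqrt)
    have "(a \<eta>)\<^sup>2 \<le> c * a (2 * \<eta>)"
      using sqnorm_cauchy_transform_line_doubling[OF f supp, of \<eta>] that eps by (simp add: a_def c_def)
    also have "\<dots> \<le> c * S" using aS[of "2 * \<eta>"] that eps c0 by (intro mult_left_mono) auto
    finally show "(a \<eta>)\<^sup>2 \<le> c * S" .
  qed
  then have "S \<le> sqrt (c * S)" unfolding S_def by (intro cSUP_least) auto
  then have "S\<^sup>2 \<le> c * S" using S0 c0 power_mono[of S "sqrt (c * S)" 2] by simp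
  then have "S \<le> c" using S0 c0 by (cases "S = 0") (auto simp: power2_eq_square)
  then have "a \<epsilon> \<le> c" using aS[of \<epsilon>] by simp
  then have "(a \<epsilon>)\<^sup>2 \<le> c\<^sup>2" using a0 by (intro power_mono) auto
  then show ?thesis by (simp add: a_def c_def power_mult_distrib)
qed

lemma Lp2_truncation_bound:
  assumes f: "f \<in> Lp 2"
  shows "(\<lambda>x. indicator {- real n..real n} x * f x) \<in> Lp 2"
    and "sqnorm (\<lambda>x. indicator {- real n..real n} x * f x) \<le> sqnorm f"
proof -
  show *: "(\<lambda>x. indicator {- real n..real n} x * f x) \<in> Lp 2"
    by (rule Lp2_indicator_mult[OF f]) auto
  show "sqnorm (\<lambda>x. indicator {- real n..real n} x * f x) \<le> sqnorm f"
    by (rule sqnorm_mono[OF Lp2_measurable[OF *] f]) (auto simp: indicator_def)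
qed

lemma truncation_eventually_eq:
  "\<forall>\<^sub>F n in sequentially. indicator {- real n..real n} x * f x = (f x :: complex)"
proof -
  obtain n0 :: nat where "\<bar>x\<bar> \<le> real n0" using real_arch_simple by blast
  then show ?thesis
    by (intro eventually_sequentiallyI[of n0]) (auto simp: indicator_def abs_le_iff)
qed

lemma cauchy_transform_truncation_tendsto:
  assumes f: "f \<in> Lp 2" and z: "Im z \<noteq> 0"
  shows "(\<lambda>n. cauchy_transform (\<lambda>x. indicator {- real n..real n} x * f x) z) \<longlonglongrightarrow> cauchy_transform f z"
  unfolding cauchy_transform_def
proof (rule integral_dominated_convergence[where w = "\<lambda>x. norm (f x / (complex_of_real x - z))"])
  show "integrable lebesgue (\<lambda>x. norm (f x / (complex_of_real x - z)))"
    by (intro integrable_norm cauchy_transform_integrable f z)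
  show "(\<lambda>x. f x / (complex_of_real x - z)) \<in> borel_measurable lebesgue"
    by (rule borel_measurable_integrable[OF cauchy_transform_integrable[OF f z]])
  show "(\<lambda>x. indicator {- real n..real n} x * f x / (complex_of_real x - z)) \<in> borel_measurable lebesgue" for n
    by (rule borel_measurable_integrable[OF cauchy_transform_integrable[OF Lp2_truncation_bound(1)[OF f] z]])
  show "AE x in lebesgue. (\<lambda>n. indicator {- real n..real n} x * f x / (complex_of_real x - z)) \<longlonglongrightarrow> f x / (complex_of_real x - z)"
  proof (rule AE_I2, rule tendsto_eventually)
    fix x
    show "\<forall>\<^sub>F n in sequentially. indicator {- real n..real n} x * f x / (complex_of_real x - z) = f x / (complex_of_real x - z)"
      using truncation_eventually_eq[of x f] by eventually_elim simp
  qed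
qed (auto simp: indicator_def)

text \<open>The bound no longer sees the support, so it survives truncation to
  \<open>[-n, n]\<close> and Fatou.\<close>

lemma Lp2_cauchy_transform_line:
  assumes f: "f \<in> Lp 2" and eps: "0 < \<epsilon>"
  shows "(\<lambda>x. cauchy_transform f (Complex x \<epsilon>)) \<in> Lp 2"
    and "sqnorm (\<lambda>x. cauchy_transform f (Complex x \<epsilon>)) \<le> (2 * pi)\<^sup>2 * sqnorm f"
proof -
  define g where "g n x = indicator {- real n..real n} x * f x" for n :: nat and x
  have g: "g n \<in> Lp 2" "sqnorm (g n) \<le> sqnorm f" for n
    unfolding g_def using Lp2_truncation_bound[OF f] by auto
  have supp: "\<forall>x. real n < \<bar>x\<bar> \<longrightarrow> g n x = 0" for n
    by (auto simp: g_def indicator_def)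
  have L2: "(\<lambda>x. cauchy_transform (g n) (Complex x \<epsilon>)) \<in> Lp 2" for n
    using cauchy_transform_line_bounded_support[OF g(1) supp eps, of n] by auto
  have bnd: "sqnorm (\<lambda>x. cauchy_transform (g n) (Complex x \<epsilon>)) \<le> (2 * pi)\<^sup>2 * sqnorm f" for n
    using sqnorm_cauchy_transform_line_bounded_support[OF g(1) supp eps, of n] g(2)[of n]
    by (meson mult_left_mono order_trans zero_le_power2)
  have lim: "AE x in lebesgue. (\<lambda>n. cauchy_transform (g n) (Complex x \<epsilon>)) \<longlonglongrightarrow> cauchy_transform f (Complex x \<epsilon>)"
    unfolding g_def using eps by (intro AE_I2 cauchy_transform_truncation_tendsto f) auto
  have m: "(\<lambda>x. cauchy_transform f (Complex x \<epsilon>)) \<in> borel_measurable lebesgue"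
    using eps by (intro cauchy_transform_line_measurable f) auto
  show "(\<lambda>x. cauchy_transform f (Complex x \<epsilon>)) \<in> Lp 2"
    and "sqnorm (\<lambda>x. cauchy_transform f (Complex x \<epsilon>)) \<le> (2 * pi)\<^sup>2 * sqnorm f"
    using Lp2_Fatou[OF L2 lim m bnd] by auto
qed

section \<open>A weak-type maximal inequality\<close>

text \<open>Since \<open>\<mu>\<close> and its conjugate lie in opposite half-planes, the Cauchy formula yields the Poisson
  formula, with kernel \<open>1 / (t - \<mu>) - 1 / (t - cnj \<mu>) = 2 \<i> \<delta> / \<bar>t - \<mu>\<bar>\<^sup>2\<close>.\<close>

lemma norm_square_le_poisson:
  assumes hol: "F holomorphic_on {z. 0 < Im z}"
    and bnd: "\<And>z. 0 < Im z \<Longrightarrow> norm (F z) \<le> K / sqrt (Im z)"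
    and eps: "0 < \<epsilon>" and L2: "(\<lambda>x. F (Complex x \<epsilon>)) \<in> Lp 2" and delta: "0 < \<delta>"
  shows "(norm (F (Complex x (\<epsilon> + \<delta>))))\<^sup>2 \<le>
    inv_sq_integral / pi\<^sup>2 * (\<delta> * sqnorm (\<lambda>t. F (Complex t \<epsilon>) * (1 / (complex_of_real t - Complex x \<delta>))))"
proof -
  define Fe where "Fe t = F (Complex t \<epsilon>)" for t
  define k where "k t = 1 / (complex_of_real t - Complex x \<delta>)" for t
  have Fe: "Fe \<in> Lp 2" using L2 by (simp add: Fe_def[abs_def])
  have k: "k \<in> Lp 2" "sqnorm k = inv_sq_integral / \<delta>"
    using kernel_Lp2[of "Complex x \<delta>"] sqnorm_kernel[of "Complex x \<delta>"] delta by (auto simp: k_def[abs_def])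
  have kb: "norm (k t) \<le> 1 / \<delta>" for t
    using norm_ge_abs_Im_kernel[of "Complex x \<delta>" t] delta by (simp add: k_def norm_divide frac_le)
  have Fk: "(\<lambda>t. Fe t * k t) \<in> Lp 2"
  proof (rule Lp2_bound[OF _ Fe, of _ "1 / \<delta>"])
    show "(\<lambda>t. Fe t * k t) \<in> borel_measurable lebesgue"
      using Fe k by (intro borel_measurable_times Lp2_measurable)
    show "AE t in lebesgue. norm (Fe t * k t) \<le> 1 / \<delta> * norm (Fe t)"
    proof (rule AE_I2)
      fix t
      have "norm (k t) * norm (Fe t) \<le> 1 / \<delta> * norm (Fe t)"
        using kb by (rule mult_right_mono) simp
      then show "norm (Fe t * k t) \<le> 1 / \<delta> * norm (Fe t)"
        by (simp only: norm_mult mult.commute[of "norm (Fe t)"])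
    qed
  qed
  have diff: "Fe t / (complex_of_real t - Complex x \<delta>) - Fe t / (complex_of_real t - Complex x (- \<delta>))
      = 2 * \<i> * \<delta> * ((Fe t * k t) * cnj (k t))" for t
  proof -
    define z where "z = complex_of_real t - Complex x \<delta>"
    have z: "z \<noteq> 0" using delta by (auto simp: z_def complex_eq_iff)
    have c: "complex_of_real t - Complex x (- \<delta>) = cnj z" by (simp add: z_def complex_eq_iff)
    have d: "cnj z - z = 2 * \<i> * \<delta>" by (simp add: z_def complex_eq_iff)
    have "Fe t / z - Fe t / cnj z = Fe t * (cnj z - z) / (z * cnj z)"
      using z by (simp add: field_simps)
    then have "Fe t / z - Fe t / cnj z = Fe t * (2 * \<i> * \<delta>) / (z * cnj z)"
      unfolding d .
    then show ?thesis unfolding c k_def z_def[symmetric] by (simp add: ac_simps)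
  qed
  have "2 * pi * \<i> * F (Complex x \<delta> + \<i> * \<epsilon>) = cauchy_transform Fe (Complex x \<delta>) - cauchy_transform Fe (Complex x (- \<delta>))"
    using half_plane_Cauchy_formula[OF hol bnd eps L2, of "Complex x \<delta>"]
      half_plane_Cauchy_formula[OF hol bnd eps L2, of "Complex x (- \<delta>)"] delta
    by (simp add: Fe_def[abs_def])
  also have "\<dots> = (LINT t|lebesgue. Fe t / (complex_of_real t - Complex x \<delta>) - Fe t / (complex_of_real t - Complex x (- \<delta>)))"
    unfolding cauchy_transform_def using delta
    by (intro Bochner_Integration.integral_diff[symmetric] cauchy_transform_integrable Fe) auto
  also have "\<dots> = 2 * \<i> * \<delta> * (LINT t|lebesgue. (Fe t * k t) * cnj (k t))"
    unfolding diff by (rule Bochner_Integration.integral_mult_right_zero)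
  finally have "norm (2 * pi * \<i> * F (Complex x \<delta> + \<i> * \<epsilon>)) = norm (2 * \<i> * \<delta> * (LINT t|lebesgue. (Fe t * k t) * cnj (k t)))"
    by (rule arg_cong)
  then have "pi * norm (F (Complex x \<delta> + \<i> * \<epsilon>)) = \<delta> * norm (LINT t|lebesgue. (Fe t * k t) * cnj (k t))"
    using delta by (simp add: norm_mult)
  \<comment> \<open>The splitting keeps one kernel with \<open>Fe\<close>: after squaring,
    \<open>|Fe|^2\<close> is integrated against the Poisson kernel, and \<open>sqnorm k\<close>
    cancels one of the two factors \<open>\<delta>\<close>. This is Jensen's inequality up to a
    constant.\<close>
  also have "\<dots> \<le> \<delta> * (sqrt (sqnorm (\<lambda>t. Fe t * k t)) * sqrt (sqnorm k))"
    using Cauchy_Schwarz_Lp2[OF Fk Lp2_cnj[OF k(1)]] delta by (intro mult_left_mono) (auto simp: sqnorm_cnj)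
  finally have "(pi * norm (F (Complex x \<delta> + \<i> * \<epsilon>)))\<^sup>2 \<le> (\<delta> * (sqrt (sqnorm (\<lambda>t. Fe t * k t)) * sqrt (sqnorm k)))\<^sup>2"
    by (rule power_mono) simp
  also have "\<dots> = inv_sq_integral * (\<delta> * sqnorm (\<lambda>t. Fe t * k t))"
    using delta unfolding power_mult_distrib k(2) using inv_sq_integral_nonneg by (simp add: power2_eq_square)
  finally have "pi\<^sup>2 * (norm (F (Complex x \<delta> + \<i> * \<epsilon>)))\<^sup>2 \<le> inv_sq_integral * (\<delta> * sqnorm (\<lambda>t. Fe t * k t))"
    by (simp add: power_mult_distrib)
  moreover have "Complex x \<delta> + \<i> * \<epsilon> = Complex x (\<epsilon> + \<delta>)" by (simp add: complex_eq_iff)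
  ultimately show ?thesis
    unfolding Fe_def k_def by (simp add: field_simps)
qed

section \<open>Dyadic decomposition of the Poisson kernel and the covering argument\<close>

lemma sets_lebesgue_cball [measurable]: "cball (x :: real) r \<in> sets lebesgue"
  by simp

text \<open>The least admissible \<open>j\<close>: either it is 0, or the preceding scale is still
  below \<open>\<bar>s\<bar>\<close>, whence the factor 2.\<close>

lemma dyadic_scale_exists:
  assumes "0 < (\<delta> :: real)"
  obtains j :: nat where "\<bar>s\<bar> \<le> 2 ^ j * \<delta>" "2 ^ j * \<delta> \<le> 2 * max \<bar>s\<bar> \<delta>"
proof -
  define P where "P j \<longleftrightarrow> \<bar>s\<bar> \<le> 2 ^ j * \<delta>" for j :: nat
  obtain n :: nat where "\<bar>s\<bar> / \<delta> < 2 ^ n" using real_arch_pow[of 2 "\<bar>s\<bar> / \<delta>"] by auto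
  then have "P n" using assms by (simp add: P_def field_simps)
  define j where "j = (LEAST j. P j)"
  have "P j" unfolding j_def using \<open>P n\<close> by (rule LeastI)
  moreover have "2 ^ j * \<delta> \<le> 2 * max \<bar>s\<bar> \<delta>"
  proof (cases j)
    case (Suc i)
    then have "\<not> P i" using not_less_Least[of i P] by (simp add: j_def)
    then show ?thesis using Suc by (simp add: P_def max_def)
  qed (use assms in \<open>auto simp: max_def\<close>)
  ultimately show ?thesis using that by (simp add: P_def)
qed

text \<open>The Poisson kernel lies below a weighted sum of indicators of the balls of radius
  \<open>2^j \<delta>\<close>. The ball number \<open>j\<close> contributes at most
  \<open>4 a / 2^j\<close>, and these sum to \<open>8 a\<close>.\<close>

lemma poisson_le_of_averages:
  fixes v :: "real \<Rightarrow> ennreal"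
  assumes v [measurable]: "v \<in> borel_measurable lebesgue" and delta: "0 < \<delta>" and a: "0 \<le> a"
    and avg: "\<And>r. 0 < r \<Longrightarrow> (\<integral>\<^sup>+t. v t * indicator (cball x r) t \<partial>lebesgue) \<le> ennreal (a * r)"
  shows "(\<integral>\<^sup>+t. v t * ennreal (\<delta> / ((t - x)\<^sup>2 + \<delta>\<^sup>2)) \<partial>lebesgue) \<le> ennreal (8 * a)"
proof -
  \<comment> \<open>Squaring the dyadic estimate gives
    \<open>4^j \<delta>^2 \<le> 4 ((t - x)^2 + \<delta>^2)\<close>, that is,
    \<open>\<delta> / ((t - x)^2 + \<delta>^2) \<le> c j\<close>.\<close>
  define c where "c j = 4 * (1 / 4) ^ j / \<delta>" for j :: nat
  have c0: "0 \<le> c j" for j using delta by (simp add: c_def)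
  have kernel: "ennreal (\<delta> / ((t - x)\<^sup>2 + \<delta>\<^sup>2)) \<le> (\<Sum>j. ennreal (c j) * indicator (cball x (2 ^ j * \<delta>)) t)" for t
  proof -
    obtain j :: nat where j: "\<bar>t - x\<bar> \<le> 2 ^ j * \<delta>" "2 ^ j * \<delta> \<le> 2 * max \<bar>t - x\<bar> \<delta>"
      using dyadic_scale_exists[OF delta] by blast
    have "(2 ^ j * \<delta>)\<^sup>2 \<le> (2 * max \<bar>t - x\<bar> \<delta>)\<^sup>2"
      using j(2) delta by (intro power_mono) auto
    also have "\<dots> \<le> 4 * ((t - x)\<^sup>2 + \<delta>\<^sup>2)" by (simp add: power_mult_distrib max_def)
    finally have "4 ^ j * \<delta>\<^sup>2 \<le> 4 * ((t - x)\<^sup>2 + \<delta>\<^sup>2)"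
      by (simp add: power_mult_distrib power_mult[symmetric] mult.commute[of j] power_mult)
    moreover have "0 < (t - x)\<^sup>2 + \<delta>\<^sup>2" using delta by (intro add_nonneg_pos) auto
    ultimately have "\<delta> / ((t - x)\<^sup>2 + \<delta>\<^sup>2) \<le> c j"
      using delta by (simp add: c_def field_simps power2_eq_square)
    then have "ennreal (\<delta> / ((t - x)\<^sup>2 + \<delta>\<^sup>2)) \<le> ennreal (c j) * indicator (cball x (2 ^ j * \<delta>)) t"
      using j(1) by (auto simp: indicator_def dist_real_def abs_minus_commute intro: ennreal_leI)
    also have "\<dots> \<le> (\<Sum>j. ennreal (c j) * indicator (cball x (2 ^ j * \<delta>)) t)"
    proof -
      define g where "g j = ennreal (c j) * indicator (cball x (2 ^ j * \<delta>)) t" for j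
      show ?thesis
        unfolding g_def[symmetric] using sum_le_suminf[of g "{j}"] by simp
    qed
    finally show ?thesis .
  qed
  have "(\<integral>\<^sup>+t. v t * ennreal (\<delta> / ((t - x)\<^sup>2 + \<delta>\<^sup>2)) \<partial>lebesgue)
      \<le> (\<integral>\<^sup>+t. (\<Sum>j. ennreal (c j) * (v t * indicator (cball x (2 ^ j * \<delta>)) t)) \<partial>lebesgue)"
  proof (rule nn_integral_mono)
    fix t
    have "v t * ennreal (\<delta> / ((t - x)\<^sup>2 + \<delta>\<^sup>2)) \<le> v t * (\<Sum>j. ennreal (c j) * indicator (cball x (2 ^ j * \<delta>)) t)"
      by (intro mult_left_mono kernel) simp
    also have "\<dots> = (\<Sum>j. v t * (ennreal (c j) * indicator (cball x (2 ^ j * \<delta>)) t))"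
      by (rule ennreal_suminf_cmult[symmetric])
    finally show "v t * ennreal (\<delta> / ((t - x)\<^sup>2 + \<delta>\<^sup>2)) \<le> (\<Sum>j. ennreal (c j) * (v t * indicator (cball x (2 ^ j * \<delta>)) t))"
      by (simp only: mult.left_commute)
  qed
  also have "\<dots> = (\<Sum>j. \<integral>\<^sup>+t. ennreal (c j) * (v t * indicator (cball x (2 ^ j * \<delta>)) t) \<partial>lebesgue)"
    by (rule nn_integral_suminf) measurable
  also have "\<dots> \<le> (\<Sum>j. ennreal (4 * a * (1 / 2) ^ j))"
  proof (intro suminf_le summableI)
    fix j
    have "(\<integral>\<^sup>+t. ennreal (c j) * (v t * indicator (cball x (2 ^ j * \<delta>)) t) \<partial>lebesgue)
        = ennreal (c j) * (\<integral>\<^sup>+t. v t * indicator (cball x (2 ^ j * \<delta>)) t \<partial>lebesgue)"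
      by (rule nn_integral_cmult) measurable
    also have "\<dots> \<le> ennreal (c j) * ennreal (a * (2 ^ j * \<delta>))"
      using delta by (intro mult_left_mono avg) auto
    also have "\<dots> = ennreal (c j * (a * (2 ^ j * \<delta>)))"
      by (rule ennreal_mult[symmetric]) (use c0 a delta in auto)
    also have "c j * (a * (2 ^ j * \<delta>)) = 4 * a * (1 / 2) ^ j"
    proof -
      have "(1 / 4) ^ j * 2 ^ j = ((1 / 2) ^ j :: real)" by (simp flip: power_mult_distrib)
      then show ?thesis using delta by (simp add: c_def)
    qed
    finally show "(\<integral>\<^sup>+t. ennreal (c j) * (v t * indicator (cball x (2 ^ j * \<delta>)) t) \<partial>lebesgue) \<le> ennreal (4 * a * (1 / 2) ^ j)" .
  qed
  also have "\<dots> = ennreal (8 * a)"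
  proof (rule suminf_ennreal_eq)
    have "(\<lambda>j. (1 / 2) ^ j) sums (1 / (1 - 1 / 2 :: real))" by (rule geometric_sums) simp
    from sums_mult[OF this, of "4 * a"] show "(\<lambda>j. 4 * a * (1 / 2) ^ j) sums (8 * a)" by simp
  qed (use a in auto)
  finally show ?thesis .
qed

text \<open>Vitali selects countably many disjoint balls whose fivefold enlargements cover
  \<open>B\<close>; each enlarged interval has length \<open>10 r\<close>, and the mass of
  \<open>v\<close> on the disjoint balls adds up to at most \<open>V\<close>. Averages are
  normalised by the radius, not the length.\<close>

lemma Hardy_Littlewood_weak_type:
  fixes v :: "real \<Rightarrow> ennreal"
  assumes v [measurable]: "v \<in> borel_measurable lebesgue" and fin: "(\<integral>\<^sup>+t. v t \<partial>lebesgue) \<le> ennreal V"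
    and a: "0 < a" and V: "0 \<le> V"
    and B: "\<And>x. x \<in> B \<Longrightarrow> \<exists>r>0. ennreal (a * r) < (\<integral>\<^sup>+t. v t * indicator (cball x r) t \<partial>lebesgue)"
  shows "emeasure lebesgue B \<le> ennreal (10 * V / a)"
proof -
  obtain r where r: "\<And>x. x \<in> B \<Longrightarrow> 0 < r x"
    "\<And>x. x \<in> B \<Longrightarrow> ennreal (a * r x) < (\<integral>\<^sup>+t. v t * indicator (cball x (r x)) t \<partial>lebesgue)"
    using B by metis
  \<comment> \<open>The covering lemma requires bounded radii; they are bounded because the total
    mass of \<open>v\<close> is.\<close>
  have rb: "r x \<le> V / a" if "x \<in> B" for x
  proof -
    have "ennreal (a * r x) \<le> (\<integral>\<^sup>+t. v t * indicator (cball x (r x)) t \<partial>lebesgue)"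
      using r(2)[OF that] by simp
    also have "\<dots> \<le> (\<integral>\<^sup>+t. v t \<partial>lebesgue)"
      by (rule nn_integral_mono) (auto simp: indicator_def)
    also have "\<dots> \<le> ennreal V" by (rule fin)
    finally have "a * r x \<le> V" using V by simp
    then show ?thesis using a by (simp add: field_simps)
  qed
  obtain C where C: "countable C" "C \<subseteq> B"
    "pairwise (\<lambda>i j. disjnt (cball i (r i)) (cball j (r j))) C"
    "B \<subseteq> (\<Union>i\<in>C. cball i (5 * r i))"
  proof (rule Vitali_covering_lemma_cballs[where S = B and K = B and a = "\<lambda>x. x" and r = r and B = "V / a"])
    show "B \<subseteq> (\<Union>i\<in>B. cball i (r i))" using r(1) by force
    show "0 < r i \<and> r i \<le> V / a" if "i \<in> B" for i using r(1) rb that by blast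
  qed blast
  have disj: "disjoint_family_on (\<lambda>i. cball i (r i)) C"
    using C(3) by (auto simp: disjoint_family_on_def pairwise_def disjnt_def)
  have "emeasure lebesgue B \<le> emeasure lebesgue (\<Union>i\<in>C. cball i (5 * r i))"
    by (rule emeasure_mono[OF C(4)]) (auto intro!: sets.countable_UN' C(1))
  also have "\<dots> = (\<integral>\<^sup>+x. indicator (\<Union>i\<in>C. cball i (5 * r i)) x \<partial>lebesgue)"
    by (rule nn_integral_indicator[symmetric]) (auto intro!: sets.countable_UN' C(1))
  also have "\<dots> \<le> (\<integral>\<^sup>+x. (\<integral>\<^sup>+i. indicator (cball i (5 * r i)) x \<partial>count_space C) \<partial>lebesgue)"
  proof (rule nn_integral_mono)
    fix x
    show "indicator (\<Union>i\<in>C. cball i (5 * r i)) x \<le> (\<integral>\<^sup>+i. indicator (cball i (5 * r i)) x \<partial>count_space C)"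
    proof (cases "x \<in> (\<Union>i\<in>C. cball i (5 * r i))")
      case True
      then obtain i where "i \<in> C" "x \<in> cball i (5 * r i)" by blast
      with True show ?thesis
        using nn_integral_ge_point[of i C "\<lambda>i. indicator (cball i (5 * r i)) x :: ennreal"] by simp
    qed simp
  qed
  also have "\<dots> = (\<integral>\<^sup>+i. (\<integral>\<^sup>+x. indicator (cball i (5 * r i)) x \<partial>lebesgue) \<partial>count_space C)"
    by (rule nn_integral_count_space_nn_integral[OF C(1)]) measurable
  also have "\<dots> \<le> (\<integral>\<^sup>+i. ennreal (10 / a) * (\<integral>\<^sup>+t. v t * indicator (cball i (r i)) t \<partial>lebesgue) \<partial>count_space C)"
  proof (rule nn_integral_mono)
    fix i assume "i \<in> space (count_space C)"
    then have i: "i \<in> B" using C(2) by auto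
    have ri: "0 < r i" by (rule r(1)[OF i])
    have "(\<integral>\<^sup>+x. indicator (cball i (5 * r i)) x \<partial>lebesgue) = ennreal (10 * r i)"
      using ri by (simp add: cball_eq_atLeastAtMost emeasure_lborel_Icc_eq)
    also have "\<dots> = ennreal (10 / a) * ennreal (a * r i)"
      using a ri by (simp flip: ennreal_mult)
    also have "\<dots> \<le> ennreal (10 / a) * (\<integral>\<^sup>+t. v t * indicator (cball i (r i)) t \<partial>lebesgue)"
      using r(2)[OF i] by (intro mult_left_mono) auto
    finally show "(\<integral>\<^sup>+x. indicator (cball i (5 * r i)) x \<partial>lebesgue)
      \<le> ennreal (10 / a) * (\<integral>\<^sup>+t. v t * indicator (cball i (r i)) t \<partial>lebesgue)" .
  qed
  \<comment> \<open>As the measure with density \<open>v\<close>, the masses of the disjoint balls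
    can be added.\<close>
  also have "\<dots> = ennreal (10 / a) * (\<integral>\<^sup>+i. emeasure (density lebesgue v) (cball i (r i)) \<partial>count_space C)"
    by (simp add: nn_integral_cmult emeasure_density)
  also have "(\<integral>\<^sup>+i. emeasure (density lebesgue v) (cball i (r i)) \<partial>count_space C) = emeasure (density lebesgue v) (\<Union>i\<in>C. cball i (r i))"
    by (rule emeasure_UN_countable[symmetric]) (use C(1) disj in auto)
  also have "\<dots> \<le> emeasure (density lebesgue v) UNIV"
    using emeasure_space[of "density lebesgue v"] by simp
  also have "emeasure (density lebesgue v) UNIV \<le> ennreal V"
    using fin by (simp add: emeasure_density)
  finally have "emeasure lebesgue B \<le> ennreal (10 / a) * ennreal V"
    by (simp add: mult_left_mono)
  also have "\<dots> = ennreal (10 * V / a)"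
    using a V by (simp flip: ennreal_mult)
  finally show ?thesis .
qed

text \<open>The factors come from the Vitali lemma (10), the dyadic sum (8) and \<open>Lp2_cauchy_transform_line\<close>.\<close>

definition maximal_const :: real where
  "maximal_const = 80 * (inv_sq_integral + 1) * (2 * pi)\<^sup>2"

lemma maximal_const_nonneg: "0 \<le> maximal_const"
  using inv_sq_integral_nonneg by (simp add: maximal_const_def)

text \<open>The maximal function is an uncountable supremum, but its superlevel sets are unions of
  open sets; this settles measurability.\<close>

lemma open_superlevel_vertical:
  assumes f: "f \<in> Lp 2" and eps: "0 \<le> \<epsilon>"
  shows "open {x. \<exists>\<eta>>\<epsilon>. t < norm (cauchy_transform f (Complex x \<eta>))}"
proof -
  have "{x. \<exists>\<eta>>\<epsilon>. t < norm (cauchy_transform f (Complex x \<eta>))} =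
      (\<Union>\<eta>\<in>{\<epsilon><..}. {x. t < norm (cauchy_transform f (Complex x \<eta>))})" by auto
  moreover have "open {x. t < norm (cauchy_transform f (Complex x \<eta>))}" if "\<eta> \<in> {\<epsilon><..}" for \<eta>
    using continuous_cauchy_transform_line[OF f, of \<eta>] that eps
    by (intro open_Collect_less continuous_intros) auto
  ultimately show ?thesis by auto
qed

text \<open>A value above \<open>t\<close> at height \<open>\<eta>\<close> makes the Poisson
  integral of the squared modulus on the line at height \<open>\<epsilon>\<close> large, so some
  average of that L^1 function is large. Thus the L^1 weak-type bound yields one of type
  (2,2).\<close>

lemma weak_type_above:
  assumes f: "f \<in> Lp 2" and eps: "0 < \<epsilon>" and t: "0 < t"
  shows "emeasure lebesgue {x. \<exists>\<eta>>\<epsilon>. t < norm (cauchy_transform f (Complex x \<eta>))} \<le> ennreal (maximal_const * sqnorm f / t\<^sup>2)"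
proof -
  define v where "v x = ennreal ((norm (cauchy_transform f (Complex x \<epsilon>)))\<^sup>2)" for x
  define V where "V = (2 * pi)\<^sup>2 * sqnorm f"
  \<comment> \<open>Chosen so that averages below \<open>a\<close> give a squared modulus at most
    \<open>inv_sq_integral / pi^2 * (8 * a)\<close>, which is at most \<open>t^2\<close>. The
    summand 1 makes the denominator visibly positive.\<close>
  define a where "a = t\<^sup>2 / (8 * (inv_sq_integral + 1))"
  have a: "0 < a" using t inv_sq_integral_nonneg by (simp add: a_def)
  have V: "0 \<le> V" by (simp add: V_def)
  note L2 = Lp2_cauchy_transform_line[OF f eps]
  have [measurable]: "(\<lambda>x. cauchy_transform f (Complex x \<epsilon>)) \<in> borel_measurable lebesgue"
    using L2(1) by (rule Lp2_measurable)
  have vm: "v \<in> borel_measurable lebesgue" unfolding v_def by measurable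
  have fin: "(\<integral>\<^sup>+x. v x \<partial>lebesgue) \<le> ennreal V"
    unfolding v_def nn_integral_eq_integral[OF Lp2_integrable[OF L2(1)] AE_I2[OF zero_le_power2]]
    using L2(2) by (intro ennreal_leI) (simp add: sqnorm_def V_def)
  have "emeasure lebesgue {x. \<exists>\<eta>>\<epsilon>. t < norm (cauchy_transform f (Complex x \<eta>))} \<le> ennreal (10 * V / a)"
  proof (rule Hardy_Littlewood_weak_type[OF vm fin a V])
    fix x assume "x \<in> {x. \<exists>\<eta>>\<epsilon>. t < norm (cauchy_transform f (Complex x \<eta>))}"
    then obtain \<eta> where eta: "\<epsilon> < \<eta>" "t < norm (cauchy_transform f (Complex x \<eta>))" by auto
    define \<delta> where "\<delta> = \<eta> - \<epsilon>"
    have delta: "0 < \<delta>" "\<epsilon> + \<delta> = \<eta>" using eta by (auto simp: \<delta>_def)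
    show "\<exists>r>0. ennreal (a * r) < (\<integral>\<^sup>+t. v t * indicator (cball x r) t \<partial>lebesgue)"
    proof (rule ccontr)
      assume "\<not> ?thesis"
      then have "(\<integral>\<^sup>+t. v t * indicator (cball x r) t \<partial>lebesgue) \<le> ennreal (a * r)" if "0 < r" for r
        using that by (meson not_le)
      then have "(\<integral>\<^sup>+t. v t * ennreal (\<delta> / ((t - x)\<^sup>2 + \<delta>\<^sup>2)) \<partial>lebesgue) \<le> ennreal (8 * a)"
        using a by (intro poisson_le_of_averages vm delta) auto
      also have "(\<integral>\<^sup>+t. v t * ennreal (\<delta> / ((t - x)\<^sup>2 + \<delta>\<^sup>2)) \<partial>lebesgue)
        = (\<integral>\<^sup>+s. ennreal (\<delta> * (norm (cauchy_transform f (Complex s \<epsilon>) * (1 / (complex_of_real s - Complex x \<delta>))))\<^sup>2) \<partial>lebesgue)"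
      proof (rule nn_integral_cong)
        fix s
        have "(norm (complex_of_real s - Complex x \<delta>))\<^sup>2 = (s - x)\<^sup>2 + \<delta>\<^sup>2"
          by (simp add: cmod_power2)
        then show "v s * ennreal (\<delta> / ((s - x)\<^sup>2 + \<delta>\<^sup>2)) =
          ennreal (\<delta> * (norm (cauchy_transform f (Complex s \<epsilon>) * (1 / (complex_of_real s - Complex x \<delta>))))\<^sup>2)"
          unfolding v_def using delta
          by (simp add: ennreal_mult[symmetric] norm_mult norm_divide power_mult_distrib power_divide mult.commute)
      qed
      finally have le: "(\<integral>\<^sup>+s. ennreal (\<delta> * (norm (cauchy_transform f (Complex s \<epsilon>) * (1 / (complex_of_real s - Complex x \<delta>))))\<^sup>2) \<partial>lebesgue) \<le> ennreal (8 * a)" .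
      have "integral\<^sup>L lebesgue (\<lambda>s. \<delta> * (norm (cauchy_transform f (Complex s \<epsilon>) * (1 / (complex_of_real s - Complex x \<delta>))))\<^sup>2) \<le> 8 * a"
        using a delta le by (intro integral_real_bounded) auto
      then have "\<delta> * sqnorm (\<lambda>s. cauchy_transform f (Complex s \<epsilon>) * (1 / (complex_of_real s - Complex x \<delta>))) \<le> 8 * a"
        by (simp add: sqnorm_def)
      moreover have "(norm (cauchy_transform f (Complex x (\<epsilon> + \<delta>))))\<^sup>2 \<le> inv_sq_integral / pi\<^sup>2 *
          (\<delta> * sqnorm (\<lambda>s. cauchy_transform f (Complex s \<epsilon>) * (1 / (complex_of_real s - Complex x \<delta>))))"
        by (rule norm_square_le_poisson[OF holomorphic_cauchy_transform_upper[OF f] _ eps L2(1) delta(1)])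
           (rule cauchy_transform_bound_half_plane[OF f])
      moreover have "0 \<le> inv_sq_integral / pi\<^sup>2" using inv_sq_integral_nonneg by simp
      ultimately have "(norm (cauchy_transform f (Complex x \<eta>)))\<^sup>2 \<le> inv_sq_integral / pi\<^sup>2 * (8 * a)"
        unfolding delta(2) by (meson mult_left_mono order_trans)
      also have "\<dots> = (inv_sq_integral / (inv_sq_integral + 1)) * (t\<^sup>2 / pi\<^sup>2)"
      proof -
        have "8 * a = t\<^sup>2 / (inv_sq_integral + 1)"
          using inv_sq_integral_nonneg by (simp add: a_def divide_simps)
        then show ?thesis by (simp add: ac_simps)
      qed
      also have "\<dots> \<le> 1 * (t\<^sup>2 / 1)"
        using inv_sq_integral_nonneg pi_gt3
        by (intro mult_mono divide_left_mono) (auto simp: divide_le_eq one_le_power)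
      finally have "norm (cauchy_transform f (Complex x \<eta>)) \<le> t"
        using t by (simp add: power2_le_iff_abs_le)
      then show False using eta by simp
    qed
  qed
  also have "10 * V / a = maximal_const * sqnorm f / t\<^sup>2"
    using t inv_sq_integral_nonneg by (simp add: V_def a_def maximal_const_def field_simps)
  finally show ?thesis .
qed

text \<open>The bound above height \<open>\<epsilon>\<close> is independent of
  \<open>\<epsilon>\<close>, so continuity from below applies along
  \<open>1 / Suc n\<close>.\<close>

theorem weak_type_vertical:
  assumes f: "f \<in> Lp 2" and t: "0 < t"
  shows "emeasure lebesgue {x. \<exists>\<eta>>0. t < norm (cauchy_transform f (Complex x \<eta>))} \<le> ennreal (maximal_const * sqnorm f / t\<^sup>2)"
proof -
  define A where "A n = {x. \<exists>\<eta>>1 / real (Suc n). t < norm (cauchy_transform f (Complex x \<eta>))}" for n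
  have Aopen: "open (A n)" for n
    unfolding A_def by (rule open_superlevel_vertical[OF f]) simp
  have eq: "{x. \<exists>\<eta>>0. t < norm (cauchy_transform f (Complex x \<eta>))} = (\<Union>n. A n)"
  proof (intro equalityI subsetI)
    fix x assume "x \<in> {x. \<exists>\<eta>>0. t < norm (cauchy_transform f (Complex x \<eta>))}"
    then obtain \<eta> where eta: "0 < \<eta>" "t < norm (cauchy_transform f (Complex x \<eta>))" by auto
    obtain n where "1 / real (Suc n) < \<eta>" using nat_approx_posE[OF eta(1)] by blast
    then show "x \<in> (\<Union>n. A n)" using eta(2) unfolding A_def by auto
  next
    fix x assume "x \<in> (\<Union>n. A n)"
    then obtain n \<eta> where "1 / real (Suc n) < \<eta>" "t < norm (cauchy_transform f (Complex x \<eta>))"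
      unfolding A_def by auto
    moreover have "0 < 1 / real (Suc n)" by simp
    ultimately show "x \<in> {x. \<exists>\<eta>>0. t < norm (cauchy_transform f (Complex x \<eta>))}"
      using less_trans by blast
  qed
  have inc: "incseq A"
  proof (rule incseq_SucI, rule subsetI)
    fix n x assume "x \<in> A n"
    then obtain \<eta> where "1 / real (Suc n) < \<eta>" "t < norm (cauchy_transform f (Complex x \<eta>))"
      unfolding A_def by auto
    moreover have "1 / real (Suc (Suc n)) \<le> 1 / real (Suc n)" by (intro divide_left_mono) auto
    ultimately show "x \<in> A (Suc n)" unfolding A_def by (auto intro: le_less_trans)
  qed
  have "emeasure lebesgue (\<Union>n. A n) = (SUP n. emeasure lebesgue (A n))"
    using Aopen by (intro SUP_emeasure_incseq[symmetric] inc) auto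
  also have "\<dots> \<le> ennreal (maximal_const * sqnorm f / t\<^sup>2)"
    unfolding A_def by (intro SUP_least weak_type_above f t) simp
  finally show ?thesis unfolding eq .
qed

section \<open>Boundary values and the jump relation\<close>

text \<open>Vertical limits are the ones in \<open>riesz_plus\<close>, and the vertical maximal
  function controls exactly these.\<close>

definition boundary_values :: "(complex \<Rightarrow> complex) \<Rightarrow> real \<Rightarrow> complex \<Rightarrow> complex \<Rightarrow> bool" where
  "boundary_values F x L L' \<longleftrightarrow> ((\<lambda>\<epsilon>. F (Complex x \<epsilon>)) \<longlongrightarrow> L) (at_right 0) \<and>
     ((\<lambda>\<epsilon>. F (Complex x (- \<epsilon>))) \<longlongrightarrow> L') (at_right 0)"

text \<open>Existence of the limits and the value of the jump are bundled because both pass to L^2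
  limits by the same argument.\<close>

definition plemelj :: "(real \<Rightarrow> complex) \<Rightarrow> bool" where
  "plemelj f \<longleftrightarrow> (AE x in lebesgue. \<exists>L L'. boundary_values (cauchy_transform f) x L L' \<and> L - L' = 2 * pi * \<i> * f x)"

text \<open>Interchange of the limits in \<open>n\<close> and \<open>\<epsilon>\<close>: closeness
  to the common \<open>h\<close> makes \<open>L\<close> Cauchy. The threshold \<open>n0\<close> is a
  parameter since Borel--Cantelli provides it separately for each point.\<close>

lemma tendsto_uniform_approx:
  fixes h :: "real \<Rightarrow> complex"
  assumes u: "\<And>n. (u n \<longlongrightarrow> L n) (at_right 0)"
    and approx: "\<And>n \<epsilon>. n0 \<le> n \<Longrightarrow> 0 < \<epsilon> \<Longrightarrow> norm (h \<epsilon> - u n \<epsilon>) \<le> (1 / 2) ^ n"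
  obtains l where "L \<longlonglongrightarrow> l" "(h \<longlongrightarrow> l) (at_right 0)"
proof -
  have pos: "\<forall>\<^sub>F \<epsilon> in at_right (0::real). \<epsilon> \<in> {0<..}"
    by (auto simp: eventually_at_right_less)
  have Lb: "dist (L n) (L m) \<le> (1 / 2) ^ n + (1 / 2) ^ m" if "n0 \<le> n" "n0 \<le> m" for n m
  proof (rule tendsto_upperbound)
    show "((\<lambda>\<epsilon>. dist (u n \<epsilon>) (u m \<epsilon>)) \<longlongrightarrow> dist (L n) (L m)) (at_right 0)"
      by (intro tendsto_dist u)
    show "\<forall>\<^sub>F \<epsilon> in at_right 0. dist (u n \<epsilon>) (u m \<epsilon>) \<le> (1 / 2) ^ n + (1 / 2) ^ m"
      using pos
    proof eventually_elim
      case (elim \<epsilon>)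
      then have "norm (h \<epsilon> - u n \<epsilon>) \<le> (1 / 2) ^ n" "norm (h \<epsilon> - u m \<epsilon>) \<le> (1 / 2) ^ m"
        using approx that by auto
      then show ?case
        using dist_triangle2[of "u n \<epsilon>" "u m \<epsilon>" "h \<epsilon>"] by (simp add: dist_norm norm_minus_commute)
    qed
  qed simp
  have small: "\<exists>N\<ge>n0. \<forall>n\<ge>N. (1 / 2) ^ n < (e :: real)" if "0 < e" for e
  proof -
    have "(\<lambda>n. (1 / 2) ^ n :: real) \<longlonglongrightarrow> 0" by (rule LIMSEQ_realpow_zero) auto
    from order_tendstoD(2)[OF this that] obtain N where "\<forall>n\<ge>N. (1 / 2) ^ n < e"
      by (auto simp: eventually_sequentially)
    then show ?thesis by (intro exI[of _ "max N n0"]) auto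
  qed
  have "Cauchy L"
  proof (rule metric_CauchyI)
    fix e :: real assume "0 < e"
    then obtain N where N: "n0 \<le> N" "\<forall>n\<ge>N. (1 / 2) ^ n < e / 2" using small[of "e / 2"] by auto
    have "dist (L m) (L n) < e" if "N \<le> m" "N \<le> n" for m n
    proof -
      have "(1 / 2) ^ m < e / 2" "(1 / 2) ^ n < e / 2" using N(2) that by blast+
      then show ?thesis using Lb[of m n] N(1) that by linarith
    qed
    then show "\<exists>M. \<forall>m\<ge>M. \<forall>n\<ge>M. dist (L m) (L n) < e" by blast
  qed
  then obtain l where l: "L \<longlonglongrightarrow> l" using Cauchy_convergent convergent_def by blast
  have "uniform_limit {0<..} u h sequentially"
  proof (rule uniform_limitI)
    fix e :: real assume "0 < e"
    then obtain N where N: "n0 \<le> N" "\<forall>n\<ge>N. (1 / 2) ^ n < e" using small by auto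
    then show "\<forall>\<^sub>F n in sequentially. \<forall>x\<in>{0<..}. dist (u n x) (h x) < e"
      by (intro eventually_sequentiallyI[of N])
         (metis approx dist_commute dist_norm greaterThan_iff le_less_trans order_trans)
  qed
  from swap_uniform_limit'[OF always_eventually[OF allI[OF u]] l this pos] have "(h \<longlongrightarrow> l) (at_right 0)" by simp
  then show ?thesis using that l by blast
qed

lemma weak_type_vertical_lower:
  assumes f: "f \<in> Lp 2" and t: "0 < t"
  shows "open {x. \<exists>\<eta>>0. t < norm (cauchy_transform f (Complex x (- \<eta>)))}"
    and "emeasure lebesgue {x. \<exists>\<eta>>0. t < norm (cauchy_transform f (Complex x (- \<eta>)))} \<le> ennreal (maximal_const * sqnorm f / t\<^sup>2)"
proof -
  have "norm (cauchy_transform (\<lambda>x. cnj (f x)) (Complex x \<eta>)) = norm (cauchy_transform f (Complex x (- \<eta>)))" for x \<eta>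
  proof -
    have "cnj (Complex x \<eta>) = Complex x (- \<eta>)" by (simp add: complex_eq_iff)
    then show ?thesis by (simp add: cauchy_transform_cnj)
  qed
  then show "open {x. \<exists>\<eta>>0. t < norm (cauchy_transform f (Complex x (- \<eta>)))}"
    and "emeasure lebesgue {x. \<exists>\<eta>>0. t < norm (cauchy_transform f (Complex x (- \<eta>)))} \<le> ennreal (maximal_const * sqnorm f / t\<^sup>2)"
    using open_superlevel_vertical[OF Lp2_cnj[OF f], of 0 t] weak_type_vertical[OF Lp2_cnj[OF f] t]
    by (simp_all add: sqnorm_cnj)
qed

lemma Chebyshev_Lp2:
  assumes f: "f \<in> Lp 2" and t: "0 < t"
  shows "{x. t < norm (f x)} \<in> sets lebesgue"
    and "emeasure lebesgue {x. t < norm (f x)} \<le> ennreal (sqnorm f / t\<^sup>2)"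
proof -
  have [measurable]: "f \<in> borel_measurable lebesgue" using f by (rule Lp2_measurable)
  have "{x \<in> space lebesgue. t < norm (f x)} \<in> sets lebesgue" by measurable
  then show "{x. t < norm (f x)} \<in> sets lebesgue" by simp
  have m: "{x \<in> space lebesgue. t\<^sup>2 \<le> (norm (f x))\<^sup>2} \<in> sets lebesgue" by measurable
  have "emeasure lebesgue {x. t < norm (f x)} \<le> emeasure lebesgue {x \<in> space lebesgue. t\<^sup>2 \<le> (norm (f x))\<^sup>2}"
    using t by (intro emeasure_mono m) (auto intro!: power_mono)
  also have "\<dots> \<le> ennreal ((1 / t\<^sup>2) * (LINT x|lebesgue. (norm (f x))\<^sup>2))"
    by (rule integral_Markov_inequality) (use t Lp2_integrable[OF f] in auto)
  finally show "emeasure lebesgue {x. t < norm (f x)} \<le> ennreal (sqnorm f / t\<^sup>2)"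
    by (simp add: sqnorm_def)
qed

text \<open>The weak-type bound and Borel--Cantelli, along a subsequence converging fast enough.\<close>

lemma plemelj_closed:
  assumes g: "\<And>m. g m \<in> Lp 2" "\<And>m. plemelj (g m)" and f: "f \<in> Lp 2"
    and lim: "(\<lambda>m. sqnorm (\<lambda>x. f x - g m x)) \<longlonglongrightarrow> 0"
  shows "plemelj f"
proof -
  \<comment> \<open>The rate \<open>8^(-n)\<close>, divided by the squared level
    \<open>4^(-n)\<close>, leaves the summable \<open>2^(-n)\<close>.\<close>
  have "\<exists>m. sqnorm (\<lambda>x. f x - g m x) < (1 / 8) ^ n" for n :: nat
    using order_tendstoD(2)[OF lim, of "(1 / 8) ^ n"] by (auto simp: eventually_sequentially)
  then obtain r where r: "\<And>n. sqnorm (\<lambda>x. f x - g (r n) x) < (1 / 8) ^ n" by metis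
  define d where "d n x = f x - g (r n) x" for n x
  have d: "d n \<in> Lp 2" "sqnorm (d n) \<le> (1 / 8) ^ n" for n
    using Lp2_diff[OF f g(1), of "r n"] r[of n] unfolding d_def by auto
  define t where "t n = (1 / 2 :: real) ^ n" for n :: nat
  have t: "0 < t n" for n by (simp add: t_def)
  define A1 where "A1 n = {x. \<exists>\<eta>>0. t n < norm (cauchy_transform (d n) (Complex x \<eta>))}" for n
  define A2 where "A2 n = {x. \<exists>\<eta>>0. t n < norm (cauchy_transform (d n) (Complex x (- \<eta>)))}" for n
  \<comment> \<open>\<open>A1\<close> and \<open>A2\<close> control the transforms on the two sides;
    \<open>A3\<close> makes \<open>g (r n) x\<close> converge to \<open>f x\<close>, which
    identifies the jump in the limit.\<close>
  define A3 where "A3 n = {x. t n < norm (d n x)}" for n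
  have q: "c * sqnorm (d n) / (t n)\<^sup>2 \<le> c * (1 / 2) ^ n" if "0 \<le> c" for c n
  proof -
    have "(t n)\<^sup>2 = (1 / 4) ^ n"
      unfolding t_def power2_eq_square power_mult_distrib[symmetric] by simp
    then have "(1 / 8) ^ n / (t n)\<^sup>2 = ((1 / 8) / (1 / 4) :: real) ^ n"
      by (simp only: power_divide)
    then have "(1 / 8) ^ n / (t n)\<^sup>2 = (1 / 2 :: real) ^ n" by simp
    moreover have "sqnorm (d n) / (t n)\<^sup>2 \<le> (1 / 8) ^ n / (t n)\<^sup>2" by (intro divide_right_mono d) simp
    ultimately have "sqnorm (d n) / (t n)\<^sup>2 \<le> (1 / 2) ^ n" by simp
    then have "c * (sqnorm (d n) / (t n)\<^sup>2) \<le> c * (1 / 2) ^ n" using that by (rule mult_left_mono)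
    then show ?thesis by simp
  qed
  have A1: "A1 n \<in> sets lebesgue" "emeasure lebesgue (A1 n) \<le> ennreal (maximal_const * (1 / 2) ^ n)" for n
  proof -
    show "A1 n \<in> sets lebesgue" unfolding A1_def using open_superlevel_vertical[OF d(1), of 0] by auto
    show "emeasure lebesgue (A1 n) \<le> ennreal (maximal_const * (1 / 2) ^ n)"
      unfolding A1_def by (rule order_trans[OF weak_type_vertical[OF d(1) t] ennreal_leI[OF q[OF maximal_const_nonneg]]])
  qed
  have A2: "A2 n \<in> sets lebesgue" "emeasure lebesgue (A2 n) \<le> ennreal (maximal_const * (1 / 2) ^ n)" for n
  proof -
    show "A2 n \<in> sets lebesgue" unfolding A2_def using weak_type_vertical_lower(1)[OF d(1) t] by auto
    show "emeasure lebesgue (A2 n) \<le> ennreal (maximal_const * (1 / 2) ^ n)"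
      unfolding A2_def by (rule order_trans[OF weak_type_vertical_lower(2)[OF d(1) t] ennreal_leI[OF q[OF maximal_const_nonneg]]])
  qed
  have A3: "A3 n \<in> sets lebesgue" "emeasure lebesgue (A3 n) \<le> ennreal (1 * (1 / 2) ^ n)" for n
  proof -
    show "A3 n \<in> sets lebesgue" unfolding A3_def by (rule Chebyshev_Lp2(1)[OF d(1) t])
    show "emeasure lebesgue (A3 n) \<le> ennreal (1 * (1 / 2) ^ n)"
      using order_trans[OF Chebyshev_Lp2(2)[OF d(1) t] ennreal_leI] q[of 1] unfolding A3_def by simp
  qed
  have BC: "AE x in lebesgue. \<forall>\<^sub>F n in sequentially. x \<in> space lebesgue - A n"
    if A: "\<And>n. A n \<in> sets lebesgue" "\<And>n. emeasure lebesgue (A n) \<le> ennreal (c * (1 / 2) ^ n)" and c: "0 \<le> c" for A c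
  proof (rule borel_cantelli_AE1[OF A(1)])
    show fin: "emeasure lebesgue (A n) < \<infinity>" for n
      by (rule le_less_trans[OF A(2)]) simp
    show "summable (\<lambda>n. measure lebesgue (A n))"
    proof (rule summable_comparison_test')
      show "summable (\<lambda>n. c * (1 / 2 :: real) ^ n)" by (intro summable_mult summable_geometric) simp
      show "norm (measure lebesgue (A n)) \<le> c * (1 / 2) ^ n" for n
        using A(2)[of n] c by (simp add: measure_def enn2real_leI)
    qed
  qed
  have pl: "AE x in lebesgue. \<forall>n. \<exists>L L'. boundary_values (cauchy_transform (g (r n))) x L L' \<and> L - L' = 2 * pi * \<i> * g (r n) x"
    using g(2) unfolding plemelj_def AE_all_countable by blast
  show ?thesis
    unfolding plemelj_def
    using BC[OF A1 maximal_const_nonneg] BC[OF A2 maximal_const_nonneg] BC[OF A3 zero_le_one] pl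
  proof eventually_elim
    case (elim x)
    have "\<forall>\<^sub>F n in sequentially. x \<notin> A1 n \<and> x \<notin> A2 n \<and> x \<notin> A3 n"
      using elim(1-3) by eventually_elim auto
    then obtain n0 where n0: "\<And>n. n0 \<le> n \<Longrightarrow> x \<notin> A1 n \<and> x \<notin> A2 n \<and> x \<notin> A3 n"
      by (auto simp: eventually_sequentially)
    from elim(4) obtain L L' where
      L: "\<And>n. boundary_values (cauchy_transform (g (r n))) x (L n) (L' n)"
         "\<And>n. L n - L' n = 2 * pi * \<i> * g (r n) x" by metis
    have dz: "cauchy_transform (d n) z = cauchy_transform f z - cauchy_transform (g (r n)) z" if "Im z \<noteq> 0" for n z
      unfolding d_def using cauchy_transform_diff[OF f g(1) that] by simp
    have b1: "norm (cauchy_transform f (Complex x \<epsilon>) - cauchy_transform (g (r n)) (Complex x \<epsilon>)) \<le> (1 / 2) ^ n"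
      if "n0 \<le> n" "0 < \<epsilon>" for n \<epsilon>
    proof -
      have "norm (cauchy_transform (d n) (Complex x \<epsilon>)) \<le> (1 / 2) ^ n"
        using n0[OF that(1)] that(2) unfolding A1_def t_def mem_Collect_eq not_ex not_less by (meson not_le)
      then show ?thesis using that(2) by (simp add: dz)
    qed
    have b2: "norm (cauchy_transform f (Complex x (- \<epsilon>)) - cauchy_transform (g (r n)) (Complex x (- \<epsilon>))) \<le> (1 / 2) ^ n"
      if "n0 \<le> n" "0 < \<epsilon>" for n \<epsilon>
    proof -
      have "norm (cauchy_transform (d n) (Complex x (- \<epsilon>))) \<le> (1 / 2) ^ n"
        using n0[OF that(1)] that(2) unfolding A2_def t_def mem_Collect_eq not_ex not_less by (meson not_le)
      then show ?thesis using that(2) by (simp add: dz)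
    qed
    obtain l where l: "L \<longlonglongrightarrow> l" "((\<lambda>\<epsilon>. cauchy_transform f (Complex x \<epsilon>)) \<longlongrightarrow> l) (at_right 0)"
      using tendsto_uniform_approx[where u = "\<lambda>n \<epsilon>. cauchy_transform (g (r n)) (Complex x \<epsilon>)" and h = "\<lambda>\<epsilon>. cauchy_transform f (Complex x \<epsilon>)" and L = L and ?n0.0 = n0]
        L(1) b1 unfolding boundary_values_def by blast
    obtain l' where l': "L' \<longlonglongrightarrow> l'" "((\<lambda>\<epsilon>. cauchy_transform f (Complex x (- \<epsilon>))) \<longlongrightarrow> l') (at_right 0)"
      using tendsto_uniform_approx[where u = "\<lambda>n \<epsilon>. cauchy_transform (g (r n)) (Complex x (- \<epsilon>))" and h = "\<lambda>\<epsilon>. cauchy_transform f (Complex x (- \<epsilon>))" and L = L' and ?n0.0 = n0]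
        L(1) b2 unfolding boundary_values_def by blast
    have "(\<lambda>n. g (r n) x - f x) \<longlonglongrightarrow> 0"
    proof (rule Lim_null_comparison)
      show "\<forall>\<^sub>F n in sequentially. norm (g (r n) x - f x) \<le> (1 / 2) ^ n"
        using n0 by (intro eventually_sequentiallyI[of n0]) (auto simp: A3_def t_def d_def not_less norm_minus_commute)
      show "(\<lambda>n. (1 / 2) ^ n :: real) \<longlonglongrightarrow> 0" by (rule LIMSEQ_realpow_zero) auto
    qed
    then have "(\<lambda>n. g (r n) x) \<longlonglongrightarrow> f x" by (simp add: Lim_null[symmetric])
    then have "(\<lambda>n. L n - L' n) \<longlonglongrightarrow> 2 * pi * \<i> * f x" unfolding L(2) by (intro tendsto_intros)
    moreover have "(\<lambda>n. L n - L' n) \<longlonglongrightarrow> l - l'" by (intro tendsto_diff l l')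
    ultimately have "l - l' = 2 * pi * \<i> * f x" using LIMSEQ_unique by blast
    then show ?case using l(2) l'(2) unfolding boundary_values_def by blast
  qed
qed

section \<open>Algebra of boundary values and closure properties of the jump relation\<close>

lemma plemelj_cong_AE:
  assumes "plemelj g" "f \<in> borel_measurable lebesgue" "g \<in> borel_measurable lebesgue" "AE x in lebesgue. f x = g x"
  shows "plemelj f"
proof -
  have "cauchy_transform f = cauchy_transform g"
    using cauchy_transform_cong_AE[OF assms(2-4)] by (intro ext)
  then show ?thesis
    using assms(1,4) unfolding plemelj_def by (auto elim!: AE_mp)
qed

lemma eventually_Im_nonzero: "\<forall>\<^sub>F \<epsilon> in at_right (0::real). Im (Complex x \<epsilon>) \<noteq> 0 \<and> Im (Complex x (- \<epsilon>)) \<noteq> 0"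
  using eventually_at_right_less[of "0::real"] by eventually_elim auto

lemma boundary_values_add:
  "boundary_values F x L L' \<Longrightarrow> boundary_values G x M M' \<Longrightarrow> boundary_values (\<lambda>z. F z + G z) x (L + M) (L' + M')"
  unfolding boundary_values_def by (auto intro!: tendsto_add)

lemma boundary_values_mult:
  "boundary_values F x L L' \<Longrightarrow> boundary_values G x M M' \<Longrightarrow> boundary_values (\<lambda>z. F z * G z) x (L * M) (L' * M')"
  unfolding boundary_values_def by (auto intro!: tendsto_mult)

lemma boundary_values_const: "boundary_values (\<lambda>z. c) x c c"
  unfolding boundary_values_def by auto

lemma boundary_values_linear:
  assumes f: "f \<in> Lp 2" and g: "g \<in> Lp 2"
    and "boundary_values (cauchy_transform f) x L L'" "boundary_values (cauchy_transform g) x M M'"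
  shows "boundary_values (cauchy_transform (\<lambda>x. a * f x + b * g x)) x (a * L + b * M) (a * L' + b * M')"
proof -
  have eq: "a * cauchy_transform f z + b * cauchy_transform g z = cauchy_transform (\<lambda>x. a * f x + b * g x) z" if "Im z \<noteq> 0" for z
    using cauchy_transform_add[OF Lp2_cmult[OF f] Lp2_cmult[OF g] that, of a b] by (simp add: cauchy_transform_cmult)
  have "boundary_values (\<lambda>z. a * cauchy_transform f z + b * cauchy_transform g z) x (a * L + b * M) (a * L' + b * M')"
    by (intro boundary_values_add boundary_values_mult boundary_values_const assms)
  then show ?thesis
    unfolding boundary_values_def
    by (auto elim!: Lim_transform_eventually intro!: eventually_mono[OF eventually_Im_nonzero[of x]] simp: eq)
qed

lemma plemelj_linear:
  assumes f: "f \<in> Lp 2" "plemelj f" and g: "g \<in> Lp 2" "plemelj g"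
  shows "plemelj (\<lambda>x. a * f x + b * g x)"
  using f(2) g(2) unfolding plemelj_def
proof eventually_elim
  case (elim x)
  then obtain L L' M M' where
    *: "boundary_values (cauchy_transform f) x L L'" "L - L' = 2 * pi * \<i> * f x"
      "boundary_values (cauchy_transform g) x M M'" "M - M' = 2 * pi * \<i> * g x" by blast
  have "(a * L + b * M) - (a * L' + b * M') = a * (L - L') + b * (M - M')" by (simp add: algebra_simps)
  also have "\<dots> = 2 * pi * \<i> * (a * f x + b * g x)" unfolding * by (simp add: algebra_simps)
  finally show ?case using boundary_values_linear[OF f(1) g(1) *(1,3)] by blast
qed

lemma plemelj_zero: "plemelj (\<lambda>x. 0)"
  unfolding plemelj_def boundary_values_def
  by (intro AE_I2 exI[of _ 0]) (simp add: cauchy_transform_def)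

lemma plemelj_sum:
  assumes "finite I" "\<And>i. i \<in> I \<Longrightarrow> f i \<in> Lp 2" "\<And>i. i \<in> I \<Longrightarrow> plemelj (f i)"
  shows "plemelj (\<lambda>x. \<Sum>i\<in>I. f i x)"
  using assms
proof (induction I)
  case (insert i I)
  then show ?case
    using plemelj_linear[of "f i" "\<lambda>x. \<Sum>i\<in>I. f i x" 1 1] Lp2_sum[of I f] by simp
qed (simp add: plemelj_zero)

text \<open>Domination by an L^2 function upgrades pointwise to L^2 convergence; this form of
  closedness suits sets and simple functions.\<close>

lemma plemelj_dominated_limit:
  assumes u: "\<And>m. u m \<in> Lp 2" "\<And>m. plemelj (u m)" and w: "w \<in> Lp 2"
    and dom: "\<And>m x. norm (u m x) \<le> norm (w x)"
    and lim: "\<And>x. (\<lambda>m. u m x) \<longlonglongrightarrow> f x" and f: "f \<in> borel_measurable lebesgue"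
  shows "plemelj f"
proof -
  have [measurable]: "u m \<in> borel_measurable lebesgue" "w \<in> borel_measurable lebesgue" "f \<in> borel_measurable lebesgue" for m
    using u(1) w f by (auto simp: Lp2_measurable)
  have fw: "norm (f x) \<le> norm (w x)" for x
    by (rule LIMSEQ_le_const2[OF tendsto_norm[OF lim]]) (use dom in auto)
  have f2: "f \<in> Lp 2" by (rule Lp2_bound[OF f w, of 1]) (use fw in auto)
  have "(\<lambda>m. LINT x|lebesgue. (norm (f x - u m x))\<^sup>2) \<longlonglongrightarrow> (LINT x::real|lebesgue. (0::real))"
  proof (rule integral_dominated_convergence[where w = "\<lambda>x. 4 * (norm (w x))\<^sup>2"])
    show "integrable lebesgue (\<lambda>x. 4 * (norm (w x))\<^sup>2)" using Lp2_integrable[OF w] by auto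
    show "AE x in lebesgue. (\<lambda>m. (norm (f x - u m x))\<^sup>2) \<longlonglongrightarrow> 0"
    proof (rule AE_I2)
      fix x
      have "(\<lambda>m. (norm (f x - u m x))\<^sup>2) \<longlonglongrightarrow> (norm (f x - f x))\<^sup>2"
        by (intro tendsto_intros lim)
      then show "(\<lambda>m. (norm (f x - u m x))\<^sup>2) \<longlonglongrightarrow> 0" by simp
    qed
    show "AE x in lebesgue. norm ((norm (f x - u m x))\<^sup>2) \<le> 4 * (norm (w x))\<^sup>2" for m
    proof (rule AE_I2)
      fix x
      have "norm (f x - u m x) \<le> 2 * norm (w x)"
        using norm_triangle_ineq4[of "f x" "u m x"] fw[of x] dom[of m x] by linarith
      then have "(norm (f x - u m x))\<^sup>2 \<le> (2 * norm (w x))\<^sup>2" by (rule power_mono) simp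
      then show "norm ((norm (f x - u m x))\<^sup>2) \<le> 4 * (norm (w x))\<^sup>2" by (simp add: power_mult_distrib)
    qed
  qed measurable
  then have "(\<lambda>m. sqnorm (\<lambda>x. f x - u m x)) \<longlonglongrightarrow> 0" by (simp add: sqnorm_def)
  from plemelj_closed[OF u f2 this] show ?thesis .
qed

subsection \<open>Indicator functions\<close>

lemma indicator_Lp2:
  assumes "A \<in> sets lebesgue" "A \<subseteq> {a..b}"
  shows "indicator A \<in> Lp 2"
proof -
  have "emeasure lebesgue A \<le> emeasure lebesgue {a..b}" by (rule emeasure_mono[OF assms(2)]) simp
  also have "\<dots> < \<infinity>" by (simp add: emeasure_lborel_Icc_eq)
  finally have "integrable lebesgue (indicator A :: real \<Rightarrow> real)"
    by (intro integrable_real_indicator assms(1)) simp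
  moreover have "(norm (indicator A x :: complex))\<^sup>2 = (indicator A x :: real)" for x by (simp add: indicator_def)
  ultimately show ?thesis
    unfolding Lp2_iff using assms(1) by auto
qed

text \<open>For nonreal \<open>z\<close> the segment of all \<open>x - z\<close> avoids the branch
  cut of \<open>Ln\<close>, so the principal branch is a primitive.\<close>

lemma cauchy_transform_indicator_interval:
  assumes ab: "a \<le> b" and z: "Im z \<noteq> 0"
  shows "cauchy_transform (indicator {a..b}) z = Ln (complex_of_real b - z) - Ln (complex_of_real a - z)"
proof -
  have "((\<lambda>x. 1 / (complex_of_real x - z)) has_integral (Ln (complex_of_real b - z) - Ln (complex_of_real a - z))) {a..b}"
  proof (rule fundamental_theorem_of_calculus[OF ab])
    fix x assume "x \<in> {a..b}"
    have nz: "complex_of_real x - z \<notin> \<real>\<^sub>\<le>\<^sub>0" using z by (auto simp: complex_nonpos_Reals_iff)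
    have "((\<lambda>w. Ln (w - z)) has_field_derivative 1 / (complex_of_real x - z)) (at (complex_of_real x))"
      using nz by (auto intro!: derivative_eq_intros simp: inverse_eq_divide)
    then have "((\<lambda>x. Ln (complex_of_real x - z)) has_vector_derivative 1 / (complex_of_real x - z)) (at x)"
      by (rule has_vector_derivative_real_field)
    then show "((\<lambda>x. Ln (complex_of_real x - z)) has_vector_derivative 1 / (complex_of_real x - z)) (at x within {a..b})"
      by (rule has_vector_derivative_at_within)
  qed
  then have "integral {a..b} (\<lambda>x. 1 / (complex_of_real x - z)) = Ln (complex_of_real b - z) - Ln (complex_of_real a - z)"
    by (rule integral_unique)
  moreover have "(LINT x:{a..b}|lebesgue. 1 / (complex_of_real x - z)) = integral {a..b} (\<lambda>x. 1 / (complex_of_real x - z))"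
  proof (rule set_lebesgue_integral_eq_integral(2))
    have eq: "indicator {a..b} x / (complex_of_real x - z) = indicator {a..b} x *\<^sub>R (1 / (complex_of_real x - z))" for x
      by (simp add: indicator_def)
    have "integrable lebesgue (\<lambda>x. indicator {a..b} x / (complex_of_real x - z))"
      by (intro cauchy_transform_integrable indicator_Lp2[of _ a b] z) auto
    then show "set_integrable lebesgue {a..b} (\<lambda>x. 1 / (complex_of_real x - z))"
      unfolding set_integrable_def eq .
  qed
  moreover have "cauchy_transform (indicator {a..b}) z = (LINT x:{a..b}|lebesgue. 1 / (complex_of_real x - z))"
    unfolding cauchy_transform_def set_lebesgue_integral_def
    by (rule Bochner_Integration.integral_cong) (auto simp: indicator_def)
  ultimately show ?thesis by simp
qed

text \<open>The two values \<open>\<i> * pi\<close> and \<open>- \<i> * pi\<close> across the branch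
  cut are the origin of the jump \<open>2 * pi * \<i>\<close>. For \<open>u < 0\<close> the limit is
  moved off the cut by the rule for \<open>Ln (- z)\<close>.\<close>

lemma tendsto_Ln_vertical:
  assumes "u \<noteq> 0"
  shows "((\<lambda>\<epsilon>. Ln (Complex u \<epsilon>)) \<longlongrightarrow> complex_of_real (ln \<bar>u\<bar>) + (if u < 0 then \<i> * complex_of_real pi else 0)) (at_right 0)"
    and "((\<lambda>\<epsilon>. Ln (Complex u (- \<epsilon>))) \<longlongrightarrow> complex_of_real (ln \<bar>u\<bar>) - (if u < 0 then \<i> * complex_of_real pi else 0)) (at_right 0)"
proof -
  have pos: "((\<lambda>\<epsilon>. Ln (Complex v (s * \<epsilon>))) \<longlongrightarrow> complex_of_real (ln v)) (at_right 0)" if "0 < v" for v s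
  proof -
    have "((\<lambda>\<epsilon>. Complex v (s * \<epsilon>)) \<longlongrightarrow> Complex v (s * 0)) (at_right 0)"
      unfolding Complex_eq by (intro tendsto_intros)
    then have "((\<lambda>\<epsilon>. Ln (Complex v (s * \<epsilon>))) \<longlongrightarrow> Ln (Complex v (s * 0))) (at_right 0)"
      by (rule tendsto_Ln) (use that in \<open>auto simp: complex_nonpos_Reals_iff\<close>)
    moreover have "Complex v (s * 0) = complex_of_real v" by (simp add: complex_eq_iff)
    ultimately show ?thesis using that by (simp only: Ln_of_real)
  qed
  have "((\<lambda>\<epsilon>. Ln (Complex u \<epsilon>)) \<longlongrightarrow> complex_of_real (ln \<bar>u\<bar>) + (if u < 0 then \<i> * complex_of_real pi else 0)) (at_right 0) \<and>
    ((\<lambda>\<epsilon>. Ln (Complex u (- \<epsilon>))) \<longlongrightarrow> complex_of_real (ln \<bar>u\<bar>) - (if u < 0 then \<i> * complex_of_real pi else 0)) (at_right 0)"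
  proof (cases "u < 0")
    case False
    then show ?thesis using pos[of u 1] pos[of u "-1"] assms by simp
  next
    case True
    have ev: "\<forall>\<^sub>F \<epsilon> in at_right 0. Ln (Complex (- u) (- \<epsilon>)) + \<i> * pi = Ln (Complex u \<epsilon>) \<and> Ln (Complex (- u) \<epsilon>) - \<i> * pi = Ln (Complex u (- \<epsilon>))"
      using eventually_at_right_less[of "0::real"]
    proof eventually_elim
      case (elim \<epsilon>)
      have m: "Complex u \<epsilon> = - Complex (- u) (- \<epsilon>)" "Complex u (- \<epsilon>) = - Complex (- u) \<epsilon>" by (auto simp: complex_eq_iff)
      have n: "Complex (- u) (- \<epsilon>) \<noteq> 0" "Complex (- u) \<epsilon> \<noteq> 0" using True by (auto simp: complex_eq_iff)
      show ?case
        unfolding m Ln_minus[OF n(1)] Ln_minus[OF n(2)] using elim by simp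
    qed
    have "((\<lambda>\<epsilon>. Ln (Complex (- u) (- \<epsilon>)) + \<i> * pi) \<longlongrightarrow> complex_of_real (ln (- u)) + \<i> * pi) (at_right 0)"
      using pos[of "- u" "-1"] True by (intro tendsto_intros) simp
    moreover have "((\<lambda>\<epsilon>. Ln (Complex (- u) \<epsilon>) - \<i> * pi) \<longlongrightarrow> complex_of_real (ln (- u)) - \<i> * pi) (at_right 0)"
      using pos[of "- u" "1"] True by (intro tendsto_intros) simp
    ultimately have "((\<lambda>\<epsilon>. Ln (Complex u \<epsilon>)) \<longlongrightarrow> complex_of_real (ln (- u)) + \<i> * pi) (at_right 0)"
      "((\<lambda>\<epsilon>. Ln (Complex u (- \<epsilon>))) \<longlongrightarrow> complex_of_real (ln (- u)) - \<i> * pi) (at_right 0)"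
      by (auto intro: Lim_transform_eventually[OF _ eventually_mono[OF ev]])
    then show ?thesis using True by simp
  qed
  then show "((\<lambda>\<epsilon>. Ln (Complex u \<epsilon>)) \<longlongrightarrow> complex_of_real (ln \<bar>u\<bar>) + (if u < 0 then \<i> * complex_of_real pi else 0)) (at_right 0)"
    and "((\<lambda>\<epsilon>. Ln (Complex u (- \<epsilon>))) \<longlongrightarrow> complex_of_real (ln \<bar>u\<bar>) - (if u < 0 then \<i> * complex_of_real pi else 0)) (at_right 0)" by auto
qed

lemma AE_lebesgue_neq: "AE x in lebesgue. x \<noteq> (a :: real)"
  by (rule AE_completion) (rule AE_lborel_singleton)

lemma plemelj_interval:
  assumes ab: "a \<le> b"
  shows "plemelj (indicator {a..b})"
  unfolding plemelj_def
  using AE_lebesgue_neq[of a] AE_lebesgue_neq[of b]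
proof eventually_elim
  case (elim x)
  define P where "P u = complex_of_real (ln \<bar>u\<bar>)" for u
  define Q where "Q u = (if u < 0 then \<i> * complex_of_real pi else 0)" for u :: real
  have LP: "((\<lambda>\<epsilon>. Ln (Complex u \<epsilon>)) \<longlongrightarrow> P u + Q u) (at_right 0)"
    "((\<lambda>\<epsilon>. Ln (Complex u (- \<epsilon>))) \<longlongrightarrow> P u - Q u) (at_right 0)" if "u \<noteq> 0" for u
    using tendsto_Ln_vertical[OF that] by (simp_all only: P_def Q_def)
  \<comment> \<open>Approaching \<open>x\<close> from above means approaching \<open>c - x\<close>
    from below; hence the signs of \<open>Q\<close> in the limits.\<close>
  have c: "complex_of_real c - Complex x \<epsilon> = Complex (c - x) (- \<epsilon>)" for c \<epsilon> by (simp add: complex_eq_iff)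
  have "((\<lambda>\<epsilon>. Ln (Complex (b - x) (- \<epsilon>)) - Ln (Complex (a - x) (- \<epsilon>))) \<longlongrightarrow> (P (b - x) - Q (b - x)) - (P (a - x) - Q (a - x))) (at_right 0)"
    by (intro tendsto_diff LP) (use elim in auto)
  then have 1: "((\<lambda>\<epsilon>. cauchy_transform (indicator {a..b}) (Complex x \<epsilon>)) \<longlongrightarrow> (P (b - x) - Q (b - x)) - (P (a - x) - Q (a - x))) (at_right 0)"
  proof (rule Lim_transform_eventually)
    show "\<forall>\<^sub>F \<epsilon> in at_right 0. Ln (Complex (b - x) (- \<epsilon>)) - Ln (Complex (a - x) (- \<epsilon>)) = cauchy_transform (indicator {a..b}) (Complex x \<epsilon>)"
      using eventually_Im_nonzero[of x] by eventually_elim (simp add: cauchy_transform_indicator_interval[OF ab] c)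
  qed
  have "((\<lambda>\<epsilon>. Ln (Complex (b - x) \<epsilon>) - Ln (Complex (a - x) \<epsilon>)) \<longlongrightarrow> (P (b - x) + Q (b - x)) - (P (a - x) + Q (a - x))) (at_right 0)"
    by (intro tendsto_diff LP) (use elim in auto)
  then have 2: "((\<lambda>\<epsilon>. cauchy_transform (indicator {a..b}) (Complex x (- \<epsilon>))) \<longlongrightarrow> (P (b - x) + Q (b - x)) - (P (a - x) + Q (a - x))) (at_right 0)"
  proof (rule Lim_transform_eventually)
    show "\<forall>\<^sub>F \<epsilon> in at_right 0. Ln (Complex (b - x) \<epsilon>) - Ln (Complex (a - x) \<epsilon>) = cauchy_transform (indicator {a..b}) (Complex x (- \<epsilon>))"
      using eventually_Im_nonzero[of x] by eventually_elim (simp add: cauchy_transform_indicator_interval[OF ab] c)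
  qed
  \<comment> \<open>The logarithms cancel and \<open>2 * (Q (a - x) - Q (b - x))\<close> remains,
    nonzero precisely for \<open>x\<close> between the endpoints.\<close>
  have "((P (b - x) - Q (b - x)) - (P (a - x) - Q (a - x))) - ((P (b - x) + Q (b - x)) - (P (a - x) + Q (a - x)))
      = 2 * pi * \<i> * indicator {a..b} x"
    using elim ab by (auto simp: Q_def indicator_def)
  then show ?case using 1 2 unfolding boundary_values_def by blast
qed

text \<open>A Dynkin argument from the half-lines, which generate the Borel sets and are stable
  under intersection. Cutting with \<open>[-n, n]\<close> keeps all indicators in L^2.\<close>

lemma plemelj_indicator_borel:
  assumes "A \<in> sets borel"
  shows "plemelj (indicator (A \<inter> {- real n..real n}))"
proof -
  have A: "A \<in> sigma_sets UNIV (range (\<lambda>a::real. {..a}))"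
    using assms by (simp add: borel_eq_atMost)
  have sub: "B \<in> sets lebesgue" if "B \<in> sigma_sets UNIV (range (\<lambda>a::real. {..a}))" for B
    using that by (auto simp: borel_eq_atMost intro!: sets_completionI_sets)
  have L2: "indicator (B \<inter> {- real n..real n}) \<in> Lp 2" if "B \<in> sigma_sets UNIV (range (\<lambda>a::real. {..a}))" for B
    using sub[OF that] by (intro indicator_Lp2[of _ "- real n" "real n"]) auto
  have stable: "Int_stable (range (\<lambda>a::real. {..a}))"
    by (auto simp: Int_stable_def intro!: image_eqI[where x = "min _ _"])
  show ?thesis using stable subset_UNIV[of "range (\<lambda>a::real. {..a})", folded Pow_UNIV] A
  proof (induction A rule: sigma_sets_induct_disjoint)
    case (basic A)
    then obtain a where a: "A = {..a}" by auto
    show ?case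
    proof (cases "- real n \<le> min a (real n)")
      case True
      have "A \<inter> {- real n..real n} = {- real n..min a (real n)}" using a by auto
      then show ?thesis using plemelj_interval[OF True] by simp
    next
      case False
      then have "A \<inter> {- real n..real n} = {}" using a by auto
      then show ?thesis using plemelj_zero by simp
    qed
  next
    case empty
    show ?case using plemelj_zero by simp
  next
    case (compl A)
    have "indicator ((UNIV - A) \<inter> {- real n..real n}) x = 1 * indicator {- real n..real n} x + (- 1) * (indicator (A \<inter> {- real n..real n}) x :: complex)" for x
      by (auto simp: indicator_def)
    then have "indicator ((UNIV - A) \<inter> {- real n..real n}) = (\<lambda>x. 1 * indicator {- real n..real n} x + (- 1) * (indicator (A \<inter> {- real n..real n}) x :: complex))"
      by (rule ext)
    moreover have "plemelj (\<lambda>x. 1 * indicator {- real n..real n} x + (- 1) * (indicator (A \<inter> {- real n..real n}) x :: complex))"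
      by (intro plemelj_linear plemelj_interval L2[OF compl(1)] compl(2) indicator_Lp2[of _ "- real n" "real n"]) auto
    ultimately show ?case by simp
  next
    case (union A)
    \<comment> \<open>By disjointness the partial sums are again indicators, so the indicator of
      \<open>[-n, n]\<close> dominates them.\<close>
    define u where "u m x = (\<Sum>i<m. indicator (A i \<inter> {- real n..real n}) x :: complex)" for m x
    have u_eq: "u m x = indicator ((\<Union>i<m. A i) \<inter> {- real n..real n}) x" for m x
    proof (induction m)
      case (Suc m)
      have "A m \<inter> (\<Union>i<m. A i) = {}"
      proof (rule equals0I)
        fix y assume "y \<in> A m \<inter> (\<Union>i<m. A i)"
        then obtain i where i: "i < m" "y \<in> A i" "y \<in> A m" by blast
        then have "A m \<inter> A i = {}" by (intro disjoint_family_onD[OF union(1)]) auto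
        then show False using i by blast
      qed
      moreover have "u (Suc m) x = u m x + indicator (A m \<inter> {- real n..real n}) x"
        by (simp add: u_def)
      ultimately show ?case unfolding Suc by (auto simp: lessThan_Suc indicator_def)
    qed (simp add: u_def)
    show ?case
    proof (rule plemelj_dominated_limit[where u = u and w = "indicator {- real n..real n}"])
      show "u m \<in> Lp 2" for m
        unfolding u_def using union(2) by (intro Lp2_sum L2) auto
      show "plemelj (u m)" for m
        unfolding u_def using union(2,3) by (intro plemelj_sum L2) auto
      show "indicator {- real n..real n} \<in> Lp 2"
        by (rule indicator_Lp2[of _ "- real n" "real n"]) auto
      show "norm (u m x) \<le> norm (indicator {- real n..real n} x :: complex)" for m x
        unfolding u_eq by (auto simp: indicator_def)
      show "(\<lambda>m. u m x) \<longlonglongrightarrow> indicator ((\<Union>i. A i) \<inter> {- real n..real n}) x" for x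
      proof (rule tendsto_eventually)
        show "\<forall>\<^sub>F m in sequentially. u m x = indicator ((\<Union>i. A i) \<inter> {- real n..real n}) x"
        proof (cases "x \<in> (\<Union>i. A i)")
          case True
          then obtain i where "x \<in> A i" by auto
          then show ?thesis
            by (intro eventually_sequentiallyI[of "Suc i"]) (auto simp: u_eq indicator_def)
        qed (auto simp: u_eq indicator_def)
      qed
      have "(\<Union>i. A i) \<in> sets lebesgue" using union(2) sub by auto
      then show "indicator ((\<Union>i. A i) \<inter> {- real n..real n}) \<in> borel_measurable lebesgue" by auto
    qed
  qed
qed

text \<open>A Lebesgue set differs from a Borel set by a null set, which the jump relation does not
  see.\<close>

lemma plemelj_indicator_lebesgue:
  assumes A: "A \<in> sets lebesgue"
  shows "plemelj (indicator (A \<inter> {- real n..real n}))"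
proof -
  from A obtain S N N' where S: "A = S \<union> N" "N \<subseteq> N'" "N' \<in> null_sets lborel" "S \<in> sets lborel"
    by (rule sets_completionE)
  have "AE x in lebesgue. x \<notin> N'" by (intro AE_completion AE_not_in S(3))
  then have AE: "AE x in lebesgue. indicator (A \<inter> {- real n..real n}) x = (indicator (S \<inter> {- real n..real n}) x :: complex)"
    by eventually_elim (use S in \<open>auto simp: indicator_def\<close>)
  have "S \<in> sets lebesgue" using S(4) by (rule sets_completionI_sets)
  then show ?thesis
    using A plemelj_cong_AE[OF plemelj_indicator_borel _ _ AE] S(4) by auto
qed

text \<open>Approximation by simple functions cut off to \<open>[-i, i]\<close>; they are dominated
  by \<open>2 |f|\<close>.\<close>

theorem plemelj_Lp2:
  assumes f: "f \<in> Lp 2"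
  shows "plemelj f"
proof -
  from borel_measurable_implies_sequence_metric[OF Lp2_measurable[OF f], of 0] obtain s where
    s': "\<forall>i. simple_function lebesgue (s i)" "\<forall>x\<in>space lebesgue. (\<lambda>i. s i x) \<longlonglongrightarrow> f x"
      "\<forall>i. \<forall>x\<in>space lebesgue. dist (s i x) 0 \<le> 2 * dist (f x) 0" by blast
  then have s: "\<And>i. simple_function lebesgue (s i)" "\<And>x. (\<lambda>i. s i x) \<longlonglongrightarrow> f x"
      "\<And>i x. norm (s i x) \<le> 2 * norm (f x)"
    by simp_all
  define I where "I i = {- real i..real i}" for i :: nat
  define u where "u i x = indicator (I i) x * s i x" for i x
  have u_eq: "u i x = (\<Sum>y\<in>range (s i). y * indicator (s i -` {y} \<inter> I i) x)" for i x
  proof -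
    have fin: "finite (range (s i))" using simple_functionD(1)[OF s(1)[of i]] by simp
    have "(\<Sum>y\<in>range (s i). y * indicator (s i -` {y} \<inter> I i) x) = (\<Sum>y\<in>range (s i). if y = s i x then y * indicator (I i) x else 0)"
      by (rule sum.cong[OF refl]) (simp add: indicator_def)
    also have "\<dots> = s i x * indicator (I i) x"
      using fin by (subst sum.delta) auto
    finally show ?thesis unfolding u_def by (simp only: mult.commute)
  qed
  have sets: "s i -` {y} \<in> sets lebesgue" for i y
    using simple_functionD(2)[OF s(1)[of i], of "{y}"] by simp
  have L2: "indicator (s i -` {y} \<inter> I i) \<in> Lp 2" for i y
    unfolding I_def using sets by (intro indicator_Lp2[of _ "- real i" "real i"]) auto
  show ?thesis
  proof (rule plemelj_dominated_limit[where u = u and w = "\<lambda>x. 2 * f x"])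
    show "u i \<in> Lp 2" for i unfolding u_eq by (intro Lp2_sum Lp2_cmult L2)
    show "plemelj (u i)" for i
      unfolding u_eq
    proof (rule plemelj_sum)
      show "finite (range (s i))" using simple_functionD(1)[OF s(1)[of i]] by simp
      show "plemelj (\<lambda>x. y * indicator (s i -` {y} \<inter> I i) x)" for y
        using plemelj_linear[OF L2 _ Lp2_zero plemelj_zero, of i y y 0] plemelj_indicator_lebesgue[OF sets[of i y], of i]
        unfolding I_def by simp
    qed (intro Lp2_cmult L2)
    show "(\<lambda>x. 2 * f x) \<in> Lp 2" by (rule Lp2_cmult[OF f])
    show "norm (u i x) \<le> norm (2 * f x)" for i x
      using s(3)[of i x] by (auto simp: u_def indicator_def norm_mult)
    show "(\<lambda>i. u i x) \<longlonglongrightarrow> f x" for x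
    proof (rule Lim_transform_eventually[OF s(2)])
      obtain n0 :: nat where "\<bar>x\<bar> \<le> real n0" using real_arch_simple by blast
      then show "\<forall>\<^sub>F i in sequentially. s i x = u i x"
        by (intro eventually_sequentiallyI[of n0]) (auto simp: u_def I_def indicator_def abs_le_iff)
    qed
  qed (use f in \<open>simp add: Lp2_measurable\<close>)
qed

section \<open>Functions represented by their boundary values\<close>

text \<open>For \<open>d = norm (u n - v)\<close>, dominated convergence applies to the first term of
  \<open>d * w \<le> min (d * w) (K * w\<^sup>2) + d\<^sup>2 / K\<close>, and the second is small for large \<open>K\<close>.\<close>

lemma Lp2_weak_convergence:
  assumes u: "\<And>n. u n \<in> Lp 2" "\<And>n. sqnorm (u n) \<le> B" and w: "w \<in> Lp 2"
    and lim: "AE x in lebesgue. (\<lambda>n. u n x) \<longlonglongrightarrow> v x" and v: "v \<in> borel_measurable lebesgue"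
  shows "(\<lambda>n. LINT x|lebesgue. u n x * w x) \<longlonglongrightarrow> (LINT x|lebesgue. v x * w x)"
proof -
  note V = Lp2_Fatou[OF u(1) lim v u(2)]
  have [measurable]: "u n \<in> borel_measurable lebesgue" "v \<in> borel_measurable lebesgue" "w \<in> borel_measurable lebesgue" for n
    using u(1) v w by (auto simp: Lp2_measurable)
  define d where "d n x = u n x - v x" for n x
  have dL: "d n \<in> Lp 2" for n unfolding d_def by (rule Lp2_diff[OF u(1) V(1)])
  have B0: "0 \<le> B" using u(2)[of 0] sqnorm_nonneg[of "u 0"] by linarith
  have dB: "sqnorm (d n) \<le> 4 * B" for n
    using Lp2_norm_sum_bound(2)[OF Lp2_measurable[OF dL] u(1) V(1), of n n] norm_triangle_ineq4 u(2)[of n] V(2)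
    by (force simp: d_def)
  have "(\<lambda>n. (LINT x|lebesgue. u n x * w x) - (LINT x|lebesgue. v x * w x)) \<longlonglongrightarrow> 0"
  proof (rule tendstoI)
    fix e :: real assume e: "0 < e"
    \<comment> \<open>Makes the second term at most \<open>4 * B / K \<le> e / 2\<close>; the
      summand 1 keeps \<open>K\<close> positive when \<open>B = 0\<close>.\<close>
    define K where "K = 8 * B / e + 1"
    have K: "0 < K" using B0 e by (simp add: K_def add_nonneg_pos)
    have BK: "4 * B / K \<le> e / 2"
      using K e B0 by (simp add: field_simps K_def)
    define m where "m n x = min (norm (d n x) * norm (w x)) (K * (norm (w x))\<^sup>2)" for n x
    have "(\<lambda>n. LINT x|lebesgue. m n x) \<longlonglongrightarrow> (LINT x::real|lebesgue. 0)"
    proof (rule integral_dominated_convergence[where w = "\<lambda>x. K * (norm (w x))\<^sup>2"])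
      show "integrable lebesgue (\<lambda>x. K * (norm (w x))\<^sup>2)" using Lp2_integrable[OF w] by auto
      show "AE x in lebesgue. (\<lambda>n. m n x) \<longlonglongrightarrow> 0"
        using lim
      proof eventually_elim
        case (elim x)
        have "(\<lambda>n. min (norm (u n x - v x) * norm (w x)) (K * (norm (w x))\<^sup>2)) \<longlonglongrightarrow>
          min (norm (v x - v x) * norm (w x)) (K * (norm (w x))\<^sup>2)"
          by (intro tendsto_intros elim)
        then show ?case using K by (simp add: m_def d_def min_def)
      qed
      show "AE x in lebesgue. norm (m n x) \<le> K * (norm (w x))\<^sup>2" for n
        using K by (simp add: m_def)
    qed (unfold m_def d_def, measurable)
    then have "\<forall>\<^sub>F n in sequentially. (LINT x|lebesgue. m n x) < e / 2"
      by (rule order_tendstoD) (use e in simp)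
    then show "\<forall>\<^sub>F n in sequentially. dist ((LINT x|lebesgue. u n x * w x) - (LINT x|lebesgue. v x * w x)) 0 < e"
    proof eventually_elim
      case (elim n)
      have mi: "integrable lebesgue (m n)"
      proof (rule Bochner_Integration.integrable_bound)
        show "integrable lebesgue (\<lambda>x. K * (norm (w x))\<^sup>2)" using Lp2_integrable[OF w] by auto
        show "m n \<in> borel_measurable lebesgue" unfolding m_def d_def by measurable
        show "AE x in lebesgue. norm (m n x) \<le> norm (K * (norm (w x))\<^sup>2)"
          using K by (simp add: m_def)
      qed
      have "(LINT x|lebesgue. u n x * w x) - (LINT x|lebesgue. v x * w x) = (LINT x|lebesgue. d n x * w x)"
        using Lp2_mult_integrable[OF u(1) w] Lp2_mult_integrable[OF V(1) w] by (simp add: d_def left_diff_distrib)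
      then have "norm ((LINT x|lebesgue. u n x * w x) - (LINT x|lebesgue. v x * w x)) \<le> (LINT x|lebesgue. norm (d n x) * norm (w x))"
        using integral_norm_bound[of lebesgue "\<lambda>x. d n x * w x"] by (simp add: norm_mult)
      also have "\<dots> \<le> (LINT x|lebesgue. m n x + (1 / K) * (norm (d n x))\<^sup>2)"
      proof (rule Bochner_Integration.integral_mono)
        show "integrable lebesgue (\<lambda>x. norm (d n x) * norm (w x))" by (rule Lp2_norm_mult_integrable[OF dL w])
        show "integrable lebesgue (\<lambda>x. m n x + (1 / K) * (norm (d n x))\<^sup>2)"
          using mi Lp2_integrable[OF dL] by auto
        show "norm (d n x) * norm (w x) \<le> m n x + (1 / K) * (norm (d n x))\<^sup>2" for x
        proof (cases "norm (d n x) \<le> K * norm (w x)")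
          case True
          then have "norm (d n x) * norm (w x) \<le> K * norm (w x) * norm (w x)" by (rule mult_right_mono) simp
          then have "m n x = norm (d n x) * norm (w x)" by (simp add: m_def power2_eq_square mult.assoc)
          then show ?thesis using K by simp
        next
          case False
          then have "norm (d n x) * (K * norm (w x)) \<le> norm (d n x) * norm (d n x)" by (intro mult_left_mono) auto
          then have "norm (d n x) * norm (w x) \<le> (1 / K) * (norm (d n x))\<^sup>2"
            using K by (simp add: field_simps power2_eq_square)
          moreover have "0 \<le> m n x" using K by (simp add: m_def)
          ultimately show ?thesis by simp
        qed
      qed
      also have "\<dots> = (LINT x|lebesgue. m n x) + (1 / K) * sqnorm (d n)"
        using mi Lp2_integrable[OF dL] by (simp add: sqnorm_def)
      also have "(1 / K) * sqnorm (d n) \<le> (1 / K) * (4 * B)" using dB K by (intro mult_left_mono) auto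
      also have "(1 / K) * (4 * B) \<le> e / 2" using BK by simp
      finally show ?case using elim by (simp add: dist_norm)
    qed
  qed
  then show ?thesis by (simp add: Lim_null[symmetric])
qed

text \<open>A limit along a sequence is measurable without further argument, and it agrees with the
  full vertical limit wherever the latter exists.\<close>

definition upper_bv :: "(complex \<Rightarrow> complex) \<Rightarrow> real \<Rightarrow> complex" where
  "upper_bv F x = lim (\<lambda>n. F (Complex x (inverse (real (Suc n)))))"

definition lower_bv :: "(complex \<Rightarrow> complex) \<Rightarrow> real \<Rightarrow> complex" where
  "lower_bv F x = lim (\<lambda>n. F (Complex x (- inverse (real (Suc n)))))"

lemma filterlim_inverse_Suc_at_right: "filterlim (\<lambda>n. inverse (real (Suc n))) (at_right 0) sequentially"
  unfolding filterlim_at using LIMSEQ_inverse_real_of_nat by (auto intro!: always_eventually)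

lemma boundary_values_sequences:
  assumes "boundary_values F x L L'"
  shows "(\<lambda>n. F (Complex x (inverse (real (Suc n))))) \<longlonglongrightarrow> L" "(\<lambda>n. F (Complex x (- inverse (real (Suc n))))) \<longlonglongrightarrow> L'"
  using assms filterlim_compose[OF _ filterlim_inverse_Suc_at_right]
  unfolding boundary_values_def by blast+

lemma boundary_values_bv:
  assumes "boundary_values F x L L'"
  shows "upper_bv F x = L" "lower_bv F x = L'"
  unfolding upper_bv_def lower_bv_def using boundary_values_sequences[OF assms] by (auto intro: limI)

text \<open>A pair of H^2 functions, one in each half-plane. The growth bound feeds the contour
  estimates; boundary values are part of the class, so that no general theorem on the boundary
  behaviour of analytic functions is called upon.\<close>

definition hardy_class :: "(complex \<Rightarrow> complex) \<Rightarrow> bool" where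
  "hardy_class F \<longleftrightarrow> F holomorphic_on {z. Im z \<noteq> 0} \<and>
     (\<exists>K. \<forall>z. Im z \<noteq> 0 \<longrightarrow> norm (F z) \<le> K / sqrt \<bar>Im z\<bar>) \<and>
     (\<exists>B. \<forall>\<epsilon>. \<epsilon> \<noteq> 0 \<longrightarrow> (\<lambda>x. F (Complex x \<epsilon>)) \<in> Lp 2 \<and> sqnorm (\<lambda>x. F (Complex x \<epsilon>)) \<le> B) \<and>
     (AE x in lebesgue. \<exists>L L'. boundary_values F x L L')"

definition bounded_class :: "(complex \<Rightarrow> complex) \<Rightarrow> bool" where
  "bounded_class G \<longleftrightarrow> G holomorphic_on {z. Im z \<noteq> 0} \<and> (\<exists>M. \<forall>z. Im z \<noteq> 0 \<longrightarrow> norm (G z) \<le> M) \<and>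
     (AE x in lebesgue. \<exists>L L'. boundary_values G x L L')"

section \<open>Sums and products in the Hardy and bounded classes\<close>

lemma boundary_values_power:
  "boundary_values F x L L' \<Longrightarrow> boundary_values (\<lambda>z. F z ^ n) x (L ^ n) (L' ^ n)"
  unfolding boundary_values_def by (auto intro!: tendsto_power)

lemma boundary_values_unique:
  assumes "boundary_values F x L L'" "boundary_values F x M M'"
  shows "L = M" "L' = M'"
  using boundary_values_bv[OF assms(1)] boundary_values_bv[OF assms(2)] by auto

lemma line_measurable:
  assumes "F holomorphic_on {z. Im z \<noteq> 0}" "\<epsilon> \<noteq> 0"
  shows "(\<lambda>x. F (Complex x \<epsilon>)) \<in> borel_measurable lebesgue"
proof (rule borel_measurable_lebesgue_continuous)
  have "continuous_on {z. Im z \<noteq> 0} F" by (rule holomorphic_on_imp_continuous_on[OF assms(1)])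
  then show "continuous_on UNIV (\<lambda>x. F (Complex x \<epsilon>))"
    by (rule continuous_on_compose2) (use assms in \<open>auto intro!: continuous_intros simp: Complex_eq\<close>)
qed

lemma hardy_class_cauchy_transform:
  assumes f: "f \<in> Lp 2"
  shows "hardy_class (cauchy_transform f)"
  unfolding hardy_class_def
proof (intro conjI)
  show "cauchy_transform f holomorphic_on {z. Im z \<noteq> 0}"
    by (rule holomorphic_cauchy_transform[OF f]) simp
  show "\<exists>K. \<forall>z. Im z \<noteq> 0 \<longrightarrow> norm (cauchy_transform f z) \<le> K / sqrt \<bar>Im z\<bar>"
    using norm_cauchy_transform_le[OF f]
    by (intro exI[of _ "sqrt (sqnorm f) * sqrt inv_sq_integral"]) (simp add: real_sqrt_divide)
  have cnj_line: "cauchy_transform f (Complex x (- \<epsilon>)) = cnj (cauchy_transform (\<lambda>x. cnj (f x)) (Complex x \<epsilon>))" for x \<epsilon>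
  proof -
    have "cnj (Complex x \<epsilon>) = Complex x (- \<epsilon>)" by (simp add: complex_eq_iff)
    then show ?thesis by (simp add: cauchy_transform_cnj)
  qed
  show "\<exists>B. \<forall>\<epsilon>. \<epsilon> \<noteq> 0 \<longrightarrow> (\<lambda>x. cauchy_transform f (Complex x \<epsilon>)) \<in> Lp 2 \<and> sqnorm (\<lambda>x. cauchy_transform f (Complex x \<epsilon>)) \<le> B"
  proof (intro exI allI impI)
    fix \<epsilon> :: real assume "\<epsilon> \<noteq> 0"
    then consider "0 < \<epsilon>" | "0 < - \<epsilon>" by linarith
    then show "(\<lambda>x. cauchy_transform f (Complex x \<epsilon>)) \<in> Lp 2 \<and> sqnorm (\<lambda>x. cauchy_transform f (Complex x \<epsilon>)) \<le> (2 * pi)\<^sup>2 * sqnorm f"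
    proof cases
      case 1
      then show ?thesis using Lp2_cauchy_transform_line[OF f] by blast
    next
      case 2
      have eq: "(\<lambda>x. cauchy_transform f (Complex x \<epsilon>)) = (\<lambda>x. cnj (cauchy_transform (\<lambda>x. cnj (f x)) (Complex x (- \<epsilon>))))"
        using cnj_line[of _ "- \<epsilon>"] by simp
      show ?thesis
        unfolding eq sqnorm_cnj
        using Lp2_cauchy_transform_line[OF Lp2_cnj[OF f] 2] Lp2_cnj by (auto simp: sqnorm_cnj)
    qed
  qed
  show "AE x in lebesgue. \<exists>L L'. boundary_values (cauchy_transform f) x L L'"
    using plemelj_Lp2[OF f] unfolding plemelj_def by eventually_elim blast
qed

lemma hardy_class_mult_bounded:
  assumes F: "hardy_class F" and G: "bounded_class G"
  shows "hardy_class (\<lambda>z. F z * G z)"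
proof -
  from F obtain K B where F': "F holomorphic_on {z. Im z \<noteq> 0}" "\<And>z. Im z \<noteq> 0 \<Longrightarrow> norm (F z) \<le> K / sqrt \<bar>Im z\<bar>"
    "\<And>\<epsilon>. \<epsilon> \<noteq> 0 \<Longrightarrow> (\<lambda>x. F (Complex x \<epsilon>)) \<in> Lp 2" "\<And>\<epsilon>. \<epsilon> \<noteq> 0 \<Longrightarrow> sqnorm (\<lambda>x. F (Complex x \<epsilon>)) \<le> B"
    "AE x in lebesgue. \<exists>L L'. boundary_values F x L L'"
    unfolding hardy_class_def by blast
  from G obtain M where G': "G holomorphic_on {z. Im z \<noteq> 0}" "\<And>z. Im z \<noteq> 0 \<Longrightarrow> norm (G z) \<le> M"
    "AE x in lebesgue. \<exists>L L'. boundary_values G x L L'"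
    unfolding bounded_class_def by blast
  have M0: "0 \<le> M" using order_trans[OF norm_ge_zero G'(2)[of \<i>]] by simp
  have hol: "(\<lambda>z. F z * G z) holomorphic_on {z. Im z \<noteq> 0}" by (intro holomorphic_intros F' G')
  show ?thesis
    unfolding hardy_class_def
  proof (intro conjI exI allI impI)
    show "(\<lambda>z. F z * G z) holomorphic_on {z. Im z \<noteq> 0}" by (rule hol)
    show "norm (F z * G z) \<le> (K * M) / sqrt \<bar>Im z\<bar>" if "Im z \<noteq> 0" for z
      using mult_mono[OF F'(2)[OF that] G'(2)[OF that]] order_trans[OF norm_ge_zero F'(2)[OF that]] by (simp add: norm_mult)
    fix \<epsilon> :: real assume e: "\<epsilon> \<noteq> 0"
    have b: "AE x in lebesgue. norm (F (Complex x \<epsilon>) * G (Complex x \<epsilon>)) \<le> M * norm (F (Complex x \<epsilon>))"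
    proof (rule AE_I2)
      fix x
      have "norm (G (Complex x \<epsilon>)) \<le> M" by (rule G'(2)) (use e in simp)
      from mult_right_mono[OF this norm_ge_zero[of "F (Complex x \<epsilon>)"]]
      show "norm (F (Complex x \<epsilon>) * G (Complex x \<epsilon>)) \<le> M * norm (F (Complex x \<epsilon>))"
        by (simp add: norm_mult mult.commute)
    qed
    show L: "(\<lambda>x. F (Complex x \<epsilon>) * G (Complex x \<epsilon>)) \<in> Lp 2"
      by (rule Lp2_bound[OF line_measurable[OF hol e] F'(3)[OF e] b])
    have "sqnorm (\<lambda>x. F (Complex x \<epsilon>) * G (Complex x \<epsilon>)) \<le> sqnorm (\<lambda>x. complex_of_real M * F (Complex x \<epsilon>))"
      by (rule sqnorm_mono[OF Lp2_measurable[OF L] Lp2_cmult[OF F'(3)[OF e]]])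
         (use b M0 in \<open>simp add: norm_mult\<close>)
    also have "\<dots> \<le> M\<^sup>2 * B"
      unfolding sqnorm_cmult using F'(4)[OF e] by (simp add: mult_left_mono)
    finally show "sqnorm (\<lambda>x. F (Complex x \<epsilon>) * G (Complex x \<epsilon>)) \<le> M\<^sup>2 * B" .
  next
    show "AE x in lebesgue. \<exists>L L'. boundary_values (\<lambda>z. F z * G z) x L L'"
      using F'(5) G'(3) by eventually_elim (blast intro: boundary_values_mult)
  qed
qed

lemma hardy_class_add:
  assumes F: "hardy_class F" and G: "hardy_class G"
  shows "hardy_class (\<lambda>z. F z + G z)"
proof -
  from F obtain K B where F': "F holomorphic_on {z. Im z \<noteq> 0}" "\<And>z. Im z \<noteq> 0 \<Longrightarrow> norm (F z) \<le> K / sqrt \<bar>Im z\<bar>"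
    "\<And>\<epsilon>. \<epsilon> \<noteq> 0 \<Longrightarrow> (\<lambda>x. F (Complex x \<epsilon>)) \<in> Lp 2" "\<And>\<epsilon>. \<epsilon> \<noteq> 0 \<Longrightarrow> sqnorm (\<lambda>x. F (Complex x \<epsilon>)) \<le> B"
    "AE x in lebesgue. \<exists>L L'. boundary_values F x L L'"
    unfolding hardy_class_def by blast
  from G obtain K' B' where G': "G holomorphic_on {z. Im z \<noteq> 0}" "\<And>z. Im z \<noteq> 0 \<Longrightarrow> norm (G z) \<le> K' / sqrt \<bar>Im z\<bar>"
    "\<And>\<epsilon>. \<epsilon> \<noteq> 0 \<Longrightarrow> (\<lambda>x. G (Complex x \<epsilon>)) \<in> Lp 2" "\<And>\<epsilon>. \<epsilon> \<noteq> 0 \<Longrightarrow> sqnorm (\<lambda>x. G (Complex x \<epsilon>)) \<le> B'"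
    "AE x in lebesgue. \<exists>L L'. boundary_values G x L L'"
    unfolding hardy_class_def by blast
  show ?thesis
    unfolding hardy_class_def
  proof (intro conjI exI allI impI)
    show "(\<lambda>z. F z + G z) holomorphic_on {z. Im z \<noteq> 0}" by (intro holomorphic_intros F' G')
    show "norm (F z + G z) \<le> (K + K') / sqrt \<bar>Im z\<bar>" if "Im z \<noteq> 0" for z
      using norm_triangle_mono[OF F'(2)[OF that] G'(2)[OF that]] by (simp add: add_divide_distrib)
    fix \<epsilon> :: real assume e: "\<epsilon> \<noteq> 0"
    note FL = F'(3)[OF e] and GL = G'(3)[OF e]
    show L: "(\<lambda>x. F (Complex x \<epsilon>) + G (Complex x \<epsilon>)) \<in> Lp 2" by (rule Lp2_add[OF FL GL])
    have "sqnorm (\<lambda>x. F (Complex x \<epsilon>) + G (Complex x \<epsilon>)) \<le> 2 * sqnorm (\<lambda>x. F (Complex x \<epsilon>)) + 2 * sqnorm (\<lambda>x. G (Complex x \<epsilon>))"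
      by (rule Lp2_norm_sum_bound(2)[OF Lp2_measurable[OF L] FL GL]) (simp add: norm_triangle_ineq)
    then show "sqnorm (\<lambda>x. F (Complex x \<epsilon>) + G (Complex x \<epsilon>)) \<le> 2 * B + 2 * B'"
      using F'(4)[OF e] G'(4)[OF e] by simp
  next
    show "AE x in lebesgue. \<exists>L L'. boundary_values (\<lambda>z. F z + G z) x L L'"
      using F'(5) G'(5) by eventually_elim (blast intro: boundary_values_add)
  qed
qed

lemma bounded_class_power:
  assumes "bounded_class G"
  shows "bounded_class (\<lambda>z. G z ^ n)"
proof -
  from assms obtain M where G': "G holomorphic_on {z. Im z \<noteq> 0}" "\<And>z. Im z \<noteq> 0 \<Longrightarrow> norm (G z) \<le> M"
    "AE x in lebesgue. \<exists>L L'. boundary_values G x L L'"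
    unfolding bounded_class_def by blast
  show ?thesis
    unfolding bounded_class_def
  proof (intro conjI exI allI impI)
    show "(\<lambda>z. G z ^ n) holomorphic_on {z. Im z \<noteq> 0}" by (intro holomorphic_intros G')
    show "norm (G z ^ n) \<le> M ^ n" if "Im z \<noteq> 0" for z
      unfolding norm_power by (intro power_mono G'(2) that) simp
    show "AE x in lebesgue. \<exists>L L'. boundary_values (\<lambda>z. G z ^ n) x L L'"
      using G'(3) by eventually_elim (blast intro: boundary_values_power)
  qed
qed

text \<open>The height tends to 0 in the half-plane Cauchy formula. Convergence of the lines to
  \<open>v\<close> is only weak, but the Cauchy kernel at \<open>\<mu>\<close> is itself an L^2
  function, so this is enough.\<close>

lemma upper_half_plane_representation:
  assumes hol: "F holomorphic_on {z. 0 < Im z}"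
    and bnd: "\<And>z. 0 < Im z \<Longrightarrow> norm (F z) \<le> K / sqrt (Im z)"
    and L2: "\<And>\<epsilon>. 0 < \<epsilon> \<Longrightarrow> (\<lambda>x. F (Complex x \<epsilon>)) \<in> Lp 2" "\<And>\<epsilon>. 0 < \<epsilon> \<Longrightarrow> sqnorm (\<lambda>x. F (Complex x \<epsilon>)) \<le> B"
    and lim: "AE x in lebesgue. (\<lambda>n. F (Complex x (inverse (real (Suc n))))) \<longlonglongrightarrow> v x"
    and v: "v \<in> borel_measurable lebesgue"
  shows "v \<in> Lp 2" and "0 < Im \<mu> \<Longrightarrow> cauchy_transform v \<mu> = 2 * pi * \<i> * F \<mu>"
    and "Im \<mu> < 0 \<Longrightarrow> cauchy_transform v \<mu> = 0"
proof -
  define e where "e n = inverse (real (Suc n))" for n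
  have e: "0 < e n" for n by (simp add: e_def)
  have e0: "e \<longlonglongrightarrow> 0" unfolding e_def by (rule LIMSEQ_inverse_real_of_nat)
  show "v \<in> Lp 2" by (rule Lp2_Fatou(1)[OF L2(1)[OF e] lim[folded e_def] v L2(2)[OF e]])
  have conv: "(\<lambda>n. cauchy_transform (\<lambda>x. F (Complex x (e n))) \<mu>) \<longlonglongrightarrow> cauchy_transform v \<mu>" if "Im \<mu> \<noteq> 0"
    using Lp2_weak_convergence[OF L2(1)[OF e] L2(2)[OF e] kernel_Lp2[OF that] lim[folded e_def] v]
    by (simp add: cauchy_transform_def)
  show "cauchy_transform v \<mu> = 2 * pi * \<i> * F \<mu>" if mu: "0 < Im \<mu>"
  proof (rule LIMSEQ_unique[OF conv])
    have "cauchy_transform (\<lambda>x. F (Complex x (e n))) \<mu> = 2 * pi * \<i> * F (\<mu> + \<i> * e n)" for n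
      by (rule half_plane_Cauchy_formula(1)[OF hol bnd e L2(1)[OF e] mu])
    moreover have "(\<lambda>n. F (\<mu> + \<i> * e n)) \<longlonglongrightarrow> F \<mu>"
    proof -
      have "continuous_on {z. 0 < Im z} F" by (rule holomorphic_on_imp_continuous_on[OF hol])
      then have "isCont F \<mu>"
        using mu by (subst (asm) continuous_on_eq_continuous_at) (auto simp: open_halfspace_Im_gt)
      moreover have "(\<lambda>n. \<mu> + \<i> * e n) \<longlonglongrightarrow> \<mu> + \<i> * complex_of_real 0" by (intro tendsto_intros e0)
      ultimately show ?thesis by (intro isCont_tendsto_compose[of \<mu> F]) auto
    qed
    ultimately show "(\<lambda>n. cauchy_transform (\<lambda>x. F (Complex x (e n))) \<mu>) \<longlonglongrightarrow> 2 * pi * \<i> * F \<mu>"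
      by (auto intro!: tendsto_intros)
  qed (use mu in simp)
  show "cauchy_transform v \<mu> = 0" if mu: "Im \<mu> < 0"
  proof (rule LIMSEQ_unique[OF conv])
    have "cauchy_transform (\<lambda>x. F (Complex x (e n))) \<mu> = 0" for n
      by (rule half_plane_Cauchy_formula(2)[OF hol bnd e L2(1)[OF e] mu])
    then show "(\<lambda>n. cauchy_transform (\<lambda>x. F (Complex x (e n))) \<mu>) \<longlonglongrightarrow> 0" by simp
  qed (use mu in simp)
qed

text \<open>Normalised so that \<open>jump\<close> inverts \<open>cauchy_transform\<close>: by
  Plemelj the jump of the transform of \<open>f\<close> is \<open>f\<close> almost
  everywhere.\<close>

definition jump :: "(complex \<Rightarrow> complex) \<Rightarrow> real \<Rightarrow> complex" where
  "jump F x = (upper_bv F x - lower_bv F x) / (2 * pi * \<i>)"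

text \<open>The upper boundary function contributes \<open>2 * pi * \<i> * F\<close> above and 0
  below; by reflection the lower one contributes 0 above and \<open>- 2 * pi * \<i> * F\<close>
  below. Their difference gives \<open>F\<close> on both sides.\<close>

theorem hardy_class_representation:
  assumes F: "hardy_class F"
  shows "jump F \<in> Lp 2" and "Im \<mu> \<noteq> 0 \<Longrightarrow> cauchy_transform (jump F) \<mu> = F \<mu>"
proof -
  from F obtain K B where hol: "F holomorphic_on {z. Im z \<noteq> 0}"
    and bnd: "\<And>z. Im z \<noteq> 0 \<Longrightarrow> norm (F z) \<le> K / sqrt \<bar>Im z\<bar>"
    and L2: "\<And>\<epsilon>. \<epsilon> \<noteq> 0 \<Longrightarrow> (\<lambda>x. F (Complex x \<epsilon>)) \<in> Lp 2" "\<And>\<epsilon>. \<epsilon> \<noteq> 0 \<Longrightarrow> sqnorm (\<lambda>x. F (Complex x \<epsilon>)) \<le> B"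
    and bv: "AE x in lebesgue. \<exists>L L'. boundary_values F x L L'"
    unfolding hardy_class_def by blast
  define e where "e n = inverse (real (Suc n))" for n
  have e: "0 < e n" "e n \<noteq> 0" "- e n \<noteq> 0" for n by (auto simp: e_def)
  have [measurable]: "(\<lambda>x. F (Complex x (e n))) \<in> borel_measurable lebesgue" "(\<lambda>x. F (Complex x (- e n))) \<in> borel_measurable lebesgue" for n
    using e by (auto intro!: line_measurable[OF hol])
  have up: "upper_bv F \<in> borel_measurable lebesgue" and low: "lower_bv F \<in> borel_measurable lebesgue"
    unfolding upper_bv_def[abs_def] lower_bv_def[abs_def] e_def[symmetric] by measurable
  have lim_up: "AE x in lebesgue. (\<lambda>n. F (Complex x (inverse (real (Suc n))))) \<longlonglongrightarrow> upper_bv F x"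
    using bv
  proof eventually_elim
    case (elim x)
    then obtain L L' where "boundary_values F x L L'" by blast
    then show ?case using boundary_values_sequences boundary_values_bv by metis
  qed
  have lim_low: "AE x in lebesgue. (\<lambda>n. cnj (F (cnj (Complex x (inverse (real (Suc n))))))) \<longlonglongrightarrow> cnj (lower_bv F x)"
    using bv
  proof eventually_elim
    case (elim x)
    then obtain L L' where b: "boundary_values F x L L'" by blast
    have c: "cnj (Complex x y) = Complex x (- y)" for y by (simp add: complex_eq_iff)
    show ?case unfolding c boundary_values_bv(2)[OF b] by (intro tendsto_cnj boundary_values_sequences(2)[OF b])
  qed
  have holu: "F holomorphic_on {z. 0 < Im z}" by (rule holomorphic_on_subset[OF hol]) auto
  have bndu: "norm (F z) \<le> K / sqrt (Im z)" if "0 < Im z" for z using bnd[of z] that by simp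
  note U = upper_half_plane_representation[OF holu bndu L2(1)[OF less_imp_neq[symmetric]] L2(2)[OF less_imp_neq[symmetric]] lim_up up]
  have holl: "(\<lambda>z. cnj (F (cnj z))) holomorphic_on {z. 0 < Im z}"
  proof -
    have "cnj \<circ> F \<circ> cnj holomorphic_on {z. 0 < Im z}"
      by (rule holomorphic_on_compose_cnj_cnj[OF holomorphic_on_subset[OF hol]]) (auto simp: open_halfspace_Im_gt)
    then show ?thesis by (simp add: o_def)
  qed
  have bndl: "norm (cnj (F (cnj z))) \<le> K / sqrt (Im z)" if "0 < Im z" for z using bnd[of "cnj z"] that by simp
  have c: "cnj (Complex x y) = Complex x (- y)" for x y by (simp add: complex_eq_iff)
  have L2l: "(\<lambda>x. cnj (F (cnj (Complex x \<epsilon>)))) \<in> Lp 2" "sqnorm (\<lambda>x. cnj (F (cnj (Complex x \<epsilon>)))) \<le> B" if "0 < \<epsilon>" for \<epsilon>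
    unfolding c sqnorm_cnj using L2[of "- \<epsilon>"] that by (auto intro: Lp2_cnj)
  note L = upper_half_plane_representation[OF holl bndl L2l lim_low borel_measurable_cnj[OF low]]
  have upL: "upper_bv F \<in> Lp 2" by (rule U(1)) 
  have lowL: "lower_bv F \<in> Lp 2" using Lp2_cnj[OF L(1)] by simp
  have jump_eq: "jump F = (\<lambda>x. (1 / (2 * pi * \<i>)) * (upper_bv F x - lower_bv F x))"
    by (rule ext) (simp add: jump_def)
  show "jump F \<in> Lp 2" unfolding jump_eq by (intro Lp2_cmult Lp2_diff upL lowL)
  assume mu: "Im \<mu> \<noteq> 0"
  have "cauchy_transform (jump F) \<mu> = (1 / (2 * pi * \<i>)) * (cauchy_transform (upper_bv F) \<mu> - cauchy_transform (lower_bv F) \<mu>)"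
    unfolding jump_eq cauchy_transform_cmult cauchy_transform_diff[OF upL lowL mu] ..
  also have "cauchy_transform (upper_bv F) \<mu> - cauchy_transform (lower_bv F) \<mu> = 2 * pi * \<i> * F \<mu>"
  proof -
    have low': "cauchy_transform (lower_bv F) \<mu> = cnj (cauchy_transform (\<lambda>x. cnj (lower_bv F x)) (cnj \<mu>))"
      by (simp add: cauchy_transform_cnj)
    consider "0 < Im \<mu>" | "Im \<mu> < 0" using mu by linarith
    then show ?thesis
    proof cases
      case 1
      then show ?thesis unfolding low' using U(2)[of \<mu>] L(3)[of "cnj \<mu>"] by simp
    next
      case 2
      then show ?thesis unfolding low' using U(3)[of \<mu>] L(2)[of "cnj \<mu>"] by simp
    qed
  qed
  also have "(1 / (2 * pi * \<i>)) * (2 * pi * \<i> * F \<mu>) = F \<mu>" by simp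
  finally show "cauchy_transform (jump F) \<mu> = F \<mu>" .
qed

section \<open>The Friedrichs model\<close>

text \<open>The line has infinite measure; this makes \<open>bdry_const\<close> well
  defined.\<close>

lemma const_Lp2:
  assumes "(\<lambda>x. c) \<in> Lp 2"
  shows "c = 0"
proof (rule ccontr)
  assume c: "c \<noteq> 0"
  have "(\<integral>\<^sup>+x. ennreal ((norm c)\<^sup>2) \<partial>(lebesgue :: real measure)) < \<infinity>"
    using Lp2_integrable[OF assms] by (simp add: integrable_iff_bounded)
  moreover have "(\<integral>\<^sup>+x. ennreal ((norm c)\<^sup>2) \<partial>(lebesgue :: real measure)) = ennreal ((norm c)\<^sup>2) * \<infinity>"
    by (simp add: emeasure_lborel_UNIV)
  ultimately show False using c by (simp add: ennreal_mult_top)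
qed

lemma bdry_const_eq:
  assumes "(\<lambda>x. of_real x * f x - c) \<in> Lp 2"
  shows "bdry_const f = c"
  unfolding bdry_const_def
proof (rule the_equality)
  show "(\<lambda>x. of_real x * f x - c) \<in> Lp 2" by fact
  fix d assume "(\<lambda>x. of_real x * f x - d) \<in> Lp 2"
  from Lp2_diff[OF this assms] have "(\<lambda>x. c - d) \<in> Lp 2" by simp
  then show "d = c" using const_Lp2 by force
qed

lemma friedrichs_domD:
  assumes "u \<in> friedrichs_dom"
  shows "u \<in> Lp 2" "(\<lambda>x. of_real x * u x - bdry_const u) \<in> Lp 2"
  using assms bdry_const_eq unfolding friedrichs_dom_def by auto

lemma friedrichs_dom_diff:
  assumes u: "u \<in> friedrichs_dom" and w: "w \<in> friedrichs_dom"
  shows "(\<lambda>x. u x - w x) \<in> friedrichs_dom" "bdry_const (\<lambda>x. u x - w x) = bdry_const u - bdry_const w"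
proof -
  have "(\<lambda>x. (of_real x * u x - bdry_const u) - (of_real x * w x - bdry_const w)) \<in> Lp 2"
    by (intro Lp2_diff friedrichs_domD u w)
  then have *: "(\<lambda>x. of_real x * (u x - w x) - (bdry_const u - bdry_const w)) \<in> Lp 2"
    by (simp add: algebra_simps)
  then show "(\<lambda>x. u x - w x) \<in> friedrichs_dom"
    using Lp2_diff[OF friedrichs_domD(1)[OF u] friedrichs_domD(1)[OF w]] unfolding friedrichs_dom_def by auto
  show "bdry_const (\<lambda>x. u x - w x) = bdry_const u - bdry_const w" by (rule bdry_const_eq[OF *])
qed

lemma bounded_support_dom:
  assumes u: "u \<in> Lp 2" and supp: "\<forall>x. R < \<bar>x\<bar> \<longrightarrow> u x = 0"
  shows "u \<in> friedrichs_dom" "bdry_const u = 0" "(\<lambda>x. of_real x * u x) \<in> Lp 2"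
proof -
  show *: "(\<lambda>x. of_real x * u x) \<in> Lp 2"
  proof (rule Lp2_bound[OF _ u])
    have [measurable]: "u \<in> borel_measurable lebesgue" using u by (rule Lp2_measurable)
    show "(\<lambda>x. of_real x * u x) \<in> borel_measurable lebesgue" by measurable
    show "AE x in lebesgue. norm (of_real x * u x) \<le> R * norm (u x)"
    proof (rule AE_I2)
      fix x
      show "norm (of_real x * u x) \<le> R * norm (u x)"
        using supp[rule_format, of x] by (cases "R < \<bar>x\<bar>") (auto simp: norm_mult intro!: mult_right_mono)
    qed
  qed
  then show "u \<in> friedrichs_dom" unfolding friedrichs_dom_def using u by (auto intro!: exI[of _ 0])
  show "bdry_const u = 0" by (rule bdry_const_eq) (simp add: *)
qed

section \<open>The functional \<open>Gamma1\<close> as a symmetric improper integral\<close>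

lemma Gamma1_bounded_support:
  assumes supp: "\<forall>x. R < \<bar>x\<bar> \<longrightarrow> u x = 0"
  shows "((\<lambda>R::real. LINT x:{-R..R}|lebesgue. u x) \<longlongrightarrow> (LINT x|lebesgue. u x)) at_top"
proof (rule tendsto_eventually)
  show "\<forall>\<^sub>F R' in at_top. (LINT x:{-R'..R'}|lebesgue. u x) = (LINT x|lebesgue. u x)"
    using eventually_ge_at_top[of R]
  proof eventually_elim
    case (elim R')
    have "indicator {-R'..R'} x *\<^sub>R u x = u x" for x
      using supp[rule_format, of x] elim by (cases "\<bar>x\<bar> \<le> R'") (auto simp: indicator_def abs_le_iff)
    then show ?case by (simp add: set_lebesgue_integral_def)
  qed
qed

lemma LINT_reflect:
  fixes f :: "real \<Rightarrow> complex"
  assumes "f \<in> borel_measurable borel"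
  shows "(LINT x|lebesgue. f (- x)) = (LINT x|lebesgue. f x)"
proof -
  have "(LINT x|lborel. f x) = (LINT x|lborel. f (- x))"
    using lborel_integral_real_affine[of "-1" f 0] by simp
  then show ?thesis using assms by (simp add: integral_completion)
qed

text \<open>An element of the domain may decay only like \<open>c / x\<close>. Subtracting
  \<open>c x / (1 + x^2)\<close> leaves an integrable function, and the subtracted part is odd,
  hence invisible to symmetric integrals. Without convergence \<open>Lim\<close> would not be
  additive.\<close>

lemma Gamma1_converges:
  assumes u: "u \<in> friedrichs_dom"
  shows "\<exists>l. ((\<lambda>R::real. LINT x:{-R..R}|lebesgue. u x) \<longlongrightarrow> l) at_top"
proof -
  define c where "c = bdry_const u"
  define v where "v x = of_real x * u x - c" for x
  have uL: "u \<in> Lp 2" and vL: "v \<in> Lp 2" using friedrichs_domD[OF u] by (auto simp: v_def[abs_def] c_def)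
  have sp: "0 < 1 + x\<^sup>2" for x :: real by (rule add_pos_nonneg) auto
  have cp: "1 + (complex_of_real x)\<^sup>2 \<noteq> 0" for x
  proof -
    have "complex_of_real (1 + x\<^sup>2) \<noteq> 0" using sp[of x] unfolding of_real_eq_0_iff by simp
    then show ?thesis by simp
  qed
  define q where "q x = complex_of_real (x / (1 + x\<^sup>2))" for x
  define r where "r x = complex_of_real (1 / (1 + x\<^sup>2))" for x
  have qc: "continuous_on UNIV q" and rc: "continuous_on UNIV r"
    unfolding q_def r_def using cp by (auto intro!: continuous_intros)
  have L: "f \<in> Lp 2" if f: "continuous_on UNIV f" and b: "\<And>x. (norm (f x))\<^sup>2 \<le> 1 / (1 + x\<^sup>2)" for f :: "real \<Rightarrow> complex"
    unfolding Lp2_iff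
  proof
    show m [measurable]: "f \<in> borel_measurable lebesgue" by (rule borel_measurable_lebesgue_continuous[OF f])
    show "integrable lebesgue (\<lambda>x. (norm (f x))\<^sup>2)"
    proof (rule Bochner_Integration.integrable_bound)
      show "integrable lebesgue (\<lambda>x::real. 1 / (1 + x\<^sup>2))"
        using integrable_inverse_one_plus_square by (simp add: integrable_completion)
      show "AE x in lebesgue. norm ((norm (f x))\<^sup>2) \<le> norm (1 / (1 + x\<^sup>2))"
        using b by (auto intro!: AE_I2 order_trans[OF _ abs_ge_self])
    qed measurable
  qed
  have qL: "q \<in> Lp 2"
  proof (rule L[OF qc])
    fix x :: real
    have "x\<^sup>2 / (1 + x\<^sup>2)\<^sup>2 \<le> (1 + x\<^sup>2) / (1 + x\<^sup>2)\<^sup>2" by (intro divide_right_mono) auto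
    also have "\<dots> = 1 / (1 + x\<^sup>2)" using sp[of x] by (simp add: power2_eq_square)
    finally show "(norm (q x))\<^sup>2 \<le> 1 / (1 + x\<^sup>2)" by (simp only: q_def norm_of_real power2_abs power_divide)
  qed
  have rL: "r \<in> Lp 2"
  proof (rule L[OF rc])
    fix x :: real
    have "1\<^sup>2 / (1 + x\<^sup>2)\<^sup>2 \<le> (1 + x\<^sup>2) / (1 + x\<^sup>2)\<^sup>2" by (intro divide_right_mono) auto
    also have "\<dots> = 1 / (1 + x\<^sup>2)" using sp[of x] by (simp add: power2_eq_square)
    finally show "(norm (r x))\<^sup>2 \<le> 1 / (1 + x\<^sup>2)" by (simp only: r_def norm_of_real power2_abs power_divide)
  qed
  define p where "p x = v x * q x + u x * r x" for x
  have pint: "integrable lebesgue p"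
    unfolding p_def by (intro Bochner_Integration.integrable_add Lp2_mult_integrable uL vL qL rL)
  have up: "u x = p x + c * q x" for x
  proof -
    have "p x + c * q x = (v x * of_real x + u x + c * of_real x) / (1 + (of_real x)\<^sup>2)"
      unfolding p_def q_def r_def by (simp add: add_divide_distrib)
    also have "v x * of_real x + u x + c * of_real x = u x * (1 + (of_real x)\<^sup>2)"
      by (simp add: v_def algebra_simps power2_eq_square)
    finally show ?thesis using cp[of x] by simp
  qed
  have q0: "(LINT x:{-R..R}|lebesgue. q x) = 0" for R
  proof -
    define f where "f x = indicator {-R..R} x *\<^sub>R q x" for x
    have "f \<in> borel_measurable borel"
      unfolding f_def using borel_measurable_continuous_onI[OF qc] by (intro borel_measurable_scaleR) auto
    from LINT_reflect[OF this] have "(LINT x|lebesgue. f (- x)) = (LINT x|lebesgue. f x)" .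
    moreover have "f (- x) = - f x" for x by (auto simp: f_def q_def indicator_def)
    ultimately have "- (LINT x|lebesgue. f x) = (LINT x|lebesgue. f x)" by simp
    then show ?thesis by (simp add: set_lebesgue_integral_def f_def[abs_def])
  qed
  have eq: "(LINT x:{-R..R}|lebesgue. u x) = (LINT x:{-R..R}|lebesgue. p x)" for R
  proof -
    have ip: "set_integrable lebesgue {-R..R} p"
      unfolding set_integrable_def by (rule integrable_mult_indicator[OF _ pint]) simp
    have "(\<lambda>x. indicator {-R..R} x *\<^sub>R q x) = (\<lambda>x. indicator {-R..R} x * q x)"
      by (auto simp: indicator_def)
    moreover have "integrable lebesgue (\<lambda>x. indicator {-R..R} x * q x)"
      by (intro Lp2_mult_integrable indicator_Lp2[of _ "-R" R] qL) auto
    ultimately have iq: "set_integrable lebesgue {-R..R} q"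
      unfolding set_integrable_def by simp
    have "(LINT x:{-R..R}|lebesgue. u x) = (LINT x:{-R..R}|lebesgue. p x + c * q x)"
      by (simp only: up)
    also have "\<dots> = (LINT x:{-R..R}|lebesgue. p x) + c * (LINT x:{-R..R}|lebesgue. q x)"
      using ip iq by (simp add: set_integral_add(2) set_integrable_mult_right set_integral_mult_right)
    finally show ?thesis by (simp add: q0)
  qed
  have "((\<lambda>R::real. LINT x:{-R..R}|lebesgue. p x) \<longlongrightarrow> (LINT x|lebesgue. p x)) at_top"
    by (rule tendsto_at_topI_sequentially) (rule tendsto_integral_symmetric_interval[OF pint])
  then show ?thesis unfolding eq by blast
qed

lemma Gamma1_eqI: "((\<lambda>R::real. LINT x:{-R..R}|lebesgue. u x) \<longlongrightarrow> l) at_top \<Longrightarrow> Gamma1 u = l"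
  unfolding Gamma1_def by (rule tendsto_Lim) auto

lemma set_integrable_Lp2:
  assumes "u \<in> Lp 2"
  shows "set_integrable lebesgue {-R..R} u"
proof -
  have "(\<lambda>x. indicator {-R..R} x *\<^sub>R u x) = (\<lambda>x. indicator {-R..R} x * u x)"
    by (auto simp: indicator_def)
  moreover have "integrable lebesgue (\<lambda>x. indicator {-R..R} x * u x)"
    by (intro Lp2_mult_integrable indicator_Lp2[of _ "-R" R] assms) auto
  ultimately show ?thesis unfolding set_integrable_def by simp
qed

lemma Gamma1_diff:
  assumes u: "u \<in> friedrichs_dom" and w: "w \<in> friedrichs_dom"
  shows "Gamma1 (\<lambda>x. u x - w x) = Gamma1 u - Gamma1 w"
proof -
  obtain a b where ab: "((\<lambda>R::real. LINT x:{-R..R}|lebesgue. u x) \<longlongrightarrow> a) at_top"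
    "((\<lambda>R::real. LINT x:{-R..R}|lebesgue. w x) \<longlongrightarrow> b) at_top"
    using Gamma1_converges[OF u] Gamma1_converges[OF w] by blast
  have "((\<lambda>R::real. LINT x:{-R..R}|lebesgue. u x - w x) \<longlongrightarrow> a - b) at_top"
    using tendsto_diff[OF ab] set_integrable_Lp2[OF friedrichs_domD(1)[OF u]] set_integrable_Lp2[OF friedrichs_domD(1)[OF w]]
    by (simp add: set_integral_diff(2))
  then show ?thesis using ab by (simp add: Gamma1_eqI)
qed

lemma L2_inner_integrable: "f \<in> Lp 2 \<Longrightarrow> g \<in> Lp 2 \<Longrightarrow> integrable lebesgue (\<lambda>x. f x * cnj (g x))"
  by (intro Lp2_mult_integrable Lp2_cnj)

lemma friedrichs_max_diff:
  assumes u: "u \<in> friedrichs_dom" and w: "w \<in> friedrichs_dom" and phi: "\<phi> \<in> Lp 2"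
  shows "friedrichs_max \<phi> \<psi> (\<lambda>x. u x - w x) x = friedrichs_max \<phi> \<psi> u x - friedrichs_max \<phi> \<psi> w x"
proof -
  have inn: "L2_inner (\<lambda>x. u x - w x) \<phi> = L2_inner u \<phi> - L2_inner w \<phi>"
    using L2_inner_integrable[OF friedrichs_domD(1)[OF u] phi] L2_inner_integrable[OF friedrichs_domD(1)[OF w] phi]
    by (simp add: L2_inner_def left_diff_distrib)
  show ?thesis
    unfolding friedrichs_max_def friedrichs_dom_diff(2)[OF u w] inn by (simp add: algebra_simps)
qed

text \<open>Three disjoint intervals next to a real point \<open>t\<close> support a nonzero step function annihilated by
  both \<open>\<Gamma>\<^sub>1\<close> and \<open>\<langle>\<cdot>, \<phi>\<rangle>\<close>: an approximate eigenvector.\<close>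

lemma approximate_eigenvector:
  assumes phi: "\<phi> \<in> Lp 2" and delta: "0 < \<delta>" "\<delta> \<le> 1"
  obtains u where "u \<in> Lp 2" "\<forall>x. \<bar>t\<bar> + 1 < \<bar>x\<bar> \<longrightarrow> u x = 0" "(LINT x|lebesgue. u x) = 0" "L2_inner u \<phi> = 0"
    "0 < sqnorm u" "\<And>x. u x \<noteq> 0 \<Longrightarrow> \<bar>x - t\<bar> \<le> \<delta>"
proof -
  define I where "I j = {t + \<delta> * real j / 3<..t + \<delta> * (real j + 1) / 3}" for j :: nat
  have Isub: "I j \<subseteq> {t..t + \<delta>}" if "j < 3" for j
  proof
    fix x assume "x \<in> I j"
    then have x: "t + \<delta> * real j / 3 < x" "x \<le> t + \<delta> * (real j + 1) / 3" by (auto simp: I_def)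
    have "\<delta> * (real j + 1) \<le> \<delta> * 3" using that delta by (intro mult_left_mono) auto
    moreover have "0 \<le> \<delta> * real j" using delta by simp
    ultimately show "x \<in> {t..t + \<delta>}" using x by auto
  qed
  have Im: "I j \<in> sets lebesgue" for j by (simp add: I_def)
  have IL: "indicator (I j) \<in> Lp 2" if "j < 3" for j by (rule indicator_Lp2[OF Im Isub[OF that]])
  have Ilen: "measure lebesgue (I j) = \<delta> / 3" "emeasure lebesgue (I j) < \<infinity>" for j
  proof -
    have "t + \<delta> * real j / 3 \<le> t + \<delta> * (real j + 1) / 3" using delta by (simp add: field_simps)
    then show "measure lebesgue (I j) = \<delta> / 3" "emeasure lebesgue (I j) < \<infinity>"
      by (simp_all add: I_def field_simps)
  qed
  have Idisj: "x \<notin> I j" if "x \<in> I i" "i < j" for x i j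
  proof -
    have "\<delta> * (real i + 1) \<le> \<delta> * real j" using that(2) delta by (intro mult_left_mono) auto
    then show ?thesis using that(1) by (auto simp: I_def)
  qed
  define p where "p j = L2_inner (indicator (I j)) \<phi>" for j
  \<comment> \<open>Two linear conditions on three coefficients: either \<open>(1, -1, 0)\<close>
    works, or the vector product of \<open>(1, 1, 1)\<close> and \<open>(p 0, p 1, p 2)\<close> up
    to sign, whose last entry is then nonzero.\<close>
  have "\<exists>a :: nat \<Rightarrow> complex. a 0 + a 1 + a 2 = 0 \<and> a 0 * p 0 + a 1 * p 1 + a 2 * p 2 = 0 \<and> (\<exists>j<3. a j \<noteq> 0)"
  proof (cases "p 0 = p 1")
    case True
    define a where "a j = (if j = 0 then 1 else if j = 1 then -1 else (0::complex))" for j :: nat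
    show ?thesis by (rule exI[of _ a]) (use True in \<open>auto simp: a_def intro!: exI[of _ 0]\<close>)
  next
    case False
    define a where "a j = (if j = 0 then p 1 - p 2 else if j = 1 then p 2 - p 0 else p 0 - p 1)" for j :: nat
    show ?thesis by (rule exI[of _ a]) (use False in \<open>auto simp: a_def algebra_simps intro!: exI[of _ 2]\<close>)
  qed
  then obtain a :: "nat \<Rightarrow> complex" and k where a: "a 0 + a 1 + a 2 = 0" "a 0 * p 0 + a 1 * p 1 + a 2 * p 2 = 0"
    and k: "k < 3" "a k \<noteq> 0" by blast
  define u where "u x = (\<Sum>j<3. a j * indicator (I j) x)" for x
  have uL: "u \<in> Lp 2" unfolding u_def by (intro Lp2_sum Lp2_cmult IL) auto
  have usub: "x \<in> {t..t + \<delta>}" if "u x \<noteq> 0" for x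
  proof -
    have "\<exists>j<3. a j * indicator (I j) x \<noteq> 0"
    proof (rule ccontr)
      assume "\<not> (\<exists>j<3. a j * indicator (I j) x \<noteq> 0)"
      then have "u x = 0" unfolding u_def by (intro sum.neutral) blast
      then show False using that by simp
    qed
    then obtain j where "j < 3" "a j * indicator (I j) x \<noteq> 0" by blast
    then have "x \<in> I j" by (auto simp: indicator_def split: if_splits)
    then show ?thesis using Isub[OF \<open>j < 3\<close>] by blast
  qed
  have Iint: "integrable lebesgue (indicator (I j) :: real \<Rightarrow> complex)" for j
  proof -
    have "integrable lebesgue (\<lambda>x. complex_of_real (indicator (I j) x))"
      by (intro integrable_of_real integrable_real_indicator Im Ilen)
    moreover have "(\<lambda>x. complex_of_real (indicator (I j) x)) = indicator (I j)"
      by (rule ext) (simp add: indicator_def)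
    ultimately show ?thesis by simp
  qed
  have Iint_val: "(LINT x|lebesgue. indicator (I j) x) = complex_of_real (\<delta> / 3)" for j
  proof -
    have "(LINT x|lebesgue. indicator (I j) x :: complex) = (LINT x|lebesgue. complex_of_real (indicator (I j) x))"
      by (intro Bochner_Integration.integral_cong) (auto simp: indicator_def)
    also have "\<dots> = complex_of_real (LINT x|lebesgue. indicator (I j) x)" by (rule integral_complex_of_real)
    also have "(LINT x|lebesgue. indicator (I j) x :: real) = \<delta> / 3" using Ilen(1)[of j] by simp
    finally show ?thesis .
  qed
  have sum3: "(\<Sum>j<3. f j) = f 0 + f 1 + f 2" for f :: "nat \<Rightarrow> complex" by (simp add: numeral_3_eq_3 numeral_2_eq_2)
  show ?thesis
  proof (rule that[of u])
    show "u \<in> Lp 2" by (rule uL)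
    show "\<forall>x. \<bar>t\<bar> + 1 < \<bar>x\<bar> \<longrightarrow> u x = 0"
    proof (intro allI impI, rule ccontr)
      fix x assume "\<bar>t\<bar> + 1 < \<bar>x\<bar>" "u x \<noteq> 0"
      then show False using usub[of x] delta by auto
    qed
    show "\<bar>x - t\<bar> \<le> \<delta>" if "u x \<noteq> 0" for x using usub[OF that] by auto
    have "(LINT x|lebesgue. u x) = (\<Sum>j<3. LINT x|lebesgue. a j * indicator (I j) x)"
      unfolding u_def by (rule Bochner_Integration.integral_sum) (intro integrable_mult_right Iint)
    also have "\<dots> = (\<Sum>j<3. a j * complex_of_real (\<delta> / 3))"
      by (intro sum.cong refl) (simp only: Bochner_Integration.integral_mult_right_zero Iint_val)
    also have "\<dots> = (a 0 + a 1 + a 2) * complex_of_real (\<delta> / 3)" unfolding sum3 by (simp only: distrib_right)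
    finally show "(LINT x|lebesgue. u x) = 0" using a(1) by simp
    have "L2_inner u \<phi> = (LINT x|lebesgue. (\<Sum>j<3. a j * (indicator (I j) x * cnj (\<phi> x))))"
      unfolding L2_inner_def u_def by (simp only: sum_distrib_right mult.assoc)
    also have "\<dots> = (\<Sum>j<3. LINT x|lebesgue. a j * (indicator (I j) x * cnj (\<phi> x)))"
      by (rule Bochner_Integration.integral_sum) (intro integrable_mult_right L2_inner_integrable IL phi, auto)
    also have "\<dots> = (\<Sum>j<3. a j * p j)"
      by (intro sum.cong refl) (simp only: Bochner_Integration.integral_mult_right_zero p_def L2_inner_def)
    finally show "L2_inner u \<phi> = 0" unfolding sum3 using a(2) by simp
    have uk: "u x = a k" if "x \<in> I k" for x
    proof -
      have "u x = (\<Sum>j<3. if j = k then a k else 0)"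
        unfolding u_def
      proof (intro sum.cong refl)
        fix j
        consider "j = k" | "j < k" | "k < j" by linarith
        then show "a j * indicator (I j) x = (if j = k then a k else 0)"
          using that Idisj by cases (auto simp: indicator_def)
      qed
      then show ?thesis using k by simp
    qed
    have "sqnorm (\<lambda>x. a k * indicator (I k) x) \<le> sqnorm u"
      by (rule sqnorm_mono[OF Lp2_measurable[OF Lp2_cmult[OF IL[OF k(1)]]] uL]) (auto simp: indicator_def uk)
    moreover have "sqnorm (\<lambda>x. a k * indicator (I k) x) = (norm (a k))\<^sup>2 * (\<delta> / 3)"
    proof -
      have "(norm (indicator (I k) x :: complex))\<^sup>2 = (indicator (I k) x :: real)" for x by (simp add: indicator_def)
      then show ?thesis unfolding sqnorm_cmult sqnorm_def using Ilen(1)[of k] by simp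
    qed
    moreover have "0 < (norm (a k))\<^sup>2 * (\<delta> / 3)" using k delta by simp
    ultimately show "0 < sqnorm u" by simp
  qed
qed

text \<open>On functions annihilated by both boundary functionals and by \<open>\<phi>\<close> the
  operator is multiplication by \<open>x\<close>, whatever \<open>B\<close> is. Concentrating such
  functions near a real \<open>\<mu>\<close> contradicts the bounded inverse.\<close>

lemma rho_A_not_real:
  assumes phi: "\<phi> \<in> Lp 2" and mu: "\<mu> \<in> rho_A \<phi> \<psi> B"
  shows "Im \<mu> \<noteq> 0"
proof
  assume Im0: "Im \<mu> = 0"
  define t where "t = Re \<mu>"
  have mut: "\<mu> = of_real t" using Im0 by (simp add: t_def complex_eq_iff)
  from mu obtain C where C: "\<And>u. u \<in> A_dom B \<Longrightarrow> L2_norm u \<le> C * L2_norm (\<lambda>x. friedrichs_max \<phi> \<psi> u x - \<mu> * u x)"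
    unfolding rho_A_def resolvent_set_def by blast
  \<comment> \<open>Ensures \<open>\<bar>C\<bar> * \<delta> < 1\<close>; the modulus appears because
    the sign of \<open>C\<close> is unknown.\<close>
  define \<delta> where "\<delta> = 1 / (2 * (\<bar>C\<bar> + 1))"
  have delta: "0 < \<delta>" "\<delta> \<le> 1" by (auto simp: \<delta>_def field_simps)
  obtain u where u: "u \<in> Lp 2" "\<forall>x. \<bar>t\<bar> + 1 < \<bar>x\<bar> \<longrightarrow> u x = 0" "(LINT x|lebesgue. u x) = 0" "L2_inner u \<phi> = 0"
    "0 < sqnorm u" "\<And>x. u x \<noteq> 0 \<Longrightarrow> \<bar>x - t\<bar> \<le> \<delta>"
    using approximate_eigenvector[OF phi delta, of t] by blast
  note dom = bounded_support_dom[OF u(1,2)]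
  have "Gamma1 u = 0" using Gamma1_eqI[OF Gamma1_bounded_support[OF u(2)]] u(3) by simp
  then have "u \<in> A_dom B" using dom by (simp add: A_dom_def Gamma2_def)
  moreover have "friedrichs_max \<phi> \<psi> u x - \<mu> * u x = of_real (x - t) * u x" for x
    using dom u(4) by (simp add: friedrichs_max_def mut algebra_simps)
  ultimately have le: "L2_norm u \<le> C * L2_norm (\<lambda>x. of_real (x - t) * u x)"
    using C[of u] by simp
  have "sqnorm (\<lambda>x. of_real (x - t) * u x) \<le> sqnorm (\<lambda>x. of_real \<delta> * u x)"
  proof (rule sqnorm_mono[OF _ Lp2_cmult[OF u(1)]])
    have [measurable]: "u \<in> borel_measurable lebesgue" using u(1) by (rule Lp2_measurable)
    show "(\<lambda>x. of_real (x - t) * u x) \<in> borel_measurable lebesgue" by measurable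
    show "AE x in lebesgue. norm (of_real (x - t) * u x) \<le> norm (of_real \<delta> * u x)"
    proof (rule AE_I2)
      fix x
      show "norm (of_real (x - t) * u x) \<le> norm (of_real \<delta> * u x)"
        using u(6)[of x] delta by (cases "u x = 0") (auto simp: norm_mult simp del: of_real_diff intro!: mult_right_mono)
    qed
  qed
  also have "\<dots> = \<delta>\<^sup>2 * sqnorm u" unfolding sqnorm_cmult by simp
  finally have "sqrt (sqnorm (\<lambda>x. of_real (x - t) * u x)) \<le> sqrt (\<delta>\<^sup>2 * sqnorm u)"
    by (rule real_sqrt_le_mono)
  then have "L2_norm (\<lambda>x. of_real (x - t) * u x) \<le> \<delta> * L2_norm u"
    unfolding L2_norm_eq_sqrt_sqnorm real_sqrt_mult using delta by simp
  then have "\<bar>C\<bar> * L2_norm (\<lambda>x. of_real (x - t) * u x) \<le> \<bar>C\<bar> * (\<delta> * L2_norm u)"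
    by (rule mult_left_mono) simp
  moreover have "C * L2_norm (\<lambda>x. of_real (x - t) * u x) \<le> \<bar>C\<bar> * L2_norm (\<lambda>x. of_real (x - t) * u x)"
    by (rule mult_right_mono) (auto simp: L2_norm_eq_sqrt_sqnorm)
  ultimately have "L2_norm u \<le> (\<bar>C\<bar> * \<delta>) * L2_norm u" using le by simp
  moreover have "\<bar>C\<bar> * \<delta> < 1" by (simp add: \<delta>_def field_simps)
  moreover have "0 < L2_norm u" using u(5) by (simp add: L2_norm_eq_sqrt_sqnorm)
  ultimately show False
    using mult_strict_right_mono[of "\<bar>C\<bar> * \<delta>" 1 "L2_norm u"] by linarith
qed

text \<open>Shows that the choice in \<open>solution_op\<close> has a candidate: the boundary datum
  is carried by \<open>z\<close> times the indicator of \<open>[0, 1]\<close>, and a solution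
  \<open>w\<close> in the domain of \<open>A_B\<close>, subtracted from it, removes the error in the
  equation without changing the boundary value.\<close>

lemma solution_op_solves:
  assumes phi: "\<phi> \<in> Lp 2" and psi: "\<psi> \<in> Lp 2" and mu: "\<mu> \<in> rho_A \<phi> \<psi> B"
  shows "solution_op \<phi> \<psi> \<mu> B z \<in> friedrichs_dom"
    and "AE x in lebesgue. friedrichs_max \<phi> \<psi> (solution_op \<phi> \<psi> \<mu> B z) x - \<mu> * solution_op \<phi> \<psi> \<mu> B z x = 0"
proof -
  define u0 where "u0 x = z * indicator {0..1} x" for x :: real
  have u0L: "u0 \<in> Lp 2" unfolding u0_def by (intro Lp2_cmult indicator_Lp2[of _ 0 1]) auto
  have supp: "\<forall>x. 1 < \<bar>x\<bar> \<longrightarrow> u0 x = 0" by (auto simp: u0_def indicator_def)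
  note dom = bounded_support_dom[OF u0L supp]
  have "(LINT x|lebesgue. u0 x) = z"
  proof -
    have "(LINT x|lebesgue. indicator {0..1::real} x :: complex) = (LINT x|lebesgue. complex_of_real (indicator {0..1::real} x))"
      by (intro Bochner_Integration.integral_cong) (auto simp: indicator_def)
    also have "\<dots> = complex_of_real (LINT x|lebesgue. indicator {0..1::real} x)" by (rule integral_complex_of_real)
    also have "\<dots> = 1" by simp
    finally show ?thesis unfolding u0_def by simp
  qed
  then have G1: "Gamma1 u0 = z" using Gamma1_eqI[OF Gamma1_bounded_support[OF supp]] by simp
  define g where "g x = friedrichs_max \<phi> \<psi> u0 x - \<mu> * u0 x" for x
  have "g \<in> Lp 2"
    unfolding g_def friedrichs_max_def dom(2) using Lp2_add[OF dom(3) Lp2_cmult[OF psi]]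
    by (intro Lp2_diff Lp2_cmult u0L) simp
  then obtain w where w: "w \<in> A_dom B" "AE x in lebesgue. friedrichs_max \<phi> \<psi> w x - \<mu> * w x = g x"
    using mu unfolding rho_A_def resolvent_set_def by blast
  have wd: "w \<in> friedrichs_dom" "Gamma1 w = B * Gamma2 w" using w(1) by (auto simp: A_dom_def)
  define u where "u x = u0 x - w x" for x
  have "u \<in> friedrichs_dom" unfolding u_def by (rule friedrichs_dom_diff(1)[OF dom(1) wd(1)])
  moreover have "AE x in lebesgue. friedrichs_max \<phi> \<psi> u x - \<mu> * u x = 0"
    using w(2)
  proof eventually_elim
    case (elim x)
    then show ?case
      unfolding u_def friedrichs_max_diff[OF dom(1) wd(1) phi] by (simp add: g_def algebra_simps)
  qed
  moreover have "Gamma1 u - B * Gamma2 u = z"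
    unfolding u_def Gamma1_diff[OF dom(1) wd(1)] Gamma2_def friedrichs_dom_diff(2)[OF dom(1) wd(1)]
    using G1 wd(2) dom(2) by (simp add: Gamma2_def)
  ultimately have "\<exists>u. u \<in> friedrichs_dom \<and> (AE x in lebesgue. friedrichs_max \<phi> \<psi> u x - \<mu> * u x = 0) \<and> Gamma1 u - B * Gamma2 u = z"
    by blast
  from someI_ex[OF this]
  show "solution_op \<phi> \<psi> \<mu> B z \<in> friedrichs_dom"
    and "AE x in lebesgue. friedrichs_max \<phi> \<psi> (solution_op \<phi> \<psi> \<mu> B z) x - \<mu> * solution_op \<phi> \<psi> \<mu> B z x = 0"
    unfolding solution_op_def by auto
qed

text \<open>The common factor \<open>g\<close> makes the pair of transforms of \<open>h\<close> and
  \<open>\<psi> h\<close> proportional to \<open>(N, D)\<close>, the very pair in the linear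
  relation between \<open>c\<close> and \<open>d\<close>.\<close>

lemma kernel_annihilated:
  assumes phi: "\<phi> \<in> Lp 2" and psi: "\<psi> \<in> Lp 2" and pp: "(\<lambda>x. cnj (\<phi> x) * \<psi> x) \<in> Lp 2"
    and h: "h \<in> Lp 2" and ph: "(\<lambda>x. \<psi> x * h x) \<in> Lp 2" and mu: "Im \<mu> \<noteq> 0"
    and u: "u \<in> friedrichs_dom" "AE x in lebesgue. friedrichs_max \<phi> \<psi> u x - \<mu> * u x = 0"
    and ch: "cauchy_transform h \<mu> = cauchy_transform (\<lambda>x. cnj (\<phi> x)) \<mu> * g"
    and cph: "cauchy_transform (\<lambda>x. \<psi> x * h x) \<mu> = (1 + cauchy_transform (\<lambda>x. cnj (\<phi> x) * \<psi> x) \<mu>) * g"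
  shows "(LINT x|lebesgue. h x * u x) = 0"
proof -
  define c where "c = bdry_const u"
  define d where "d = L2_inner u \<phi>"
  have uL: "u \<in> Lp 2" by (rule friedrichs_domD(1)[OF u(1)])
  have ueq: "AE x in lebesgue. u x = (c - d * \<psi> x) / (complex_of_real x - \<mu>)"
    using u(2)
  proof eventually_elim
    case (elim x)
    have "complex_of_real x - \<mu> \<noteq> 0" using mu by (auto simp: complex_eq_iff)
    moreover have "(complex_of_real x - \<mu>) * u x = c - d * \<psi> x"
      using elim by (simp add: friedrichs_max_def c_def d_def algebra_simps)
    ultimately show ?case by (simp add: field_simps)
  qed
  have [measurable]: "u \<in> borel_measurable lebesgue" "\<psi> \<in> borel_measurable lebesgue" using uL psi by (auto simp: Lp2_measurable)
  \<comment> \<open>Used twice: with \<open>cnj \<phi>\<close> it gives the relation between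
    \<open>c\<close> and \<open>d\<close>, with \<open>h\<close> the integral to be
    computed.\<close>
  have key: "(LINT x|lebesgue. f x * u x) = c * cauchy_transform f \<mu> - d * cauchy_transform (\<lambda>x. f x * \<psi> x) \<mu>"
    if f: "f \<in> Lp 2" and fp: "(\<lambda>x. f x * \<psi> x) \<in> Lp 2" for f
  proof -
    have [measurable]: "f \<in> borel_measurable lebesgue" using f by (rule Lp2_measurable)
    have "(LINT x|lebesgue. f x * u x) = (LINT x|lebesgue. c * (f x / (complex_of_real x - \<mu>)) - d * (f x * \<psi> x / (complex_of_real x - \<mu>)))"
    proof (rule integral_cong_AE)
      show "AE x in lebesgue. f x * u x = c * (f x / (complex_of_real x - \<mu>)) - d * (f x * \<psi> x / (complex_of_real x - \<mu>))"
        using ueq by eventually_elim (simp add: diff_divide_distrib right_diff_distrib ac_simps)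
    qed measurable
    also have "\<dots> = (LINT x|lebesgue. c * (f x / (complex_of_real x - \<mu>))) - (LINT x|lebesgue. d * (f x * \<psi> x / (complex_of_real x - \<mu>)))"
      by (intro Bochner_Integration.integral_diff integrable_mult_right cauchy_transform_integrable f fp mu)
    also have "\<dots> = c * cauchy_transform f \<mu> - d * cauchy_transform (\<lambda>x. f x * \<psi> x) \<mu>"
      unfolding cauchy_transform_def by (simp only: Bochner_Integration.integral_mult_right_zero)
    finally show ?thesis .
  qed
  have "d = (LINT x|lebesgue. cnj (\<phi> x) * u x)"
    unfolding d_def L2_inner_def by (simp only: mult.commute)
  also have "\<dots> = c * cauchy_transform (\<lambda>x. cnj (\<phi> x)) \<mu> - d * cauchy_transform (\<lambda>x. cnj (\<phi> x) * \<psi> x) \<mu>"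
    by (rule key[OF Lp2_cnj[OF phi] pp])
  finally have dD: "d * (1 + cauchy_transform (\<lambda>x. cnj (\<phi> x) * \<psi> x) \<mu>) = c * cauchy_transform (\<lambda>x. cnj (\<phi> x)) \<mu>"
    by (simp add: algebra_simps)
  have hp: "(\<lambda>x. h x * \<psi> x) = (\<lambda>x. \<psi> x * h x)" by (simp add: mult.commute)
  have "(LINT x|lebesgue. h x * u x) = c * cauchy_transform h \<mu> - d * cauchy_transform (\<lambda>x. \<psi> x * h x) \<mu>"
    using key[OF h] ph unfolding hp by blast
  also have "\<dots> = (c * cauchy_transform (\<lambda>x. cnj (\<phi> x)) \<mu> - d * (1 + cauchy_transform (\<lambda>x. cnj (\<phi> x) * \<psi> x) \<mu>)) * g"
    unfolding ch cph by (simp add: algebra_simps)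
  finally show ?thesis unfolding dD by simp
qed

section \<open>From single solutions to their closed span\<close>

lemma orth_compl_closed_span:
  assumes V: "V \<subseteq> Lp 2" and f: "f \<in> Lp 2" and orth: "\<And>g. g \<in> V \<Longrightarrow> L2_inner f g = 0"
  shows "f \<in> L2_orth_compl (L2_closed_span V)"
proof -
  define W where "W = {g \<in> Lp 2. L2_inner f g = 0}"
  have "cfun.subspace W"
  proof (rule cfun.subspaceI)
    show "0 \<in> W" unfolding W_def zero_fun_def using Lp2_zero by (simp add: L2_inner_def)
    show "g + h \<in> W" if "g \<in> W" "h \<in> W" for g h
      using that L2_inner_integrable[OF f, of g] L2_inner_integrable[OF f, of h] Lp2_add[of g h]
      unfolding W_def plus_fun_def by (simp add: L2_inner_def distrib_left)
    show "cscale c g \<in> W" if "g \<in> W" for c g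
    proof -
      have "L2_inner f (cscale c g) = (LINT x|lebesgue. cnj c * (f x * cnj (g x)))"
        unfolding L2_inner_def cscale_def by (intro Bochner_Integration.integral_cong) simp_all
      also have "\<dots> = cnj c * L2_inner f g" unfolding L2_inner_def by (rule Bochner_Integration.integral_mult_right_zero)
      finally show ?thesis using that Lp2_cmult[of g c] unfolding W_def cscale_def by simp
    qed
  qed
  then have span: "cfun.span V \<subseteq> W"
    using V orth by (intro cfun.span_minimal) (auto simp: W_def)
  have "L2_inner f g = 0" if g: "g \<in> L2_closed_span V" for g
  proof -
    have gL: "g \<in> Lp 2" using g by (simp add: L2_closed_span_def)
    define K where "K = sqrt (sqnorm f) + 1"
    have K: "0 < K" by (simp add: K_def add_nonneg_pos)
    have "norm (L2_inner f g) \<le> e" if e: "0 < e" for e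
    proof -
      have "0 < e / K" using e K by simp
      then obtain s where s: "s \<in> cfun.span V" "L2_norm (g - s) < e / K"
        using g unfolding L2_closed_span_def by blast
      have sW: "s \<in> Lp 2" "L2_inner f s = 0" using span s(1) by (auto simp: W_def)
      have gs: "g - s = (\<lambda>x. g x - s x)" by (rule ext) simp
      have "L2_inner f g = L2_inner f g - L2_inner f s" using sW by simp
      also have "\<dots> = (LINT x|lebesgue. f x * cnj (g x - s x))"
        using L2_inner_integrable[OF f gL] L2_inner_integrable[OF f sW(1)]
        by (simp add: L2_inner_def right_diff_distrib)
      finally have "norm (L2_inner f g) \<le> sqrt (sqnorm f) * sqrt (sqnorm (\<lambda>x. g x - s x))"
        using Cauchy_Schwarz_Lp2[OF f Lp2_cnj[OF Lp2_diff[OF gL sW(1)]]] unfolding sqnorm_cnj by simp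
      also have "sqrt (sqnorm (\<lambda>x. g x - s x)) \<le> e / K"
        using s(2) unfolding gs L2_norm_eq_sqrt_sqnorm by simp
      also have "sqrt (sqnorm f) * (e / K) \<le> K * (e / K)"
        using e K by (intro mult_right_mono) (auto simp: K_def)
      finally show ?thesis using K by (simp add: mult_left_mono)
    qed
    then have "norm (L2_inner f g) \<le> 0" by (rule field_le_epsilon) simp
    then show ?thesis by simp
  qed
  then show ?thesis using f by (simp add: L2_orth_compl_def)
qed

section \<open>Bounded functions that continue analytically across the complement of a set\<close>

text \<open>The imaginary part is, up to the sign of \<open>Im z\<close>, a Poisson integral of a
  nonnegative function: enlarging \<open>E\<close> to the whole line bounds it, and positive measure
  of \<open>E\<close> keeps it away from 0.\<close>

lemma Im_cauchy_transform_indicator: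
  assumes E: "E \<in> sets lebesgue" "E \<subseteq> {a..b}" and z: "Im z \<noteq> 0"
  shows "Im (cauchy_transform (indicator E) z) = Im z * (LINT x|lebesgue. indicator E x * (norm (1 / (complex_of_real x - z)))\<^sup>2)"
proof -
  have "Im (cauchy_transform (indicator E) z) = (LINT x|lebesgue. Im (indicator E x / (complex_of_real x - z)))"
    unfolding cauchy_transform_def
    by (rule integral_Im[symmetric]) (rule cauchy_transform_integrable[OF indicator_Lp2[OF E] z])
  also have "\<dots> = (LINT x|lebesgue. Im z * (indicator E x * (norm (1 / (complex_of_real x - z)))\<^sup>2))"
  proof (rule Bochner_Integration.integral_cong[OF refl])
    fix x
    have "Im (1 / (complex_of_real x - z)) = Im z * (norm (1 / (complex_of_real x - z)))\<^sup>2"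
      by (simp add: Im_divide norm_divide power_divide cmod_power2)
    then show "Im (indicator E x / (complex_of_real x - z)) = Im z * (indicator E x * (norm (1 / (complex_of_real x - z)))\<^sup>2)"
      by (simp add: indicator_def)
  qed
  also have "\<dots> = Im z * (LINT x|lebesgue. indicator E x * (norm (1 / (complex_of_real x - z)))\<^sup>2)"
    by (rule Bochner_Integration.integral_mult_right_zero)
  finally show ?thesis .
qed

lemma kernel_square_integrable:
  assumes E: "E \<in> sets lebesgue" and z: "Im z \<noteq> 0"
  shows "integrable lebesgue (\<lambda>x. indicator E x * (norm (1 / (complex_of_real x - z)))\<^sup>2)"
  using integrable_mult_indicator[OF E Lp2_integrable[OF kernel_Lp2[OF z]]] by simp

lemma abs_Im_cauchy_transform_indicator_le:
  assumes E: "E \<in> sets lebesgue" "E \<subseteq> {a..b}" and z: "Im z \<noteq> 0"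
  shows "\<bar>Im (cauchy_transform (indicator E) z)\<bar> \<le> inv_sq_integral"
proof -
  define J where "J = (LINT x|lebesgue. indicator E x * (norm (1 / (complex_of_real x - z)))\<^sup>2)"
  have "J \<le> sqnorm (\<lambda>x. 1 / (complex_of_real x - z))"
    unfolding J_def sqnorm_def
    by (rule Bochner_Integration.integral_mono[OF kernel_square_integrable[OF E(1) z] Lp2_integrable[OF kernel_Lp2[OF z]]])
       (auto simp: indicator_def)
  then have "\<bar>Im z\<bar> * J \<le> \<bar>Im z\<bar> * (inv_sq_integral / \<bar>Im z\<bar>)"
    unfolding sqnorm_kernel[OF z] by (rule mult_left_mono) simp
  moreover have "0 \<le> J" unfolding J_def by (rule integral_nonneg_AE) auto
  ultimately show ?thesis
    unfolding Im_cauchy_transform_indicator[OF E z] J_def[symmetric] using z by (simp add: abs_mult)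
qed

lemma Im_cauchy_transform_indicator_nonzero:
  assumes E: "E \<in> sets lebesgue" "E \<subseteq> {a..b}" and pos: "emeasure lebesgue E > 0" and z: "Im z \<noteq> 0"
  shows "Im (cauchy_transform (indicator E) z) \<noteq> 0"
proof
  assume "Im (cauchy_transform (indicator E) z) = 0"
  then have "(LINT x|lebesgue. indicator E x * (norm (1 / (complex_of_real x - z)))\<^sup>2) = 0"
    unfolding Im_cauchy_transform_indicator[OF E z] using z by simp
  then have "AE x in lebesgue. indicator E x * (norm (1 / (complex_of_real x - z)))\<^sup>2 = (0 :: real)"
    by (subst (asm) integral_nonneg_eq_0_iff_AE[OF kernel_square_integrable[OF E(1) z]]) auto
  then have "AE x in lebesgue. x \<notin> E"
  proof eventually_elim
    case (elim x)
    moreover have "complex_of_real x - z \<noteq> 0" using z by (auto simp: complex_eq_iff)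
    ultimately show ?case by (auto simp: indicator_def)
  qed
  then have "E \<in> null_sets lebesgue" using E(1) by (simp add: AE_iff_null_sets)
  then show False using pos by (simp add: null_sets_def)
qed

text \<open>The Cauchy transform \<open>w\<close> of the indicator of \<open>E\<close> takes values in a horizontal strip, so a Moebius
  transformation with pole outside the strip makes it bounded: \<open>strip_map E = w / (w - strip_const)\<close>.\<close>

definition strip_const :: complex where
  "strip_const = \<i> * complex_of_real (inv_sq_integral + 1)"

definition strip_inv :: "real set \<Rightarrow> complex \<Rightarrow> complex" where
  "strip_inv E z = 1 / (cauchy_transform (indicator E) z - strip_const)"

definition strip_map :: "real set \<Rightarrow> complex \<Rightarrow> complex" where
  "strip_map E z = 1 + strip_const * strip_inv E z"

lemma strip_dist_ge_1:
  assumes E: "E \<in> sets lebesgue" "E \<subseteq> {a..b}" and z: "Im z \<noteq> 0"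
  shows "1 \<le> norm (cauchy_transform (indicator E) z - strip_const)"
proof -
  have "1 \<le> \<bar>Im (cauchy_transform (indicator E) z - strip_const)\<bar>"
    using abs_Im_cauchy_transform_indicator_le[OF E z] by (simp add: strip_const_def)
  then show ?thesis using abs_Im_le_cmod order_trans by blast
qed

text \<open>The defining formula displays boundedness; this one displays a factor in the Hardy
  class, which supplies the square integrability that the summand 1 of \<open>D\<close>
  lacks.\<close>

lemma strip_map_eq_mult:
  assumes E: "E \<in> sets lebesgue" "E \<subseteq> {a..b}" and z: "Im z \<noteq> 0"
  shows "strip_map E z = cauchy_transform (indicator E) z * strip_inv E z"
proof -
  have "cauchy_transform (indicator E) z - strip_const \<noteq> 0" using strip_dist_ge_1[OF E z] by auto
  then show ?thesis by (simp add: strip_map_def strip_inv_def field_simps)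
qed

text \<open>The distance 1 to the pole survives in the limit, so the Moebius map is continuous at
  the boundary values.\<close>

lemma strip_boundary_values:
  assumes E: "E \<in> sets lebesgue" "E \<subseteq> {a..b}" and bv: "boundary_values (cauchy_transform (indicator E)) x L L'"
  shows "L \<noteq> strip_const" "L' \<noteq> strip_const"
    and "boundary_values (strip_inv E) x (1 / (L - strip_const)) (1 / (L' - strip_const))"
    and "boundary_values (strip_map E) x (1 + strip_const * (1 / (L - strip_const))) (1 + strip_const * (1 / (L' - strip_const)))"
proof -
  let ?w = "cauchy_transform (indicator E)"
  have lim: "((\<lambda>\<epsilon>. ?w (Complex x \<epsilon>)) \<longlongrightarrow> L) (at_right 0)" "((\<lambda>\<epsilon>. ?w (Complex x (- \<epsilon>))) \<longlongrightarrow> L') (at_right 0)"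
    using bv by (auto simp: boundary_values_def)
  have "1 \<le> norm (L - strip_const)"
  proof (rule tendsto_lowerbound)
    show "((\<lambda>\<epsilon>. norm (?w (Complex x \<epsilon>) - strip_const)) \<longlongrightarrow> norm (L - strip_const)) (at_right 0)"
      by (intro tendsto_intros lim)
    show "\<forall>\<^sub>F \<epsilon> in at_right 0. 1 \<le> norm (?w (Complex x \<epsilon>) - strip_const)"
      using eventually_Im_nonzero[of x] by eventually_elim (use strip_dist_ge_1[OF E] in auto)
  qed simp
  then show L: "L \<noteq> strip_const" by auto
  have "1 \<le> norm (L' - strip_const)"
  proof (rule tendsto_lowerbound)
    show "((\<lambda>\<epsilon>. norm (?w (Complex x (- \<epsilon>)) - strip_const)) \<longlongrightarrow> norm (L' - strip_const)) (at_right 0)"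
      by (intro tendsto_intros lim)
    show "\<forall>\<^sub>F \<epsilon> in at_right 0. 1 \<le> norm (?w (Complex x (- \<epsilon>)) - strip_const)"
      using eventually_Im_nonzero[of x] by eventually_elim (use strip_dist_ge_1[OF E] in auto)
  qed simp
  then show L': "L' \<noteq> strip_const" by auto
  show *: "boundary_values (strip_inv E) x (1 / (L - strip_const)) (1 / (L' - strip_const))"
    unfolding boundary_values_def strip_inv_def using L L' by (intro conjI tendsto_intros lim) auto
  show "boundary_values (strip_map E) x (1 + strip_const * (1 / (L - strip_const))) (1 + strip_const * (1 / (L' - strip_const)))"
    unfolding strip_map_def
    by (intro boundary_values_add boundary_values_mult boundary_values_const *)
qed

lemma bounded_class_strip:
  assumes E: "E \<in> sets lebesgue" "E \<subseteq> {a..b}"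
  shows "bounded_class (strip_inv E)" "bounded_class (strip_map E)"
proof -
  have bv: "AE x in lebesgue. \<exists>L L'. boundary_values (cauchy_transform (indicator E)) x L L'"
    using hardy_class_cauchy_transform[OF indicator_Lp2[OF E]] unfolding hardy_class_def by blast
  have ne: "cauchy_transform (indicator E) z - strip_const \<noteq> 0" if "Im z \<noteq> 0" for z
    using strip_dist_ge_1[OF E that] by auto
  have hol: "strip_inv E holomorphic_on {z. Im z \<noteq> 0}"
    unfolding strip_inv_def using ne
    by (intro holomorphic_intros holomorphic_cauchy_transform[OF indicator_Lp2[OF E]]) auto
  have b: "norm (strip_inv E z) \<le> 1" if "Im z \<noteq> 0" for z
    using strip_dist_ge_1[OF E that] by (simp add: strip_inv_def norm_divide divide_le_eq)
  show "bounded_class (strip_inv E)"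
    unfolding bounded_class_def
  proof (intro conjI exI allI impI)
    show "AE x in lebesgue. \<exists>L L'. boundary_values (strip_inv E) x L L'"
      using bv by eventually_elim (blast intro: strip_boundary_values(3)[OF E])
  qed (use hol b in auto)
  show "bounded_class (strip_map E)"
    unfolding bounded_class_def
  proof (intro conjI exI allI impI)
    show "AE x in lebesgue. \<exists>L L'. boundary_values (strip_map E) x L L'"
      using bv by eventually_elim (blast intro: strip_boundary_values(4)[OF E])
    show "strip_map E holomorphic_on {z. Im z \<noteq> 0}" unfolding strip_map_def by (intro holomorphic_intros hol)
    show "norm (strip_map E z) \<le> 1 + norm strip_const * 1" if "Im z \<noteq> 0" for z
      unfolding strip_map_def
      by (rule order_trans[OF norm_triangle_ineq]) (use mult_left_mono[OF b[OF that], of "norm strip_const"] in \<open>simp add: norm_mult\<close>)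
  qed
qed

lemma bounded_class_mult:
  assumes "bounded_class F" "bounded_class G"
  shows "bounded_class (\<lambda>z. F z * G z)"
proof -
  from assms obtain M N where F: "F holomorphic_on {z. Im z \<noteq> 0}" "\<And>z. Im z \<noteq> 0 \<Longrightarrow> norm (F z) \<le> M"
    "AE x in lebesgue. \<exists>L L'. boundary_values F x L L'"
    and G: "G holomorphic_on {z. Im z \<noteq> 0}" "\<And>z. Im z \<noteq> 0 \<Longrightarrow> norm (G z) \<le> N"
    "AE x in lebesgue. \<exists>L L'. boundary_values G x L L'"
    unfolding bounded_class_def by blast
  show ?thesis
    unfolding bounded_class_def
  proof (intro conjI exI allI impI)
    show "(\<lambda>z. F z * G z) holomorphic_on {z. Im z \<noteq> 0}" by (intro holomorphic_intros F G)
    show "norm (F z * G z) \<le> M * N" if "Im z \<noteq> 0" for z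
      unfolding norm_mult using order_trans[OF norm_ge_zero F(2)[OF that]]
      by (intro mult_mono F(2) G(2) that) auto
    show "AE x in lebesgue. \<exists>L L'. boundary_values (\<lambda>z. F z * G z) x L L'"
      using F(3) G(3) by eventually_elim (blast intro: boundary_values_mult)
  qed
qed

text \<open>A continuous map with finite range on a connected set is constant. Then the transform of
  the indicator is constant near \<open>z0\<close>, hence in the whole half-plane, hence 0 by its
  decay as \<bar>Im z\<bar> grows, against its nonzero imaginary part.\<close>

lemma strip_map_infinite_on_ball:
  assumes E: "E \<in> sets lebesgue" "E \<subseteq> {a..b}" and pos: "emeasure lebesgue E > 0"
    and z0: "Im z0 \<noteq> 0" and \<rho>: "0 < \<rho>" and sub: "ball z0 \<rho> \<subseteq> {z. Im z \<noteq> 0}"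
  shows "infinite (strip_map E ` ball z0 \<rho>)"
proof
  let ?w = "cauchy_transform (indicator E)"
  note wL = indicator_Lp2[OF E]
  assume fin: "finite (strip_map E ` ball z0 \<rho>)"
  have "continuous_on (ball z0 \<rho>) (strip_map E)"
    using bounded_class_strip(2)[OF E] sub unfolding bounded_class_def
    by (meson holomorphic_on_imp_continuous_on holomorphic_on_subset)
  then have "strip_map E constant_on ball z0 \<rho>"
    by (rule continuous_finite_range_constant[OF connected_ball _ fin])
  then obtain c where c: "\<And>z. z \<in> ball z0 \<rho> \<Longrightarrow> strip_map E z = c" by (auto simp: constant_on_def)
  have sc: "strip_const \<noteq> 0" using inv_sq_integral_nonneg by (simp add: strip_const_def complex_eq_iff)
  have wconst: "?w z = ?w z0" if z: "z \<in> ball z0 \<rho>" for z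
  proof -
    have "strip_map E z = strip_map E z0" using c[OF z] c[of z0] \<rho> by simp
    then have "strip_inv E z = strip_inv E z0" using sc by (simp add: strip_map_def)
    moreover have "?w z - strip_const \<noteq> 0" "?w z0 - strip_const \<noteq> 0"
      using strip_dist_ge_1[OF E, of z] strip_dist_ge_1[OF E z0] sub z by auto
    ultimately show ?thesis by (simp add: strip_inv_def field_simps)
  qed
  \<comment> \<open>The half-plane containing \<open>z0\<close>, in a form that treats both cases at
    once.\<close>
  define H where "H = {z. 0 < Im z * Im z0}"
  have H: "open H" "connected H" "\<And>z. z \<in> H \<Longrightarrow> Im z \<noteq> 0" "z0 \<in> H"
  proof -
    have *: "H = (if 0 < Im z0 then {z. 0 < Im z} else {z. Im z < 0})"
      using z0 by (auto simp: H_def zero_less_mult_iff)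
    show "open H" unfolding * by (simp add: open_halfspace_Im_gt open_halfspace_Im_lt)
    show "connected H" unfolding *
      by (simp add: convex_connected convex_halfspace_Im_gt convex_halfspace_Im_lt)
  qed (use z0 in \<open>auto simp: H_def zero_less_mult_iff\<close>)
  have "z0 \<in> ball z0 \<rho> \<inter> H" using H(4) \<rho> by simp
  then have ballH: "ball z0 \<rho> \<inter> H \<noteq> {}" by blast
  have wH: "?w z = ?w z0" if "z \<in> H" for z
  proof (rule analytic_continuation_open[of "ball z0 \<rho> \<inter> H" H ?w "\<lambda>_. ?w z0"])
    show "?w holomorphic_on H" by (rule holomorphic_cauchy_transform[OF wL]) (use H in auto)
  qed (use H ballH wconst that in auto)
  have small: "norm (?w z0) \<le> sqrt (sqnorm (indicator E)) * sqrt (inv_sq_integral / real n)" if n: "0 < n" for n :: nat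
  proof -
    define z where "z = Complex 0 (real n * sgn (Im z0))"
    have a: "\<bar>Im z\<bar> = real n" using z0 by (simp add: z_def abs_mult abs_sgn_eq)
    have "z \<in> H" using z0 n by (auto simp: H_def z_def mult.assoc zero_less_mult_iff sgn_if)
    then show ?thesis using norm_cauchy_transform_le[OF wL H(3)] wH a by metis
  qed
  have "(\<lambda>n. sqrt (sqnorm (indicator E)) * sqrt (inv_sq_integral / real n)) \<longlonglongrightarrow> sqrt (sqnorm (indicator E)) * sqrt 0"
    by (intro tendsto_intros lim_const_over_n)
  then have "norm (?w z0) \<le> sqrt (sqnorm (indicator E)) * sqrt 0"
    by (rule tendsto_lowerbound) (use small in \<open>auto intro!: eventually_sequentiallyI[of 1]\<close>)
  then have "?w z0 = 0" by simp
  then show False using Im_cauchy_transform_indicator_nonzero[OF E pos z0] by simp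
qed

section \<open>The orthogonal complement of the detectable subspace\<close>

text \<open>The integrability alternatives act through this product: it makes \<open>D - 1\<close>
  the Cauchy transform of an L^2 function.\<close>

lemma Lp2_cnj_mult:
  assumes "(\<exists>\<epsilon>>0. \<phi> \<in> Lp 2 \<inter> Lp (2 + \<epsilon>) \<and> \<psi> \<in> Lp 2 \<inter> Linfty) \<or>
           (\<phi> \<in> Lp 2 \<inter> Lp 4 \<and> \<psi> \<in> Lp 2 \<inter> Lp 4)"
  shows "(\<lambda>x. cnj (\<phi> x) * \<psi> x) \<in> Lp 2"
proof -
  have phi: "\<phi> \<in> Lp 2" and psi: "\<psi> \<in> Lp 2" using assms by auto
  have [measurable]: "\<phi> \<in> borel_measurable lebesgue" "\<psi> \<in> borel_measurable lebesgue"
    using phi psi by (auto simp: Lp2_measurable)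
  have m: "(\<lambda>x. cnj (\<phi> x) * \<psi> x) \<in> borel_measurable lebesgue" by measurable
  from assms show ?thesis
  proof
    assume "\<exists>\<epsilon>>0. \<phi> \<in> Lp 2 \<inter> Lp (2 + \<epsilon>) \<and> \<psi> \<in> Lp 2 \<inter> Linfty"
    then obtain C where "AE x in lebesgue. norm (\<psi> x) \<le> C" by (auto simp: Linfty_def)
    then have "AE x in lebesgue. norm (cnj (\<phi> x) * \<psi> x) \<le> C * norm (\<phi> x)"
      by eventually_elim (use mult_right_mono[OF _ norm_ge_zero] in \<open>fastforce simp: norm_mult mult.commute\<close>)
    then show ?thesis by (rule Lp2_bound[OF m phi])
  next
    assume "\<phi> \<in> Lp 2 \<inter> Lp 4 \<and> \<psi> \<in> Lp 2 \<inter> Lp 4"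
    then have "integrable lebesgue (\<lambda>x. norm (\<phi> x) ^ 4)" "integrable lebesgue (\<lambda>x. norm (\<psi> x) ^ 4)"
      by (auto simp: Lp_def)
    then have i: "integrable lebesgue (\<lambda>x. norm (\<phi> x) ^ 4 + norm (\<psi> x) ^ 4)" by simp
    have "integrable lebesgue (\<lambda>x. (norm (cnj (\<phi> x) * \<psi> x))\<^sup>2)"
    proof (rule Bochner_Integration.integrable_bound[OF i])
      show "AE x in lebesgue. norm ((norm (cnj (\<phi> x) * \<psi> x))\<^sup>2) \<le> norm (norm (\<phi> x) ^ 4 + norm (\<psi> x) ^ 4)"
      proof (rule AE_I2)
        fix x
        have "2 * ((norm (\<phi> x))\<^sup>2 * (norm (\<psi> x))\<^sup>2) \<le> ((norm (\<phi> x))\<^sup>2)\<^sup>2 + ((norm (\<psi> x))\<^sup>2)\<^sup>2"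
          using sum_squares_bound[of "(norm (\<phi> x))\<^sup>2" "(norm (\<psi> x))\<^sup>2"] by simp
        moreover have "0 \<le> (norm (\<phi> x))\<^sup>2 * (norm (\<psi> x))\<^sup>2" by simp
        ultimately have "(norm (\<phi> x))\<^sup>2 * (norm (\<psi> x))\<^sup>2 \<le> ((norm (\<phi> x))\<^sup>2)\<^sup>2 + ((norm (\<psi> x))\<^sup>2)\<^sup>2"
          by linarith
        then show "norm ((norm (cnj (\<phi> x) * \<psi> x))\<^sup>2) \<le> norm (norm (\<phi> x) ^ 4 + norm (\<psi> x) ^ 4)"
          by (simp add: norm_mult power_mult_distrib)
      qed
    qed measurable
    then show ?thesis using m by (simp add: Lp2_iff)
  qed
qed

text \<open>Existence of the limit is assumed because \<open>Lim\<close> carries information only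
  there; Plemelj provides it almost everywhere.\<close>

lemma riesz_plus_eq:
  assumes "boundary_values (cauchy_transform f) x L L'"
  shows "2 * pi * \<i> * riesz_plus f x = L"
proof -
  have "complex_of_real x + \<i> * complex_of_real \<epsilon> = Complex x \<epsilon>" for \<epsilon> by (simp add: complex_eq_iff)
  then have "Lim (at_right 0) (\<lambda>\<epsilon>::real. LINT t|lebesgue. f t / (of_real t - (of_real x + \<i> * of_real \<epsilon>))) = L"
    using assms unfolding boundary_values_def cauchy_transform_def by (intro tendsto_Lim) simp_all
  then show ?thesis by (simp add: riesz_plus_def)
qed

text \<open>The construction needs the indicator of the exceptional set in L^2, so the set is cut
  down to a bounded piece.\<close>

lemma bounded_positive_part:
  assumes E: "E \<in> sets lebesgue" "emeasure lebesgue E > 0"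
  obtains n :: nat where "emeasure lebesgue (E \<inter> {- real n..real n}) > 0"
proof (rule ccontr)
  assume "\<not> thesis"
  then have "emeasure lebesgue (E \<inter> {- real n..real n}) = 0" for n :: nat
    using that by (metis not_gr_zero)
  then have "(\<Union>n::nat. E \<inter> {- real n..real n}) \<in> null_sets lebesgue"
    using E(1) by (intro null_sets_UN) (auto simp: null_sets_def)
  moreover have "(\<Union>n::nat. E \<inter> {- real n..real n}) = E"
  proof -
    have "\<exists>n::nat. - real n \<le> x \<and> x \<le> real n" for x :: real
    proof -
      obtain n :: nat where "\<bar>x\<bar> \<le> real n" using real_arch_simple by blast
      then show ?thesis by (intro exI[of _ n]) auto
    qed
    then show ?thesis by auto
  qed
  ultimately show False using E(2) by (simp add: null_sets_def)
qed

text \<open>With \<open>N\<close> and \<open>D\<close> the Cauchy transforms of \<open>cnj \<phi>\<close> and (up to the summand 1) of \<open>cnj \<phi> * \<psi>\<close>, the functions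
  \<open>D - \<psi> N\<close> have no jump across the real line, and vanish on \<open>E\<close>, where alone \<open>G\<close> jumps. Hence \<open>\<psi>\<close> times
  the jump of \<open>N G\<^sup>n\<close> is the jump of \<open>D G\<^sup>n\<close>, for \<open>G = strip_map E\<close>.\<close>

lemma jump_family:
  assumes phi: "\<phi> \<in> Lp 2" and psi: "\<psi> \<in> Lp 2" and pp: "(\<lambda>x. cnj (\<phi> x) * \<psi> x) \<in> Lp 2"
    and E: "E \<in> sets lebesgue" "E \<subseteq> {a..b}"
    and rel: "AE x in lebesgue. x \<in> E \<longrightarrow> (\<forall>L L' M M'. boundary_values (cauchy_transform (\<lambda>x. cnj (\<phi> x))) x L L' \<longrightarrow>
        boundary_values (cauchy_transform (\<lambda>x. cnj (\<phi> x) * \<psi> x)) x M M' \<longrightarrow> 1 + M = \<psi> x * L)"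
  defines "h \<equiv> \<lambda>n. jump (\<lambda>z. cauchy_transform (\<lambda>x. cnj (\<phi> x)) z * strip_map E z ^ Suc n)"
  shows "h n \<in> Lp 2" "(\<lambda>x. \<psi> x * h n x) \<in> Lp 2"
    and "Im z \<noteq> 0 \<Longrightarrow> cauchy_transform (h n) z = cauchy_transform (\<lambda>x. cnj (\<phi> x)) z * strip_map E z ^ Suc n"
    and "Im z \<noteq> 0 \<Longrightarrow> cauchy_transform (\<lambda>x. \<psi> x * h n x) z =
      (1 + cauchy_transform (\<lambda>x. cnj (\<phi> x) * \<psi> x) z) * strip_map E z ^ Suc n"
proof -
  define N where "N = cauchy_transform (\<lambda>x. cnj (\<phi> x))"
  define P where "P = cauchy_transform (\<lambda>x. cnj (\<phi> x) * \<psi> x)"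
  define w where "w = cauchy_transform (indicator E)"
  define G where "G = strip_map E"
  define F where "F z = N z * G z ^ Suc n" for z
  \<comment> \<open>Off the line this is \<open>D * G ^ Suc n\<close>. The summand 1 of
    \<open>D\<close> contributes \<open>G ^ Suc n\<close>, rewritten with one factor
    \<open>w\<close> in the Hardy class and the rest bounded; this accounts for
    \<open>Suc n\<close>.\<close>
  define K where "K z = w z * (strip_inv E z * G z ^ n) + P z * G z ^ Suc n" for z
  note wL = indicator_Lp2[OF E]
  note bc = bounded_class_strip[OF E]
  have hF: "hardy_class F"
    unfolding F_def N_def G_def by (intro hardy_class_mult_bounded hardy_class_cauchy_transform Lp2_cnj phi bounded_class_power bc)
  have hK: "hardy_class K"
    unfolding K_def P_def G_def w_def
    by (intro hardy_class_add hardy_class_mult_bounded hardy_class_cauchy_transform wL pp bounded_class_mult bounded_class_power bc)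
  have hn: "h n = jump F" unfolding h_def F_def[abs_def] N_def G_def by simp
  show hL: "h n \<in> Lp 2" unfolding hn by (rule hardy_class_representation(1)[OF hF])
  show "cauchy_transform (h n) z = cauchy_transform (\<lambda>x. cnj (\<phi> x)) z * strip_map E z ^ Suc n" if "Im z \<noteq> 0"
    unfolding hn hardy_class_representation(2)[OF hF that] F_def N_def G_def ..
  have ae: "AE x in lebesgue. \<psi> x * h n x = jump K x"
    using rel plemelj_Lp2[OF Lp2_cnj[OF phi], unfolded plemelj_def] plemelj_Lp2[OF pp, unfolded plemelj_def]
      plemelj_Lp2[OF wL, unfolded plemelj_def]
  proof eventually_elim
    case (elim x)
    from elim(2) obtain N1 N2 where bN: "boundary_values N x N1 N2" and jN: "N1 - N2 = 2 * pi * \<i> * cnj (\<phi> x)"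
      unfolding N_def by blast
    from elim(3) obtain P1 P2 where bP: "boundary_values P x P1 P2" and jP: "P1 - P2 = 2 * pi * \<i> * (cnj (\<phi> x) * \<psi> x)"
      unfolding P_def by blast
    from elim(4) obtain w1 w2 where bw: "boundary_values w x w1 w2" and jw: "w1 - w2 = 2 * pi * \<i> * indicator E x"
      unfolding w_def by blast
    define G1 where "G1 = 1 + strip_const * (1 / (w1 - strip_const))"
    define G2 where "G2 = 1 + strip_const * (1 / (w2 - strip_const))"
    note sb = strip_boundary_values[OF E bw[unfolded w_def]]
    have bG: "boundary_values G x G1 G2" using sb(4) unfolding G_def G1_def G2_def .
    have wr: "w1 * (1 / (w1 - strip_const)) = G1" "w2 * (1 / (w2 - strip_const)) = G2"
      using sb(1,2) by (simp_all add: G1_def G2_def field_simps)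
    have bF: "boundary_values F x (N1 * G1 ^ Suc n) (N2 * G2 ^ Suc n)"
      unfolding F_def by (intro boundary_values_mult boundary_values_power bN bG)
    have bK: "boundary_values K x (w1 * (1 / (w1 - strip_const) * G1 ^ n) + P1 * G1 ^ Suc n) (w2 * (1 / (w2 - strip_const) * G2 ^ n) + P2 * G2 ^ Suc n)"
      unfolding K_def by (intro boundary_values_add boundary_values_mult boundary_values_power bw bP bG sb(3))
    have K1: "w1 * (1 / (w1 - strip_const) * G1 ^ n) + P1 * G1 ^ Suc n = (1 + P1) * G1 ^ Suc n"
      unfolding mult.assoc[symmetric] wr by (simp add: algebra_simps)
    have K2: "w2 * (1 / (w2 - strip_const) * G2 ^ n) + P2 * G2 ^ Suc n = (1 + P2) * G2 ^ Suc n"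
      unfolding mult.assoc[symmetric] wr by (simp add: algebra_simps)
    \<comment> \<open>The hypothesis \<open>rel\<close> speaks of upper values only; this identity
      transfers it to the lower ones.\<close>
    have nojump: "1 + P1 - \<psi> x * N1 = 1 + P2 - \<psi> x * N2"
    proof -
      have "(1 + P1 - \<psi> x * N1) - (1 + P2 - \<psi> x * N2) = (P1 - P2) - \<psi> x * (N1 - N2)" by (simp add: algebra_simps)
      also have "\<dots> = 0" unfolding jN jP by simp
      finally show ?thesis by (simp only: right_minus_eq)
    qed
    have "((1 + P1) * G1 ^ Suc n - (1 + P2) * G2 ^ Suc n) - \<psi> x * (N1 * G1 ^ Suc n - N2 * G2 ^ Suc n)
        = (1 + P1 - \<psi> x * N1) * G1 ^ Suc n - (1 + P2 - \<psi> x * N2) * G2 ^ Suc n" by (simp add: algebra_simps)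
    also have "\<dots> = (1 + P1 - \<psi> x * N1) * (G1 ^ Suc n - G2 ^ Suc n)" unfolding nojump by (simp add: algebra_simps)
    also have "\<dots> = 0"
    proof (cases "x \<in> E")
      case True
      then have "1 + P1 = \<psi> x * N1" using elim(1) bN bP unfolding N_def P_def by blast
      then show ?thesis by simp
    next
      case False
      then have "w1 = w2" using jw by simp
      then show ?thesis by (simp add: G1_def G2_def)
    qed
    finally have "\<psi> x * (N1 * G1 ^ Suc n - N2 * G2 ^ Suc n) = (1 + P1) * G1 ^ Suc n - (1 + P2) * G2 ^ Suc n" by simp
    then show ?case
      unfolding hn jump_def boundary_values_bv[OF bF] boundary_values_bv[OF bK] K1 K2 by simp
  qed
  have m: "(\<lambda>x. \<psi> x * h n x) \<in> borel_measurable lebesgue"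
    using psi hL by (intro borel_measurable_times Lp2_measurable)
  note JL = hardy_class_representation(1)[OF hK]
  \<comment> \<open>Membership comes from equality with the jump of \<open>K\<close>, without any
    pointwise bound on \<open>\<psi>\<close>.\<close>
  show "(\<lambda>x. \<psi> x * h n x) \<in> Lp 2" by (rule Lp2_cong_AE[OF m JL ae])
  show "cauchy_transform (\<lambda>x. \<psi> x * h n x) z = (1 + cauchy_transform (\<lambda>x. cnj (\<phi> x) * \<psi> x) z) * strip_map E z ^ Suc n"
    if z: "Im z \<noteq> 0"
  proof -
    have "cauchy_transform (\<lambda>x. \<psi> x * h n x) z = K z"
      using cauchy_transform_cong_AE[OF m Lp2_measurable[OF JL] ae] hardy_class_representation(2)[OF hK z] by simp
    also have "\<dots> = (1 + P z) * G z ^ Suc n"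
      unfolding K_def mult.assoc[symmetric] w_def G_def strip_map_eq_mult[OF E z, symmetric] by (simp add: algebra_simps)
    finally show ?thesis unfolding P_def G_def .
  qed
qed

text \<open>If \<open>N\<close> vanished identically, Plemelj would give \<open>\<phi> = 0\<close>
  almost everywhere, so \<open>D = 1\<close> and the relation on \<open>E\<close> would read
  \<open>1 = 0\<close>.\<close>

lemma cauchy_transform_nonvanishing:
  assumes phi: "\<phi> \<in> Lp 2" and pp: "(\<lambda>x. cnj (\<phi> x) * \<psi> x) \<in> Lp 2"
    and E: "E \<in> sets lebesgue" "emeasure lebesgue E > 0"
    and rel: "AE x in lebesgue. x \<in> E \<longrightarrow> (\<forall>L L' M M'. boundary_values (cauchy_transform (\<lambda>x. cnj (\<phi> x))) x L L' \<longrightarrow>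
        boundary_values (cauchy_transform (\<lambda>x. cnj (\<phi> x) * \<psi> x)) x M M' \<longrightarrow> 1 + M = \<psi> x * L)"
  obtains z0 where "Im z0 \<noteq> 0" "cauchy_transform (\<lambda>x. cnj (\<phi> x)) z0 \<noteq> 0"
proof (rule ccontr)
  assume "\<not> thesis"
  then have N0: "\<And>z. Im z \<noteq> 0 \<Longrightarrow> cauchy_transform (\<lambda>x. cnj (\<phi> x)) z = 0" using that by blast
  have bN: "boundary_values (cauchy_transform (\<lambda>x. cnj (\<phi> x))) x 0 0" for x
    unfolding boundary_values_def
    using eventually_Im_nonzero[of x] by (auto intro!: tendsto_eventually elim!: eventually_mono simp: N0)
  have phi0: "AE x in lebesgue. cnj (\<phi> x) = 0"
    using plemelj_Lp2[OF Lp2_cnj[OF phi]] unfolding plemelj_def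
  proof eventually_elim
    case (elim x)
    then show ?case using boundary_values_unique[OF bN[of x]] by fastforce
  qed
  have "cauchy_transform (\<lambda>x. cnj (\<phi> x) * \<psi> x) z = cauchy_transform (\<lambda>x. 0) z" for z
    by (rule cauchy_transform_cong_AE[OF Lp2_measurable[OF pp]]) (use phi0 in auto)
  then have bP: "boundary_values (cauchy_transform (\<lambda>x. cnj (\<phi> x) * \<psi> x)) x 0 0" for x
    unfolding boundary_values_def by (simp add: cauchy_transform_def)
  from rel have "AE x in lebesgue. x \<notin> E"
  proof eventually_elim
    case (elim x)
    then show ?case using bN[of x] bP[of x] by fastforce
  qed
  then have "E \<in> null_sets lebesgue" using E(1) by (simp add: AE_iff_null_sets)
  then show False using E(2) by (simp add: null_sets_def)
qed

text \<open>The Cauchy transform turns a linear relation into \<open>N * p(G) = 0\<close> for a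
  polynomial \<open>p\<close>. Near a point where \<open>N\<close> is nonzero, \<open>G\<close>
  would take values among the finitely many roots of \<open>p\<close>.\<close>

lemma jump_family_independent:
  assumes phi: "\<phi> \<in> Lp 2" and E: "E \<in> sets lebesgue" "E \<subseteq> {a..b}" "emeasure lebesgue E > 0"
    and z0: "Im z0 \<noteq> 0" "cauchy_transform (\<lambda>x. cnj (\<phi> x)) z0 \<noteq> 0"
    and h: "\<And>n. h n \<in> Lp 2"
    and ch: "\<And>n z. Im z \<noteq> 0 \<Longrightarrow> cauchy_transform (h n) z = cauchy_transform (\<lambda>x. cnj (\<phi> x)) z * strip_map E z ^ Suc n"
    and zero: "AE x in lebesgue. (\<Sum>n\<le>m. c n * h n x) = 0" and n: "n \<le> m"
  shows "c n = 0"
proof (rule ccontr)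
  assume "c n \<noteq> 0"
  define N where "N = cauchy_transform (\<lambda>x. cnj (\<phi> x))"
  \<comment> \<open>Degrees are shifted by one because the powers of \<open>G\<close> start at
    1.\<close>
  define p where "p = (\<Sum>k\<le>m. monom (c k) (Suc k))"
  have "coeff p (Suc n) = c n"
  proof -
    have "coeff p (Suc n) = (\<Sum>k\<le>m. if k = n then c k else 0)"
      unfolding p_def by (simp add: coeff_sum)
    then show ?thesis using n by simp
  qed
  then have p0: "p \<noteq> 0" using \<open>c n \<noteq> 0\<close> by auto
  have Np: "N z * poly p (strip_map E z) = 0" if z: "Im z \<noteq> 0" for z
  proof -
    have L: "(\<lambda>x. \<Sum>k\<le>m. c k * h k x) \<in> Lp 2" by (intro Lp2_sum Lp2_cmult h)
    have "0 = cauchy_transform (\<lambda>x. \<Sum>k\<le>m. c k * h k x) z"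
      using cauchy_transform_cong_AE[OF Lp2_measurable[OF L] _ zero] by (simp add: cauchy_transform_def)
    also have "\<dots> = (\<Sum>k\<le>m. c k * (N z * strip_map E z ^ Suc k))"
      by (subst cauchy_transform_sum[OF Lp2_cmult[OF h] z]) (simp only: cauchy_transform_cmult ch[OF z] N_def)
    also have "\<dots> = N z * poly p (strip_map E z)"
      unfolding p_def poly_sum poly_monom sum_distrib_left by (simp only: mult.left_commute)
    finally show ?thesis by simp
  qed
  have cN: "continuous_on {z. Im z \<noteq> 0} N"
    unfolding N_def by (intro holomorphic_on_imp_continuous_on holomorphic_cauchy_transform Lp2_cnj phi) simp
  have op: "open {z. Im z \<noteq> 0}"
    by (intro open_Collect_neq continuous_intros)
  have "open (N -` (- {0}) \<inter> {z. Im z \<noteq> 0})"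
    using cN unfolding continuous_on_open_vimage[OF op] by (simp add: open_Compl)
  moreover have "z0 \<in> N -` (- {0}) \<inter> {z. Im z \<noteq> 0}" using z0 by (simp add: N_def)
  ultimately obtain \<rho> where \<rho>: "0 < \<rho>" "ball z0 \<rho> \<subseteq> N -` (- {0}) \<inter> {z. Im z \<noteq> 0}"
    using open_contains_ball by blast
  have "strip_map E ` ball z0 \<rho> \<subseteq> {x. poly p x = 0}"
    using Np \<rho>(2) by fastforce
  then have "finite (strip_map E ` ball z0 \<rho>)"
    using poly_roots_finite[OF p0] finite_subset by blast
  then show False
    using strip_map_infinite_on_ball[OF E z0(1) \<rho>(1)] \<rho>(2) by blast
qed

text \<open>Almost everywhere equality is removed by passing to representatives in the span of
  \<open>F\<close>, where the usual comparison of an independent family with a finite spanning set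
  applies.\<close>

lemma infinite_dim_aeI:
  assumes f: "\<And>n::nat. f n \<in> V"
    and indep: "\<And>m c n. AE x in lebesgue. (\<Sum>k\<le>m. c k * f k x) = 0 \<Longrightarrow> n \<le> m \<Longrightarrow> c n = 0"
  shows "infinite_dim_ae V"
  unfolding infinite_dim_ae_def
proof
  assume "\<exists>F. finite F \<and> F \<subseteq> V \<and> (\<forall>f \<in> V. \<exists>g \<in> cfun.span F. AE x in lebesgue. f x = g x)"
  then obtain F where F: "finite F" "\<And>f. f \<in> V \<Longrightarrow> \<exists>g \<in> cfun.span F. AE x in lebesgue. f x = g x" by blast
  have "\<forall>n. \<exists>g. g \<in> cfun.span F \<and> (AE x in lebesgue. f n x = g x)" using F(2)[OF f] by blast
  from choice[OF this] obtain g where g: "\<And>n. g n \<in> cfun.span F" "\<And>n. AE x in lebesgue. f n x = g n x" by blast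
  \<comment> \<open>The indices from 0 to \<open>m\<close> give one function more than
    \<open>F\<close> can accommodate.\<close>
  define m where "m = card F"
  have lin: "c n = 0" if "(\<Sum>k\<le>m. cscale (c k) (g k)) = 0" "n \<le> m" for c n
  proof (rule indep[OF _ that(2)])
    have ev: "(\<Sum>k\<in>I. cscale (c k) (g k)) x = (\<Sum>k\<in>I. c k * g k x)" for x and I :: "nat set"
      by (induction I rule: infinite_finite_induct) (auto simp: cscale_def)
    have "AE x in lebesgue. \<forall>n. f n x = g n x" using g(2) by (simp add: AE_all_countable)
    then show "AE x in lebesgue. (\<Sum>k\<le>m. c k * f k x) = 0"
    proof eventually_elim
      case (elim x)
      then have "(\<Sum>k\<le>m. c k * f k x) = (\<Sum>k\<le>m. cscale (c k) (g k)) x" unfolding ev by simp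
      then show ?case using that(1) by simp
    qed
  qed
  \<comment> \<open>Independence is a property of the set of representatives, so coincidences must
    be excluded before counting.\<close>
  have inj: "inj_on g {..m}"
  proof (rule inj_onI, rule ccontr)
    fix i j assume ij: "i \<in> {..m}" "j \<in> {..m}" "g i = g j" "i \<noteq> j"
    define c where "c k = (if k = i then 1 else if k = j then -1 else (0::complex))" for k
    have "(\<Sum>k\<le>m. cscale (c k) (g k)) = (\<Sum>k\<in>{i, j}. cscale (c k) (g k))"
      by (rule sum.mono_neutral_right) (use ij in \<open>auto simp: c_def cfun.scale_zero_left\<close>)
    also have "\<dots> = 0" using ij by (simp add: c_def cfun.scale_minus_left)
    finally have "c i = 0" by (rule lin) (use ij in simp)
    then show False by (simp add: c_def)
  qed
  have "cfun.independent (g ` {..m})"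
  proof
    assume "cfun.dependent (g ` {..m})"
    then obtain u where u: "\<exists>v\<in>g ` {..m}. u v \<noteq> 0" "(\<Sum>v\<in>g ` {..m}. cscale (u v) v) = 0"
      using cfun.dependent_finite[of "g ` {..m}"] by auto
    have "(\<Sum>k\<le>m. cscale (u (g k)) (g k)) = 0"
      using u(2) by (simp add: sum.reindex[OF inj])
    from lin[OF this] u(1) show False by auto
  qed
  moreover have "g ` {..m} \<subseteq> cfun.span F" using g(1) by auto
  ultimately have "card (g ` {..m}) \<le> card F"
    using cfun.independent_span_bound[OF F(1)] by blast
  then show False using card_image[OF inj] by (simp add: m_def)
qed

theorem theorem5p14:
  fixes \<phi> \<psi> :: "real \<Rightarrow> complex" and \<alpha> :: complex
  assumes "(\<exists>\<epsilon>>0. \<phi> \<in> Lp 2 \<inter> Lp (2 + \<epsilon>) \<and> \<psi> \<in> Lp 2 \<inter> Linfty) \<or>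
           (\<phi> \<in> Lp 2 \<inter> Lp 4 \<and> \<psi> \<in> Lp 2 \<inter> Lp 4)"
    and "\<alpha> \<in> exceptional_set \<phi> \<psi>"
  shows "infinite_dim_ae (L2_orth_compl (detectable_space \<phi> (\<lambda>x. \<alpha> * \<psi> x)))"
proof -
  define \<xi> where "\<xi> x = \<alpha> * \<psi> x" for x
  have phi: "\<phi> \<in> Lp 2" and psi: "\<psi> \<in> Lp 2" using assms(1) by auto
  have pp: "(\<lambda>x. cnj (\<phi> x) * \<psi> x) \<in> Lp 2" by (rule Lp2_cnj_mult[OF assms(1)])
  have chi: "\<xi> \<in> Lp 2" unfolding \<xi>_def[abs_def] by (rule Lp2_cmult[OF psi])
  have pc_eq: "(\<lambda>x. cnj (\<phi> x) * \<xi> x) = (\<lambda>x. \<alpha> * (cnj (\<phi> x) * \<psi> x))" by (simp add: \<xi>_def ac_simps)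
  have pc: "(\<lambda>x. cnj (\<phi> x) * \<xi> x) \<in> Lp 2" unfolding pc_eq by (rule Lp2_cmult[OF pp])
  obtain E0 where E0: "E0 \<in> sets lebesgue" "emeasure lebesgue E0 > 0"
    "AE k in lebesgue. k \<in> E0 \<longrightarrow> 1 + 2 * of_real pi * \<i> * \<alpha> *
      (riesz_plus (\<lambda>x. cnj (\<phi> x) * \<psi> x) k - \<psi> k * riesz_plus (\<lambda>x. cnj (\<phi> x)) k) = 0"
    using assms(2) unfolding exceptional_set_def by blast
  obtain n where n: "emeasure lebesgue (E0 \<inter> {- real n..real n}) > 0"
    using bounded_positive_part[OF E0(1,2)] by blast
  define E where "E = E0 \<inter> {- real n..real n}"
  have E: "E \<in> sets lebesgue" "E \<subseteq> {- real n..real n}" "emeasure lebesgue E > 0"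
    using E0(1) n by (auto simp: E_def)
  have rel: "AE x in lebesgue. x \<in> E \<longrightarrow> (\<forall>L L' M M'. boundary_values (cauchy_transform (\<lambda>x. cnj (\<phi> x))) x L L' \<longrightarrow>
        boundary_values (cauchy_transform (\<lambda>x. cnj (\<phi> x) * \<xi> x)) x M M' \<longrightarrow> 1 + M = \<xi> x * L)"
    using E0(3) plemelj_Lp2[OF pp, unfolded plemelj_def]
  proof (eventually_elim, intro impI allI)
    fix x L L' M M'
    assume 1: "x \<in> E0 \<longrightarrow> 1 + 2 * of_real pi * \<i> * \<alpha> *
      (riesz_plus (\<lambda>x. cnj (\<phi> x) * \<psi> x) x - \<psi> x * riesz_plus (\<lambda>x. cnj (\<phi> x)) x) = 0"
      and 2: "\<exists>L L'. boundary_values (cauchy_transform (\<lambda>x. cnj (\<phi> x) * \<psi> x)) x L L' \<and> L - L' = 2 * pi * \<i> * (cnj (\<phi> x) * \<psi> x)"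
      and 3: "x \<in> E" "boundary_values (cauchy_transform (\<lambda>x. cnj (\<phi> x))) x L L'"
        "boundary_values (cauchy_transform (\<lambda>x. cnj (\<phi> x) * \<xi> x)) x M M'"
    from 2 obtain Q Q' where Q: "boundary_values (cauchy_transform (\<lambda>x. cnj (\<phi> x) * \<psi> x)) x Q Q'" by blast
    have "boundary_values (cauchy_transform (\<lambda>x. cnj (\<phi> x) * \<xi> x)) x (\<alpha> * Q) (\<alpha> * Q')"
      using boundary_values_mult[OF boundary_values_const Q, of \<alpha>] unfolding pc_eq cauchy_transform_cmult[abs_def] .
    then have M: "M = \<alpha> * Q" using boundary_values_unique[OF 3(3)] by blast
    have "0 = 1 + 2 * of_real pi * \<i> * \<alpha> *
      (riesz_plus (\<lambda>x. cnj (\<phi> x) * \<psi> x) x - \<psi> x * riesz_plus (\<lambda>x. cnj (\<phi> x)) x)"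
      using 1 3(1) by (simp add: E_def)
    also have "\<dots> = 1 + \<alpha> * (2 * pi * \<i> * riesz_plus (\<lambda>x. cnj (\<phi> x) * \<psi> x) x) - \<alpha> * \<psi> x * (2 * pi * \<i> * riesz_plus (\<lambda>x. cnj (\<phi> x)) x)"
      by (simp add: algebra_simps)
    also have "\<dots> = 1 + M - \<xi> x * L"
      unfolding riesz_plus_eq[OF Q] riesz_plus_eq[OF 3(2)] M \<xi>_def ..
    finally show "1 + M = \<xi> x * L" by simp
  qed
  define h where "h n = jump (\<lambda>z. cauchy_transform (\<lambda>x. cnj (\<phi> x)) z * strip_map E z ^ Suc n)" for n
  note jf = jump_family[OF phi chi pc E(1,2) rel, folded h_def]
  obtain z0 where z0: "Im z0 \<noteq> 0" "cauchy_transform (\<lambda>x. cnj (\<phi> x)) z0 \<noteq> 0"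
    using cauchy_transform_nonvanishing[OF phi pc E(1,3) rel] by blast
  define V where "V = (\<Union>B. \<Union>\<mu> \<in> rho_A \<phi> \<xi> B. range (solution_op \<phi> \<xi> \<mu> B))"
  have VL: "V \<subseteq> Lp 2"
    unfolding V_def using friedrichs_domD(1)[OF solution_op_solves(1)[OF phi chi]] by auto
  \<comment> \<open>\<open>kernel_annihilated\<close> is bilinear whereas \<open>L2_inner\<close>
    conjugates its second argument; hence \<open>cnj (h n)\<close>.\<close>
  have mem: "(\<lambda>x. cnj (h n x)) \<in> L2_orth_compl (L2_closed_span V)" for n
  proof (rule orth_compl_closed_span[OF VL Lp2_cnj[OF jf(1)]])
    fix u assume "u \<in> V"
    then obtain B \<mu> z where mu: "\<mu> \<in> rho_A \<phi> \<xi> B" and u: "u = solution_op \<phi> \<xi> \<mu> B z"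
      unfolding V_def by blast
    note sol = solution_op_solves[OF phi chi mu, of z, folded u]
    have Im: "Im \<mu> \<noteq> 0" by (rule rho_A_not_real[OF phi mu])
    have "(LINT x|lebesgue. h n x * u x) = 0"
      by (rule kernel_annihilated[OF phi chi pc jf(1,2) Im sol jf(3)[OF Im] jf(4)[OF Im]])
    moreover have "L2_inner (\<lambda>x. cnj (h n x)) u = cnj (LINT x|lebesgue. h n x * u x)"
      unfolding L2_inner_def by (simp only: complex_cnj_mult[symmetric] Bochner_Integration.integral_cnj)
    ultimately show "L2_inner (\<lambda>x. cnj (h n x)) u = 0" by simp
  qed
  have "infinite_dim_ae (L2_orth_compl (L2_closed_span V))"
  proof (rule infinite_dim_aeI[OF mem])
    fix m c and n :: nat
    assume zero: "AE x in lebesgue. (\<Sum>k\<le>m. c k * cnj (h k x)) = 0" and n: "n \<le> m"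
    from zero have "AE x in lebesgue. (\<Sum>k\<le>m. cnj (c k) * h k x) = 0"
    proof eventually_elim
      case (elim x)
      have "(\<Sum>k\<le>m. cnj (c k) * h k x) = cnj (\<Sum>k\<le>m. c k * cnj (h k x))" by simp
      then show ?case using elim by simp
    qed
    from jump_family_independent[OF phi E z0 jf(1) jf(3) this n] have "cnj (c n) = 0" .
    then show "c n = 0" by simp
  qed
  then show ?thesis unfolding V_def detectable_space_def \<xi>_def[abs_def] .
qed

end
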